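(* Let $(u_m,w_m)$ be a minimizing sequence for $I$ with $u_m,w_m\ge0$, i.e. $(u_m,w_m)\in\mathcal{N}$, $N(u_m,w_m)=1$ for all $m$, and $K(u_m,w_m)\to I$. Then there exist a subsequence $(u_{m_j},w_{m_j})$ and sequences $(R_j)\subset(0,\infty)$, $(y_j)\subset\mathbb{R}^4$ such that \[ v_j(x):=R_j^{-1}u_{m_j}(R_j^{-1}(x-y_j)),\qquad z_j(x):=R_j^{-1}w_{m_j}(R_j^{-1}(x-y_j)) \] converge strongly in $\dot H^1(\mathbb{R}^4)\times\dot H^1(\mathbb{R}^4)$ to some $(v,z)\in\mathcal{N}$ which is a minimizer for $I$, i.e. $N(v,z)=1$ and $K(v,z)=I$.
   Context: Real-valued functions. $K(u,w)=\int(|\nabla u|^2+|\nabla w|^2)$, $N(u,w)=\int(\frac1{36}u^4+\frac94w^4+u^2w^2+\frac19u^3w)$, $\mathcal{N}=\{(u,w)\in\dot H^1(\mathbb{R}^4)^2:N(u,w)>0\}$, $I=\inf\{K(u,w):(u,w)\in\mathcal{N},N(u,w)=1\}$. *)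

theory Defs
  imports "HOL-Analysis.Analysis"
begin

type_synonym R4 = "real ^ 4"

definition pderiv4 :: "4 \<Rightarrow> (R4 \<Rightarrow> real) \<Rightarrow> R4 \<Rightarrow> real" where
  "pderiv4 i f x = frechet_derivative f (at x) (axis i 1)"

coinductive smooth4 :: "(R4 \<Rightarrow> real) \<Rightarrow> bool" where
  "(\<forall>x. f differentiable (at x)) \<Longrightarrow> (\<forall>i. smooth4 (pderiv4 i f)) \<Longrightarrow> smooth4 f"

definition test_fun :: "(R4 \<Rightarrow> real) \<Rightarrow> bool" where
  "test_fun \<phi> \<longleftrightarrow> smooth4 \<phi> \<and> compact (closure {x. \<phi> x \<noteq> 0})"

definition weak_grad :: "(R4 \<Rightarrow> real) \<Rightarrow> (R4 \<Rightarrow> R4) \<Rightarrow> bool" where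
  "weak_grad u g \<longleftrightarrow> (\<forall>\<phi> i. test_fun \<phi> \<longrightarrow>
      integrable lebesgue (\<lambda>x. u x * pderiv4 i \<phi> x) \<and>
      integrable lebesgue (\<lambda>x. g x $ i * \<phi> x) \<and>
      (\<integral>x. u x * pderiv4 i \<phi> x \<partial>lebesgue) = - (\<integral>x. g x $ i * \<phi> x \<partial>lebesgue))"

definition L2_grad :: "(R4 \<Rightarrow> real) \<Rightarrow> (R4 \<Rightarrow> R4) \<Rightarrow> bool" where
  "L2_grad u g \<longleftrightarrow> g \<in> borel_measurable lebesgue \<and>
      integrable lebesgue (\<lambda>x. (norm (g x))\<^sup>2) \<and> weak_grad u g"

text \<open>Homogeneous Sobolev space Hdot^1(R^4) = {u in L^4 : grad u in L^2} (critical embedding, 2* = 4).\<close>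
definition Hdot1 :: "(R4 \<Rightarrow> real) set" where
  "Hdot1 = {u. u \<in> borel_measurable lebesgue \<and> integrable lebesgue (\<lambda>x. (u x) ^ 4) \<and>
               (\<exists>g. L2_grad u g)}"

definition grad :: "(R4 \<Rightarrow> real) \<Rightarrow> R4 \<Rightarrow> R4" where
  "grad u = (SOME g. L2_grad u g)"

definition Kfun :: "(R4 \<Rightarrow> real) \<Rightarrow> (R4 \<Rightarrow> real) \<Rightarrow> real" where
  "Kfun u w = (\<integral>x. (norm (grad u x))\<^sup>2 + (norm (grad w x))\<^sup>2 \<partial>lebesgue)"

definition Nfun :: "(R4 \<Rightarrow> real) \<Rightarrow> (R4 \<Rightarrow> real) \<Rightarrow> real" where
  "Nfun u w = (\<integral>x. (1/36) * (u x)^4 + (9/4) * (w x)^4 + (u x)^2 * (w x)^2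
                    + (1/9) * (u x)^3 * w x \<partial>lebesgue)"

definition NN :: "((R4 \<Rightarrow> real) \<times> (R4 \<Rightarrow> real)) set" where
  "NN = {(u, w). u \<in> Hdot1 \<and> w \<in> Hdot1 \<and> Nfun u w > 0}"

definition Iinf :: real where
  "Iinf = Inf {Kfun u w | u w. (u, w) \<in> NN \<and> Nfun u w = 1}"

definition Hdot1_conv :: "(nat \<Rightarrow> R4 \<Rightarrow> real) \<Rightarrow> (R4 \<Rightarrow> real) \<Rightarrow> bool" where
  "Hdot1_conv f v \<longleftrightarrow> (\<lambda>j. \<integral>x. (norm (grad (f j) x - grad v x))\<^sup>2 \<partial>lebesgue) \<longlonglongrightarrow> 0"

end

theory Submission
  imports Defs "HOL-Complex_Analysis.Great_Picard"
begin

text \<open>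
A function with square-integrable weak gradient satisfies
\<open>\<parallel>u(\<cdot> + h) - u\<parallel>\<^sub>2 \<le> |h| \<parallel>\<nabla>u\<parallel>\<^sub>2\<close>. Cutting \<open>f = |u| + |w|\<close> into dyadic slices, this
alone gives the refined Sobolev inequality \<open>\<integral>f\<^sup>4 \<le> C B\<^sup>2 \<parallel>\<nabla>f\<parallel>\<^sub>2\<^sup>2\<close>, where \<open>B\<close> bounds
\<open>r\<close> times the average of \<open>f\<close> over every cube of side \<open>r\<close>. It yields both \<open>I > 0\<close> and, for a
minimizing sequence, scales and centres for which the rescaled pairs keep a fixed amount of mass in
the unit cube. By local compactness a subsequence converges almost everywhere to some
\<open>(v, z) \<noteq> 0\<close>.

The energy splits, \<open>K(v, z) + K(v\<^sub>j - v, z\<^sub>j - z) \<le> K(v\<^sub>j, z\<^sub>j) + o(1)\<close>, and so does the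
quartic functional, by the argument of Brezis and Lieb. Since \<open>K \<ge> I \<surd>N\<close>, the number
\<open>\<theta> = N(v, z) > 0\<close> satisfies \<open>\<surd>\<theta> + \<surd>(1 - \<theta>) \<le> 1\<close>. Hence \<open>\<theta> = 1\<close> and
\<open>K(v\<^sub>j - v, z\<^sub>j - z)\<close> tends to \<open>0\<close>.
\<close>

section \<open>Smooth bump functions\<close>

text \<open>The obstacle is the noncompact group of maps taking u to c u(y + c x), which preserves
  both functionals. The quantity r times (average over a cube of side r) is invariant under the same
  group, so one cube on which it exceeds a fixed bound can be moved to the unit cube. One such cube
  per index is enough: no concentration function is maximized. Vanishing is then excluded by the
  mass in the unit cube, and dichotomy by the strict concavity of the square root, whose exponent
  1/2 is the ratio of the degrees of \<open>Kfun\<close> and \<open>Nfun\<close>. Of a weak gradient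
  the analysis uses uniqueness, linearity, rescaling, the translation bound and closedness under
  local L^1 convergence. No smooth mollification, no chain rule for |u| and no weak compactness in
  L^2 enter. Translation bounds are stated for Borel representatives as nonnegative integrals over
  \<open>lborel\<close>, so that Fubini and Fatou apply without integrability conditions. Gradients
  and the two functionals stay over \<open>lebesgue\<close>.\<close>

fun ck :: "nat \<Rightarrow> (R4 \<Rightarrow> real) \<Rightarrow> bool" where
  "ck 0 f \<longleftrightarrow> True"
| "ck (Suc n) f \<longleftrightarrow> (\<forall>x. f differentiable (at x)) \<and> (\<forall>i. ck n (pderiv4 i f))"

lemma smooth4_imp_ck: "smooth4 f \<Longrightarrow> ck n f"
proof (induction n arbitrary: f)
  case (Suc n)
  then show ?case by (auto elim: smooth4.cases)
qed simp

text \<open>The product rule turns one function into a sum of products, so a direct coinduction for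
  \<open>smooth4\<close> would need an invariant closed under sums and products. Finite orders of
  differentiability reduce these closure properties to induction on the order.\<close>

lemma smooth4_iff_ck: "smooth4 f \<longleftrightarrow> (\<forall>n. ck n f)"
proof
  assume "\<forall>n. ck n f"
  then show "smooth4 f"
  proof (coinduction arbitrary: f)
    case smooth4
    then have "ck (Suc n) f" for n by blast
    then show ?case by auto
  qed
qed (simp add: smooth4_imp_ck)

lemma smooth4_differentiable: "smooth4 f \<Longrightarrow> f differentiable (at x)"
  and smooth4_pderiv4: "smooth4 f \<Longrightarrow> smooth4 (pderiv4 i f)"
  by (auto elim: smooth4.cases)

lemma smooth4_isCont: "smooth4 f \<Longrightarrow> isCont f x"
  using smooth4_differentiable differentiable_imp_continuous_within by blast

lemma smooth4_borel: "smooth4 f \<Longrightarrow> f \<in> borel_measurable borel"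
  by (intro borel_measurable_continuous_onI continuous_at_imp_continuous_on) (simp add: smooth4_isCont)

lemma pderiv4_eqI: "(f has_derivative D) (at x) \<Longrightarrow> pderiv4 i f x = D (axis i 1)"
  unfolding pderiv4_def by (metis frechet_derivative_at)

lemma ck_SucD: "ck (Suc n) f \<Longrightarrow> ck n f"
  by (induction n arbitrary: f) auto

lemma ck_add: "ck n f \<Longrightarrow> ck n g \<Longrightarrow> ck n (\<lambda>x. f x + g x)"
proof (induction n arbitrary: f g)
  case (Suc n)
  have "pderiv4 i (\<lambda>x. f x + g x) = (\<lambda>x. pderiv4 i f x + pderiv4 i g x)" for i
    using Suc.prems
    by (intro ext, subst pderiv4_eqI[OF has_derivative_add[OF frechet_derivative_works[THEN iffD1] frechet_derivative_works[THEN iffD1]]])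
       (auto simp: pderiv4_def)
  with Suc show ?case by auto
qed simp

lemma ck_mult: "ck n f \<Longrightarrow> ck n g \<Longrightarrow> ck n (\<lambda>x. f x * g x)"
proof (induction n arbitrary: f g)
  case (Suc n)
  have "pderiv4 i (\<lambda>x. f x * g x) = (\<lambda>x. f x * pderiv4 i g x + pderiv4 i f x * g x)" for i
    using Suc.prems
    by (intro ext, subst pderiv4_eqI[OF has_derivative_mult[OF frechet_derivative_works[THEN iffD1] frechet_derivative_works[THEN iffD1]]])
       (auto simp: pderiv4_def)
  moreover have "ck n f" "ck n g" using Suc.prems ck_SucD by blast+
  ultimately show ?case using Suc by (auto intro!: ck_add)
qed simp

lemma pderiv4_affine:
  assumes "\<And>x. f differentiable (at x)"
  shows "pderiv4 i (\<lambda>x. f (y + c *\<^sub>R x)) = (\<lambda>x. c * pderiv4 i f (y + c *\<^sub>R x))"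
proof
  fix x
  have 1: "(f has_derivative frechet_derivative f (at (y + c *\<^sub>R x))) (at (y + c *\<^sub>R x))"
    using assms frechet_derivative_works by blast
  have 2: "((\<lambda>x. y + c *\<^sub>R x) has_derivative (\<lambda>h. c *\<^sub>R h)) (at x)"
    by (auto intro!: derivative_eq_intros)
  from has_derivative_compose[OF 2 1] have "pderiv4 i (\<lambda>x. f (y + c *\<^sub>R x)) x
    = frechet_derivative f (at (y + c *\<^sub>R x)) (c *\<^sub>R axis i 1)"
    by (rule pderiv4_eqI)
  also have "\<dots> = c * pderiv4 i f (y + c *\<^sub>R x)"
    using linear_frechet_derivative[of f "at (y + c *\<^sub>R x)"] assms
    by (simp add: pderiv4_def linear_scale)
  finally show "pderiv4 i (\<lambda>x. f (y + c *\<^sub>R x)) x = c * pderiv4 i f (y + c *\<^sub>R x)" .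
qed

lemma differentiable_affine:
  assumes "\<And>x. f differentiable (at x)"
  shows "(\<lambda>x. f (y + c *\<^sub>R x)) differentiable (at (x::'a::real_normed_vector))"
  by (rule differentiable_compose[of f, OF assms]) (auto intro!: derivative_intros)

lemma ck_const: "ck n (\<lambda>x. c)"
proof (induction n arbitrary: c)
  case (Suc n)
  have "pderiv4 i (\<lambda>x. c) = (\<lambda>x. 0)" for i
    by (intro ext, subst pderiv4_eqI[OF has_derivative_const]) simp
  with Suc show ?case by simp
qed simp

lemma ck_affine: "ck n f \<Longrightarrow> ck n (\<lambda>x. f (y + c *\<^sub>R x))"
proof (induction n arbitrary: f)
  case (Suc n)
  then show ?case
    by (auto simp: pderiv4_affine intro!: differentiable_affine ck_mult ck_const)
qed simp

lemma smooth4_affine: "smooth4 f \<Longrightarrow> smooth4 (\<lambda>x. f (y + c *\<^sub>R x))"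
  by (simp add: smooth4_iff_ck ck_affine)

lemma smooth4_mult: "smooth4 f \<Longrightarrow> smooth4 g \<Longrightarrow> smooth4 (\<lambda>x. f x * g x)"
  by (simp add: smooth4_iff_ck ck_mult)

lemma smooth4_const: "smooth4 (\<lambda>x. c)"
  by (simp add: smooth4_iff_ck ck_const)

lemma smooth4_prod: "finite S \<Longrightarrow> (\<And>i. i \<in> S \<Longrightarrow> smooth4 (f i)) \<Longrightarrow> smooth4 (\<lambda>x. \<Prod>i\<in>S. f i x)"
  by (induction S rule: finite_induct) (auto intro!: smooth4_mult simp: smooth4_const)

text \<open>The classical flat function exp(-1/t), extended by zero, is not closed under
  differentiation by itself; with an arbitrary polynomial in 1/t as a factor the family is.\<close>

definition hexp :: "real poly \<Rightarrow> real \<Rightarrow> real" where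
  "hexp p t = (if t > 0 then poly p (1 / t) * exp (- (1 / t)) else 0)"

lemma poly_times_exp_neg_tendsto_0: "((\<lambda>x. poly p x * exp (- x)) \<longlongrightarrow> 0) (at_top :: real filter)"
proof (induction p)
  case (pCons a p)
  have 1: "((\<lambda>x. x ^ n * exp (- x)) \<longlongrightarrow> 0) (at_top :: real filter)" for n
    using tendsto_power_div_exp_0[of n] by (simp add: exp_minus field_simps)
  have "((\<lambda>x. a * (x^0 * exp (- x)) + (\<Sum>i\<le>degree p. coeff p i * (x ^ Suc i * exp (- x)))) \<longlongrightarrow> a * 0 + (\<Sum>i\<le>degree p. coeff p i * 0)) (at_top :: real filter)"
    by (intro tendsto_intros 1)
  moreover have "a * (x^0 * exp (- x)) + (\<Sum>i\<le>degree p. coeff p i * (x ^ Suc i * exp (- x))) = poly (pCons a p) x * exp (- x)" for x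
    by (simp add: poly_altdef[of p] sum_distrib_left sum_distrib_right algebra_simps)
  ultimately show ?case by simp
qed simp

text \<open>With s = 1/t the derivative in t is -s^2 times the derivative in s, so p(s) exp(-s)
  becomes s^2 (p - p')(s) exp(-s). At 0 the right difference quotient is s p(s) exp(-s), which tends
  to 0.\<close>

lemma hexp_DERIV:
  "(hexp p has_real_derivative hexp ([:0,0,1:] * (p - pderiv p)) t) (at t)"
proof (cases t "0::real" rule: linorder_cases)
  case less
  have "((\<lambda>_. 0) has_real_derivative 0) (at t)" by simp
  then show ?thesis
    by (rule DERIV_cong_ev[THEN iffD1, rotated 3])
       (use less in \<open>auto simp: hexp_def eventually_nhds intro!: exI[of _ "{..<0}"]\<close>)
next
  case greater
  have "((\<lambda>t. poly p (1 / t) * exp (- (1 / t))) has_real_derivative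
     hexp ([:0,0,1:] * (p - pderiv p)) t) (at t)"
    using greater by (auto intro!: derivative_eq_intros poly_DERIV[THEN DERIV_chain2]
      simp: hexp_def field_simps power2_eq_square)
  then show ?thesis
    by (rule DERIV_cong_ev[THEN iffD1, rotated 3])
       (use greater in \<open>auto simp: hexp_def eventually_nhds intro!: exI[of _ "{0<..}"]\<close>)
next
  case equal
  have "((\<lambda>x. poly ([:0,1:] * p) x * exp (- x)) \<longlongrightarrow> 0) (at_top :: real filter)"
    by (rule poly_times_exp_neg_tendsto_0)
  then have "((\<lambda>x. poly ([:0,1:] * p) (inverse x) * exp (- inverse x)) \<longlongrightarrow> 0) (at_right (0::real))"
    using filterlim_compose filterlim_inverse_at_top_right by blast
  then have r: "((\<lambda>x. hexp p x / x) \<longlongrightarrow> 0) (at_right 0)"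
    by (rule Lim_transform_eventually)
       (auto simp: eventually_at_right_field hexp_def field_simps intro!: exI[of _ 1])
  have l: "((\<lambda>x. hexp p x / x) \<longlongrightarrow> 0) (at_left 0)"
    by (rule Lim_transform_eventually[of "\<lambda>_. 0"])
       (auto simp: eventually_at_left_field hexp_def intro!: exI[of _ "-1"])
  from l r have "((\<lambda>x. hexp p x / x) \<longlongrightarrow> 0) (at 0)"
    by (simp add: filterlim_at_split)
  then show ?thesis using equal by (simp add: DERIV_def hexp_def)
qed

lemma smooth4_hexp_coord: "smooth4 (\<lambda>x. hexp p (a + b * x $ i))"
proof -
  have "ck n (\<lambda>x. hexp p (a + b * x $ i))" for n
  proof (induction n arbitrary: p)
    case (Suc n)
    have d: "((\<lambda>x. hexp p (a + b * x $ i)) has_derivative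
       (\<lambda>h. b * h $ i * hexp ([:0,0,1:] * (p - pderiv p)) (a + b * x $ i))) (at x)" for x :: R4
      by (rule has_derivative_compose[OF _ hexp_DERIV[unfolded has_field_derivative_def], THEN has_derivative_eq_rhs])
         (auto intro!: derivative_eq_intros bounded_linear.has_derivative[OF bounded_linear_vec_nth])
    have "pderiv4 j (\<lambda>x. hexp p (a + b * x $ i))
       = (\<lambda>x. b * axis j 1 $ i * hexp ([:0,0,1:] * (p - pderiv p)) (a + b * x $ i))" for j
      by (intro ext pderiv4_eqI d)
    moreover have "(\<lambda>x. hexp p (a + b * x $ i)) differentiable (at x)" for x :: R4
      using d differentiable_def by blast
    ultimately show ?case by (simp add: ck_mult ck_const Suc del: mult_pCons_left)
  qed simp
  then show ?thesis by (simp add: smooth4_iff_ck)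
qed

text \<open>The factor \<open>n\<close> sharpens the edges: the function is nonzero exactly on the
  open box for each \<open>n > 0\<close> and tends to the indicator of the box as \<open>n\<close>
  grows.\<close>

definition bump :: "real \<Rightarrow> R4 \<Rightarrow> R4 \<Rightarrow> R4 \<Rightarrow> real" where
  "bump n a b x = (\<Prod>i\<in>UNIV. hexp 1 (n * (x $ i - a $ i)) * hexp 1 (n * (b $ i - x $ i)))"

lemma bump_smooth: "smooth4 (bump n a b)"
proof -
  have "smooth4 (\<lambda>x. \<Prod>i\<in>UNIV. hexp 1 (- n * a $ i + n * x $ i) * hexp 1 (n * b $ i + (-n) * x $ i))"
    by (intro smooth4_prod smooth4_mult smooth4_hexp_coord) auto
  then show ?thesis
    by (simp add: bump_def[abs_def] algebra_simps)
qed

lemma bump_nonneg: "0 \<le> bump n a b x" and bump_le_1: "bump n a b x \<le> 1"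
  unfolding bump_def by (auto intro!: prod_nonneg prod_le_1 mult_le_one simp: hexp_def)

lemma bump_nz_iff: "0 < n \<Longrightarrow> bump n a b x \<noteq> 0 \<longleftrightarrow> x \<in> box a b"
  by (auto simp: bump_def hexp_def mem_box_cart zero_less_mult_iff split: if_splits)

lemma bump_test_fun: "0 < n \<Longrightarrow> test_fun (bump n a b)"
  unfolding test_fun_def
  using bump_nz_iff[of n a b] bump_smooth[of n a b] by (auto intro!: compact_closure[THEN iffD2] bounded_subset[OF bounded_box])

lemma bump_tendsto: "(\<lambda>n. bump (real (Suc n)) a b x) \<longlonglongrightarrow> indicator (box a b) x"
proof (cases "x \<in> box a b")
  case False
  then show ?thesis using bump_nz_iff[of "real (Suc _)" a b x] by simp
next
  case True
  have *: "(\<lambda>n. hexp 1 (real (Suc n) * t)) \<longlonglongrightarrow> 1" if "t > 0" for t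
  proof -
    have "(\<lambda>n. exp (- (1 / t * (1 / real (Suc n))))) \<longlonglongrightarrow> exp (- (1 / t * 0))"
      by (intro tendsto_intros LIMSEQ_Suc[OF lim_1_over_n])
    moreover have "0 < t * real (Suc n)" for n using that by simp
    ultimately show ?thesis by (simp add: hexp_def mult.commute)
  qed
  have "(\<lambda>n. bump (real (Suc n)) a b x) \<longlonglongrightarrow> (\<Prod>i\<in>(UNIV::4 set). 1 * 1)"
    unfolding bump_def by (intro tendsto_intros *) (use True in \<open>auto simp: mem_box_cart\<close>)
  then show ?thesis using True by simp
qed

text \<open>Every point of the inner box is at least 1 away from each of the eight faces of the
  enlarged box, and each face contributes a factor of at least exp(-1).\<close>

lemma bump_lower_bound:
  assumes "x \<in> cbox a b"
  shows "exp (-8) \<le> bump 1 (a - (\<chi> i. 1)) (b + (\<chi> i. 1)) x"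
proof -
  have *: "exp (-1) \<le> hexp 1 t" if "t \<ge> 1" for t
    using that by (simp add: hexp_def)
  have "exp (-8) = (\<Prod>i\<in>(UNIV::4 set). exp (-1) * exp (-1::real))"
    by (simp flip: exp_add exp_of_nat_mult)
  also have "\<dots> \<le> bump 1 (a - (\<chi> i. 1)) (b + (\<chi> i. 1)) x"
    unfolding bump_def
    by (intro prod_mono conjI mult_mono *) (use assms in \<open>auto simp: mem_box_cart intro: order_trans[OF _ *]\<close>)
  finally show ?thesis .
qed

section \<open>Test functions\<close>

lemma test_fun_iff: "test_fun \<phi> \<longleftrightarrow> smooth4 \<phi> \<and> bounded {x. \<phi> x \<noteq> 0}"
  by (auto simp: test_fun_def compact_closure)

lemma test_fun_smooth4: "test_fun \<phi> \<Longrightarrow> smooth4 \<phi>"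
  by (simp add: test_fun_def)

lemma test_fun_borel: "test_fun \<phi> \<Longrightarrow> \<phi> \<in> borel_measurable borel"
  by (simp add: test_fun_def smooth4_borel)

lemma test_fun_affine:
  assumes "test_fun \<phi>" "c \<noteq> 0" shows "test_fun (\<lambda>x. \<phi> (y + c *\<^sub>R x))"
proof -
  have "{x. \<phi> (y + c *\<^sub>R x) \<noteq> 0} = (\<lambda>z. (1/c) *\<^sub>R (z - y)) ` {x. \<phi> x \<noteq> 0}"
    using assms(2) by (auto simp: image_iff intro!: exI[of _ "y + c *\<^sub>R _"])
  moreover have "bounded ((\<lambda>z. (1/c) *\<^sub>R (z - y)) ` {x. \<phi> x \<noteq> 0})"
    using bounded_scaling[OF bounded_translation[of "{x. \<phi> x \<noteq> 0}" "-y"], of "1/c"] assms(1)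
    by (simp add: test_fun_iff image_image)
  ultimately show ?thesis using assms by (simp add: test_fun_iff smooth4_affine)
qed

text \<open>Off the closed support the function vanishes on a neighbourhood, so its derivatives
  vanish there too and the support does not grow.\<close>

lemma test_fun_pderiv4:
  assumes "test_fun \<phi>" shows "test_fun (pderiv4 i \<phi>)"
proof -
  have "pderiv4 i \<phi> x = 0" if x: "x \<notin> closure {x. \<phi> x \<noteq> 0}" for x
  proof -
    have xc: "x \<in> - closure {x. \<phi> x \<noteq> 0}" using x by blast
    have z: "0 = \<phi> y" if "y \<in> - closure {x. \<phi> x \<noteq> 0}" for y
      using that closure_subset[of "{x. \<phi> x \<noteq> 0}"] by auto
    have o: "open (- closure {x. \<phi> x \<noteq> 0})"
      by (intro open_Compl closed_closure)
    have "(\<phi> has_derivative (\<lambda>_. 0)) (at x)"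
      by (rule has_derivative_transform_within_open[OF has_derivative_const o xc z])
    then show ?thesis by (simp add: pderiv4_eqI)
  qed
  then have "{x. pderiv4 i \<phi> x \<noteq> 0} \<subseteq> closure {x. \<phi> x \<noteq> 0}" by blast
  then show ?thesis using assms bounded_subset compact_imp_bounded
    unfolding test_fun_def[of \<phi>] test_fun_iff[of "pderiv4 i \<phi>"] by (blast intro: smooth4_pderiv4)
qed

lemma test_fun_lincomb:
  assumes "\<And>i. test_fun (f i)" shows "test_fun (\<lambda>x. \<Sum>i\<in>(UNIV :: 'n::finite set). c i * f i x)"
proof -
  have "ck n (\<lambda>x. \<Sum>i\<in>S. c i * f i x)" if "finite S" for n and S :: "'n set"
    using that
  proof (induction S rule: finite_induct)
    case (insert i S)
    then show ?case using test_fun_smooth4[OF assms] by (simp add: ck_add ck_mult ck_const smooth4_imp_ck)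
  qed (simp add: ck_const)
  moreover have "bounded {x. (\<Sum>i\<in>UNIV. c i * f i x) \<noteq> 0}"
  proof (rule bounded_subset)
    show "bounded (\<Union>i. {x. f i x \<noteq> 0})" using assms by (intro bounded_UN) (auto simp: test_fun_iff)
    show "{x. (\<Sum>i\<in>UNIV. c i * f i x) \<noteq> 0} \<subseteq> (\<Union>i. {x. f i x \<noteq> 0})"
      using sum.neutral[of UNIV "\<lambda>i. c i * f i _"] by fastforce
  qed
  ultimately show ?thesis by (simp add: test_fun_iff smooth4_iff_ck)
qed

lemma test_fun_bound:
  assumes "test_fun \<phi>"
  obtains C N :: real where "0 < C" "0 < N" "\<And>x. \<bar>\<phi> x\<bar> \<le> C * indicator (cball 0 N) x"
proof -
  have "compact (\<phi> ` closure {x. \<phi> x \<noteq> 0})"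
    using assms by (intro compact_continuous_image continuous_at_imp_continuous_on)
      (auto simp: test_fun_def smooth4_isCont)
  then obtain C where C: "0 < C" "\<And>x. x \<in> closure {x. \<phi> x \<noteq> 0} \<Longrightarrow> \<bar>\<phi> x\<bar> \<le> C"
    by (metis bounded_pos compact_imp_bounded imageI real_norm_def)
  obtain N where N: "0 < N" "\<And>x. \<phi> x \<noteq> 0 \<Longrightarrow> norm x \<le> N"
    using assms unfolding test_fun_iff bounded_pos by blast
  have "\<bar>\<phi> x\<bar> \<le> C * indicator (cball 0 N) x" for x
    using C N closure_subset[of "{x. \<phi> x \<noteq> 0}"] by (cases "\<phi> x = 0") (auto simp: indicator_def subset_eq)
  with C N show ?thesis using that by blast
qed

lemma integrable_lebesgue_iff: "f \<in> borel_measurable borel \<Longrightarrow> integrable lebesgue f \<longleftrightarrow> integrable lborel (f::_ \<Rightarrow> real)"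
  by (rule integrable_completion) simp

lemma integral_lebesgue_eq: "f \<in> borel_measurable borel \<Longrightarrow> integral\<^sup>L lebesgue f = integral\<^sup>L lborel (f::_ \<Rightarrow> real)"
  by (rule integral_completion) simp

text \<open>\<open>ennreal\<close> cuts negative values to 0, so \<open>?p\<close> and
  \<open>?n\<close> are the positive and negative parts of \<open>f\<close>. As densities they give
  measures that agree on open boxes, an intersection-stable generator of the Borel sets, and equal
  measures have almost everywhere equal densities.\<close>

lemma box_integrals_zero_AE:
  fixes f :: "'a::euclidean_space \<Rightarrow> real"
  assumes [measurable]: "f \<in> borel_measurable borel"
    and int: "\<And>a b. integrable lborel (\<lambda>x. indicator (box a b) x * f x)"
    and zero: "\<And>a b. (\<integral>x. indicator (box a b) x * f x \<partial>lborel) = 0"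
  shows "AE x in lborel. f x = 0"
proof -
  let ?p = "\<lambda>x. ennreal (f x)" and ?n = "\<lambda>x. ennreal (- f x)"
  let ?E = "range (\<lambda>(a, b). box a b::'a set)"
  let ?A = "\<lambda>n::nat. box (- (real n *\<^sub>R One)) (real n *\<^sub>R One) :: 'a set"
  have p: "emeasure (density lborel ?p) (box a b) = ennreal (\<integral>x. indicator (box a b) x * max 0 (f x) \<partial>lborel)"
   and n: "emeasure (density lborel ?n) (box a b) = ennreal (\<integral>x. indicator (box a b) x * max 0 (- f x) \<partial>lborel)" 
   and e: "(\<integral>x. indicator (box a b) x * max 0 (f x) \<partial>lborel) = (\<integral>x. indicator (box a b) x * max 0 (- f x) \<partial>lborel)"
   for a b
  proof -
    have i1: "integrable lborel (\<lambda>x. indicator (box a b) x * max 0 (f x))"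
      and i2: "integrable lborel (\<lambda>x. indicator (box a b) x * max 0 (- f x))"
      by (rule Bochner_Integration.integrable_bound[OF int[of a b]], simp, rule AE_I2, simp add: indicator_def)+
    show "emeasure (density lborel ?p) (box a b) = ennreal (\<integral>x. indicator (box a b) x * max 0 (f x) \<partial>lborel)"
      by (subst nn_integral_eq_integral[OF i1, symmetric])
         (auto simp: emeasure_density indicator_def max_def ennreal_neg intro!: nn_integral_cong)
    show "emeasure (density lborel ?n) (box a b) = ennreal (\<integral>x. indicator (box a b) x * max 0 (- f x) \<partial>lborel)"
      by (subst nn_integral_eq_integral[OF i2, symmetric])
         (auto simp: emeasure_density indicator_def max_def ennreal_neg intro!: nn_integral_cong)
    have "(\<integral>x. indicator (box a b) x * max 0 (f x) \<partial>lborel) - (\<integral>x. indicator (box a b) x * max 0 (- f x) \<partial>lborel)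
      = (\<integral>x. indicator (box a b) x * f x \<partial>lborel)"
      by (subst Bochner_Integration.integral_diff[OF i1 i2, symmetric])
         (auto intro!: Bochner_Integration.integral_cong simp: indicator_def)
    then show "(\<integral>x. indicator (box a b) x * max 0 (f x) \<partial>lborel) = (\<integral>x. indicator (box a b) x * max 0 (- f x) \<partial>lborel)"
      by (simp add: zero)
  qed
  have "density lborel ?p = density lborel ?n"
  proof (rule measure_eqI_generator_eq)
    show "Int_stable ?E" by (auto simp: Int_stable_def box_Int_box)
    show "?E \<subseteq> Pow UNIV" "sets (density lborel ?p) = sigma_sets UNIV ?E" "sets (density lborel ?n) = sigma_sets UNIV ?E"
      by (simp_all add: borel_eq_box)
    show "range ?A \<subseteq> ?E" "(\<Union>i. ?A i) = UNIV"
      unfolding UN_box_eq_UNIV by auto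
    show "emeasure (density lborel ?p) (?A i) \<noteq> \<infinity>" for i by (simp only: p) simp
    show "emeasure (density lborel ?p) X = emeasure (density lborel ?n) X" if "X \<in> ?E" for X
      using that by (auto simp: p n e)
  qed
  then have "AE x in lborel. ?p x = ?n x"
    by (subst (asm) sigma_finite_measure.density_unique_iff[OF sigma_finite_lborel]) auto
  then show ?thesis
  proof eventually_elim
    case (elim x)
    then show ?case by (cases "f x" "0::real" rule: linorder_cases) (auto simp: ennreal_neg)
  qed
qed

text \<open>The fundamental lemma of the calculus of variations: sharpened bumps converge,
  dominated, to the indicators of boxes, which leaves a function whose integral over every box is
  zero.\<close>

lemma test_fun_AE_zero:
  assumes f: "f \<in> borel_measurable lebesgue"
    and int: "\<And>\<phi>. test_fun \<phi> \<Longrightarrow> integrable lebesgue (\<lambda>x. f x * \<phi> x)"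
    and zero: "\<And>\<phi>. test_fun \<phi> \<Longrightarrow> (\<integral>x. f x * \<phi> x \<partial>lebesgue) = 0"
  shows "AE x in lebesgue. f x = 0"
proof -
  obtain f' where f'[measurable]: "f' \<in> borel_measurable borel" and ff': "AE x in lborel. f x = f' x"
    using completion_ex_borel_measurable_real[OF f] by auto
  have ffl: "AE x in lebesgue. f x = f' x" using ff' by (rule AE_completion)
  have i: "integrable lborel (\<lambda>x. f' x * \<phi> x)" and z: "(\<integral>x. f' x * \<phi> x \<partial>lborel) = 0" if \<phi>: "test_fun \<phi>" for \<phi>
  proof -
    have [measurable]: "\<phi> \<in> borel_measurable borel" using \<phi> by (rule test_fun_borel)
    have m: "(\<lambda>x. f x * \<phi> x) \<in> borel_measurable lebesgue" "(\<lambda>x. f' x * \<phi> x) \<in> borel_measurable lebesgue"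
      using f by (auto intro!: borel_measurable_times intro: measurable_completion)
    have ae: "AE x in lebesgue. f x * \<phi> x = f' x * \<phi> x" using ffl by eventually_elim simp
    show "integrable lborel (\<lambda>x. f' x * \<phi> x)"
      using integrable_cong_AE[OF m ae] int[OF \<phi>] by (simp add: integrable_lebesgue_iff)
    show "(\<integral>x. f' x * \<phi> x \<partial>lborel) = 0"
      using integral_cong_AE[OF m ae] zero[OF \<phi>] by (simp add: integral_lebesgue_eq)
  qed
  \<comment> \<open>Local integrability is not among the hypotheses. It follows by testing with a
    single bump that is at least exp(-8) on the box.\<close>
  have ic: "integrable lborel (\<lambda>x. indicator (cbox a b) x * f' x)" for a b
  proof (rule Bochner_Integration.integrable_bound)
    let ?b = "bump 1 (a - (\<chi> i. 1)) (b + (\<chi> i. 1))"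
    show "integrable lborel (\<lambda>x. exp 8 * (f' x * ?b x))"
      by (intro integrable_mult_right i bump_test_fun) simp
    have "\<bar>f' x\<bar> \<le> exp 8 * (\<bar>f' x\<bar> * ?b x)" if "x \<in> cbox a b" for x
    proof -
      have "exp 8 * (exp (-8) * \<bar>f' x\<bar>) \<le> exp 8 * (?b x * \<bar>f' x\<bar>)"
        using bump_lower_bound[OF that] by (intro mult_left_mono mult_right_mono) auto
      moreover have "exp 8 * (exp (-8) * \<bar>f' x\<bar>) = \<bar>f' x\<bar>"
        by (simp add: exp_minus)
      ultimately show ?thesis by (simp only: mult.commute[of "?b x"])
    qed
    then show "AE x in lborel. norm (indicator (cbox a b) x * f' x) \<le> norm (exp 8 * (f' x * ?b x))"
      by (auto simp: indicator_def abs_mult bump_nonneg)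
  qed simp
  have ib: "integrable lborel (\<lambda>x. indicator (box a b) x * f' x)" for a b
    by (rule Bochner_Integration.integrable_bound[OF ic[of a b]])
       (use box_subset_cbox[of a b] in \<open>auto simp: indicator_def abs_mult\<close>)
  have zb: "(\<integral>x. indicator (box a b) x * f' x \<partial>lborel) = 0" for a b
  proof -
    have "(\<lambda>n. \<integral>x. f' x * bump (real (Suc n)) a b x \<partial>lborel) \<longlonglongrightarrow> (\<integral>x. indicator (box a b) x * f' x \<partial>lborel)"
    proof (rule integral_dominated_convergence)
      show "integrable lborel (\<lambda>x. \<bar>indicator (box a b) x * f' x\<bar>)" using ib by simp
      show "(\<lambda>x. f' x * bump (real (Suc i)) a b x) \<in> borel_measurable lborel" for i
        using smooth4_borel[OF bump_smooth] by (intro borel_measurable_times) auto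
      show "AE x in lborel. (\<lambda>n. f' x * bump (real (Suc n)) a b x) \<longlonglongrightarrow> indicator (box a b) x * f' x"
        by (intro AE_I2) (subst mult.commute, intro tendsto_intros bump_tendsto)
      have "bump (real (Suc n)) a b x \<le> indicator (box a b) x" for n x
        using bump_le_1[of "real (Suc n)" a b x] bump_nz_iff[of "real (Suc n)" a b x] by (auto simp: indicator_def)
      then show "AE x in lborel. norm (f' x * bump (real (Suc i)) a b x) \<le> \<bar>indicator (box a b) x * f' x\<bar>" for i
        by (auto simp: abs_mult bump_nonneg mult.commute[of _ "\<bar>f' _\<bar>"] intro!: mult_left_mono)
    qed simp
    then show ?thesis
      using z[OF bump_test_fun[of "real (Suc _)" a b]] by (simp add: LIMSEQ_const_iff)
  qed
  have "AE x in lborel. f' x = 0" by (rule box_integrals_zero_AE[OF f' ib zb])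
  then have "AE x in lborel. f x = 0" using ff' by eventually_elim simp
  then show ?thesis by (rule AE_completion)
qed

section \<open>Calculus of weak gradients\<close>

abbreviation energy :: "('a::euclidean_space \<Rightarrow> 'b::euclidean_space) \<Rightarrow> real" where
  "energy g \<equiv> \<integral>x. (norm (g x))\<^sup>2 \<partial>lebesgue"

lemma borel_measurable_lebesgue_affine:
  fixes f :: "'a::euclidean_space \<Rightarrow> 'b::topological_space" and y :: "'a::euclidean_space"
  assumes "f \<in> borel_measurable lebesgue" "c \<noteq> 0"
  shows "(\<lambda>x. f (y + c *\<^sub>R x)) \<in> borel_measurable lebesgue"
proof -
  have "(\<lambda>x. y + c *\<^sub>R x) = (\<lambda>x. y + (\<Sum>j\<in>Basis. (c * (x \<bullet> j)) *\<^sub>R j))"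
    by (simp add: euclidean_representation flip: scaleR_scaleR scaleR_sum_right)
  then have "(\<lambda>x. y + c *\<^sub>R x) \<in> lebesgue \<rightarrow>\<^sub>M lebesgue"
    using lebesgue_affine_measurable[of "\<lambda>_. c" y] assms(2) by simp
  from measurable_compose[OF this assms(1)] show ?thesis .
qed

lemma lebesgue_affine_density:
  fixes y :: "'a::euclidean_space"
  assumes "c \<noteq> 0"
  shows "lebesgue = density (distr lebesgue lebesgue (\<lambda>x. y + c *\<^sub>R x)) (\<lambda>_. ennreal (\<bar>c\<bar> ^ DIM('a)))"
    and "(\<lambda>x. y + c *\<^sub>R x) \<in> lebesgue \<rightarrow>\<^sub>M lebesgue"
proof -
  have *: "(\<lambda>x. y + c *\<^sub>R x) = (\<lambda>x. y + (\<Sum>j\<in>Basis. (c * (x \<bullet> j)) *\<^sub>R j))"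
    by (simp add: euclidean_representation flip: scaleR_scaleR scaleR_sum_right)
  show "lebesgue = density (distr lebesgue lebesgue (\<lambda>x. y + c *\<^sub>R x)) (\<lambda>_. ennreal (\<bar>c\<bar> ^ DIM('a)))"
    using lebesgue_affine_euclidean[of "\<lambda>_. c" y] assms unfolding * by simp
  show "(\<lambda>x. y + c *\<^sub>R x) \<in> lebesgue \<rightarrow>\<^sub>M lebesgue"
    using lebesgue_affine_measurable[of "\<lambda>_. c" y] assms unfolding * by simp
qed

lemma lebesgue_integral_affine:
  fixes f :: "'a::euclidean_space \<Rightarrow> real"
  assumes [measurable]: "f \<in> borel_measurable lebesgue" and c: "c \<noteq> 0"
  shows integrable_lebesgue_affine: "integrable lebesgue (\<lambda>x. f (y + c *\<^sub>R x)) \<longleftrightarrow> integrable lebesgue f"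
    and "(\<integral>x. f (y + c *\<^sub>R x) \<partial>lebesgue) = (\<integral>x. f x \<partial>lebesgue) / \<bar>c\<bar> ^ DIM('a)"
proof -
  note [measurable] = lebesgue_affine_density(2)[OF c, of y]
  show "integrable lebesgue (\<lambda>x. f (y + c *\<^sub>R x)) \<longleftrightarrow> integrable lebesgue f"
    apply (subst (2) lebesgue_affine_density(1)[OF c, of y])
    using c by (subst integrable_density) (auto simp: integrable_distr_eq)
  show "(\<integral>x. f (y + c *\<^sub>R x) \<partial>lebesgue) = (\<integral>x. f x \<partial>lebesgue) / \<bar>c\<bar> ^ DIM('a)"
    apply (subst (2) lebesgue_affine_density(1)[OF c, of y])
    using c by (subst integral_density) (auto simp: integral_distr)
qed

lemma test_fun_borel_lebesgue: "test_fun \<phi> \<Longrightarrow> \<phi> \<in> borel_measurable lebesgue"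
  by (intro measurable_completion) (simp add: test_fun_borel)

lemma weak_gradD:
  assumes "weak_grad u g" "test_fun \<phi>"
  shows "integrable lebesgue (\<lambda>x. u x * pderiv4 i \<phi> x)" "integrable lebesgue (\<lambda>x. g x $ i * \<phi> x)"
    "(\<integral>x. u x * pderiv4 i \<phi> x \<partial>lebesgue) = - (\<integral>x. g x $ i * \<phi> x \<partial>lebesgue)"
  using assms unfolding weak_grad_def by blast+

lemma vec_nth_borel: "(\<lambda>x::real^'n. x $ i) \<in> borel_measurable borel"
  by (intro borel_measurable_continuous_onI continuous_intros)

text \<open>Makes the choice inside \<open>grad\<close> immaterial: energies may be computed with
  whichever weak gradient is at hand.\<close>

lemma L2_grad_unique:
  assumes "L2_grad u g" "L2_grad u g'" shows "AE x in lebesgue. g x = g' x"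
proof -
  have [measurable]: "g \<in> borel_measurable lebesgue" "g' \<in> borel_measurable lebesgue"
    using assms by (auto simp: L2_grad_def)
  note [measurable] = vec_nth_borel
  have "AE x in lebesgue. g x $ i - g' x $ i = 0" for i
  proof (rule test_fun_AE_zero)
    show "(\<lambda>x. g x $ i - g' x $ i) \<in> borel_measurable lebesgue" by measurable
    fix \<phi> assume \<phi>: "test_fun \<phi>"
    have *: "(\<lambda>x. (g x $ i - g' x $ i) * \<phi> x) = (\<lambda>x. g x $ i * \<phi> x - g' x $ i * \<phi> x)"
      by (auto simp: algebra_simps)
    show "integrable lebesgue (\<lambda>x. (g x $ i - g' x $ i) * \<phi> x)"
      "(\<integral>x. (g x $ i - g' x $ i) * \<phi> x \<partial>lebesgue) = 0"
      using weak_gradD[of u g \<phi> i] weak_gradD[of u g' \<phi> i] assms \<phi>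
      unfolding * L2_grad_def by auto
  qed
  then have "AE x in lebesgue. \<forall>i\<in>UNIV. g x $ i - g' x $ i = 0"
    by (intro AE_finite_allI) auto
  then show ?thesis by eventually_elim (simp add: vec_eq_iff)
qed

lemma integrable_norm_lincomb_sq:
  fixes f g :: "'a \<Rightarrow> 'b::euclidean_space"
  assumes [measurable]: "f \<in> borel_measurable M" "g \<in> borel_measurable M"
    and "integrable M (\<lambda>x. (norm (f x))\<^sup>2)" "integrable M (\<lambda>x. (norm (g x))\<^sup>2)"
  shows "integrable M (\<lambda>x. (norm (a *\<^sub>R f x + b *\<^sub>R g x))\<^sup>2)"
proof (rule Bochner_Integration.integrable_bound)
  show "integrable M (\<lambda>x. 2 * a\<^sup>2 * (norm (f x))\<^sup>2 + 2 * b\<^sup>2 * (norm (g x))\<^sup>2)"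
    using assms by (intro Bochner_Integration.integrable_add integrable_mult_right)
  have "(norm (a *\<^sub>R f x + b *\<^sub>R g x))\<^sup>2 \<le> 2 * a\<^sup>2 * (norm (f x))\<^sup>2 + 2 * b\<^sup>2 * (norm (g x))\<^sup>2" for x
  proof -
    have "(norm (a *\<^sub>R f x + b *\<^sub>R g x))\<^sup>2 \<le> (norm (a *\<^sub>R f x) + norm (b *\<^sub>R g x))\<^sup>2"
      by (intro power_mono norm_triangle_ineq) simp
    also have "\<dots> \<le> 2 * (norm (a *\<^sub>R f x))\<^sup>2 + 2 * (norm (b *\<^sub>R g x))\<^sup>2"
      using sum_squares_bound[of "norm (a *\<^sub>R f x)" "norm (b *\<^sub>R g x)"] by (simp add: power2_sum)
    finally show ?thesis by (simp add: power_mult_distrib)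
  qed
  then show "AE x in M. norm ((norm (a *\<^sub>R f x + b *\<^sub>R g x))\<^sup>2) \<le> norm (2 * a\<^sup>2 * (norm (f x))\<^sup>2 + 2 * b\<^sup>2 * (norm (g x))\<^sup>2)"
    by (intro AE_I2) (auto intro: order_trans[OF _ abs_ge_self])
qed measurable

lemma L2_grad_lincomb:
  assumes "L2_grad u g" "L2_grad w k"
  shows "L2_grad (\<lambda>x. a * u x + b * w x) (\<lambda>x. a *\<^sub>R g x + b *\<^sub>R k x)"
proof -
  have [measurable]: "g \<in> borel_measurable lebesgue" "k \<in> borel_measurable lebesgue"
    using assms by (auto simp: L2_grad_def)
  have "weak_grad (\<lambda>x. a * u x + b * w x) (\<lambda>x. a *\<^sub>R g x + b *\<^sub>R k x)"
    unfolding weak_grad_def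
  proof (intro allI impI)
    fix \<phi> i assume \<phi>: "test_fun \<phi>"
    note 1 = weak_gradD[of u g \<phi> i] and 2 = weak_gradD[of w k \<phi> i]
    have e1: "(\<lambda>x. (a * u x + b * w x) * pderiv4 i \<phi> x) = (\<lambda>x. a * (u x * pderiv4 i \<phi> x) + b * (w x * pderiv4 i \<phi> x))"
     and e2: "(\<lambda>x. (a *\<^sub>R g x + b *\<^sub>R k x) $ i * \<phi> x) = (\<lambda>x. a * (g x $ i * \<phi> x) + b * (k x $ i * \<phi> x))"
      by (auto simp: algebra_simps)
    show "integrable lebesgue (\<lambda>x. (a * u x + b * w x) * pderiv4 i \<phi> x) \<and>
       integrable lebesgue (\<lambda>x. (a *\<^sub>R g x + b *\<^sub>R k x) $ i * \<phi> x) \<and>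
       (\<integral>x. (a * u x + b * w x) * pderiv4 i \<phi> x \<partial>lebesgue) = - (\<integral>x. (a *\<^sub>R g x + b *\<^sub>R k x) $ i * \<phi> x \<partial>lebesgue)"
      unfolding e1 e2 using 1 2 assms \<phi> by (auto simp: L2_grad_def)
  qed
  then show ?thesis
    using assms unfolding L2_grad_def by (auto intro!: integrable_norm_lincomb_sq)
qed

lemma L2_grad_cong_AE:
  assumes g: "L2_grad u g" and u': "u' \<in> borel_measurable lebesgue" and ae: "AE x in lebesgue. u x = u' x"
  shows "L2_grad u' g"
proof -
  have "integrable lebesgue (\<lambda>x. u' x * pderiv4 i \<phi> x) \<and>
      (\<integral>x. u' x * pderiv4 i \<phi> x \<partial>lebesgue) = (\<integral>x. u x * pderiv4 i \<phi> x \<partial>lebesgue)" if \<phi>: "test_fun \<phi>" for \<phi> i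
  proof -
    have 1: "integrable lebesgue (\<lambda>x. u x * pderiv4 i \<phi> x)"
      using g \<phi> by (auto simp: L2_grad_def intro: weak_gradD)
    have 2: "(\<lambda>x. u' x * pderiv4 i \<phi> x) \<in> borel_measurable lebesgue"
      by (intro borel_measurable_times u' test_fun_borel_lebesgue[OF test_fun_pderiv4[OF \<phi>]])
    have 3: "AE x in lebesgue. u' x * pderiv4 i \<phi> x = u x * pderiv4 i \<phi> x"
      using ae by eventually_elim simp
    show ?thesis
      using integral_cong_AE[OF 2 borel_measurable_integrable[OF 1] 3]
        integrable_cong_AE[OF 2 borel_measurable_integrable[OF 1] 3] 1 by simp
  qed
  with g show ?thesis unfolding L2_grad_def weak_grad_def by auto
qed

text \<open>This is where the dimension enters the scaling. The gradient gains the factor c^2, its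
  square c^4, and the change of variables in four dimensions gives back c^-4, so the energy is
  invariant.\<close>

lemma L2_grad_affine:
  assumes g: "L2_grad u g" and u: "u \<in> borel_measurable lebesgue" and c: "c > 0"
  shows "L2_grad (\<lambda>x. c * u (y + c *\<^sub>R x)) (\<lambda>x. c\<^sup>2 *\<^sub>R g (y + c *\<^sub>R x))"
    and "(\<integral>x. (norm (c\<^sup>2 *\<^sub>R g (y + c *\<^sub>R x)))\<^sup>2 \<partial>lebesgue) = (energy g)"
proof -
  have gm[measurable]: "g \<in> borel_measurable lebesgue" and gi: "integrable lebesgue (\<lambda>x. (norm (g x))\<^sup>2)"
    and wg: "weak_grad u g"
    using g by (auto simp: L2_grad_def)
  have c0: "c \<noteq> 0" using c by simp
  have m: "(\<lambda>x. (norm (g x))\<^sup>2) \<in> borel_measurable lebesgue" by measurable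
  have e: "(\<lambda>x. (norm (c\<^sup>2 *\<^sub>R g (y + c *\<^sub>R x)))\<^sup>2) = (\<lambda>x. c^4 * (norm (g (y + c *\<^sub>R x)))\<^sup>2)"
    by (simp add: power_mult_distrib flip: power_mult)
  show "(\<integral>x. (norm (c\<^sup>2 *\<^sub>R g (y + c *\<^sub>R x)))\<^sup>2 \<partial>lebesgue) = (energy g)"
    unfolding e using lebesgue_integral_affine(2)[OF m c0, of y] c by simp
  have i2: "integrable lebesgue (\<lambda>x. (norm (c\<^sup>2 *\<^sub>R g (y + c *\<^sub>R x)))\<^sup>2)"
    unfolding e using lebesgue_integral_affine(1)[OF m c0, of y] gi by simp
  have "weak_grad (\<lambda>x. c * u (y + c *\<^sub>R x)) (\<lambda>x. c\<^sup>2 *\<^sub>R g (y + c *\<^sub>R x))"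
    unfolding weak_grad_def
  proof (intro allI impI)
    fix \<phi> i assume \<phi>: "test_fun \<phi>"
    \<comment> \<open>The test function is transported by the inverse affine map, so that the weak
      identity for \<open>u\<close> can be used at \<open>\<psi>\<close> and pulled back.\<close>
    define \<psi> where "\<psi> = (\<lambda>z. \<phi> ((- (1/c)) *\<^sub>R y + (1/c) *\<^sub>R z))"
    have \<psi>: "test_fun \<psi>" unfolding \<psi>_def using \<phi> c by (intro test_fun_affine) auto
    have a: "\<phi> x = \<psi> (y + c *\<^sub>R x)" for x
      using c by (simp add: \<psi>_def scaleR_right_distrib)
    have "pderiv4 i \<psi> = (\<lambda>z. (1/c) * pderiv4 i \<phi> ((- (1/c)) *\<^sub>R y + (1/c) *\<^sub>R z))"
      unfolding \<psi>_def using \<phi> by (intro pderiv4_affine) (simp add: test_fun_smooth4 smooth4_differentiable)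
    then have b: "pderiv4 i \<phi> x = c * pderiv4 i \<psi> (y + c *\<^sub>R x)" for x
      using c by (simp add: scaleR_right_distrib)
    note w = weak_gradD[OF wg \<psi>, of i]
    note w1 = lebesgue_integral_affine[OF borel_measurable_integrable[OF w(1)] c0, of y]
    note w2 = lebesgue_integral_affine[OF borel_measurable_integrable[OF w(2)] c0, of y]
    have e1: "(\<lambda>x. c * u (y + c *\<^sub>R x) * pderiv4 i \<phi> x) = (\<lambda>x. c\<^sup>2 * (u (y + c *\<^sub>R x) * pderiv4 i \<psi> (y + c *\<^sub>R x)))"
      by (auto simp: b power2_eq_square)
    have e2: "(\<lambda>x. (c\<^sup>2 *\<^sub>R g (y + c *\<^sub>R x)) $ i * \<phi> x) = (\<lambda>x. c\<^sup>2 * (g (y + c *\<^sub>R x) $ i * \<psi> (y + c *\<^sub>R x)))"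
      by (auto simp: a)
    show "integrable lebesgue (\<lambda>x. c * u (y + c *\<^sub>R x) * pderiv4 i \<phi> x) \<and>
       integrable lebesgue (\<lambda>x. (c\<^sup>2 *\<^sub>R g (y + c *\<^sub>R x)) $ i * \<phi> x) \<and>
       (\<integral>x. c * u (y + c *\<^sub>R x) * pderiv4 i \<phi> x \<partial>lebesgue) = - (\<integral>x. (c\<^sup>2 *\<^sub>R g (y + c *\<^sub>R x)) $ i * \<phi> x \<partial>lebesgue)"
      unfolding e1 e2 using w w1 w2 by simp
  qed
  with i2 show "L2_grad (\<lambda>x. c * u (y + c *\<^sub>R x)) (\<lambda>x. c\<^sup>2 *\<^sub>R g (y + c *\<^sub>R x))"
    unfolding L2_grad_def using borel_measurable_lebesgue_affine[OF gm c0, of y]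
    by (auto intro!: borel_measurable_scaleR)
qed

lemma L2_grad_grad: "L2_grad u g \<Longrightarrow> L2_grad u (grad u)"
  using someI[of "L2_grad u" g] by (simp add: grad_def)

lemma grad_AE: "L2_grad u g \<Longrightarrow> AE x in lebesgue. grad u x = g x"
  using L2_grad_unique L2_grad_grad by blast

lemma Kfun_eq:
  assumes "L2_grad u g" "L2_grad w k"
  shows "Kfun u w = (energy g) + (energy k)"
proof -
  have m[measurable]: "g \<in> borel_measurable lebesgue" "k \<in> borel_measurable lebesgue"
    "grad u \<in> borel_measurable lebesgue" "grad w \<in> borel_measurable lebesgue"
    using assms L2_grad_grad by (auto simp: L2_grad_def)
  have "Kfun u w = (\<integral>x. (norm (g x))\<^sup>2 + (norm (k x))\<^sup>2 \<partial>lebesgue)"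
    unfolding Kfun_def
  proof (rule integral_cong_AE)
    show "AE x in lebesgue. (norm (grad u x))\<^sup>2 + (norm (grad w x))\<^sup>2 = (norm (g x))\<^sup>2 + (norm (k x))\<^sup>2"
      using grad_AE[OF assms(1)] grad_AE[OF assms(2)] by eventually_elim simp
  qed measurable
  then show ?thesis using assms by (simp add: L2_grad_def)
qed

section \<open>Translation bound for the weak gradient\<close>

text \<open>Jensen's inequality for the square, from the nonnegativity of the variance. A Bochner
  integral that does not exist has the value 0, so the inequality also holds without integrability
  of \<open>f\<close>.\<close>

lemma square_integral_le_nn_integral:
  fixes f :: "'a \<Rightarrow> real"
  assumes M: "emeasure M (space M) = 1" and [measurable]: "f \<in> borel_measurable M"
  shows "ennreal ((\<integral>x. f x \<partial>M)\<^sup>2) \<le> (\<integral>\<^sup>+x. ennreal ((f x)\<^sup>2) \<partial>M)"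
proof (cases "integrable M f \<and> (\<integral>\<^sup>+x. ennreal ((f x)\<^sup>2) \<partial>M) < \<infinity>")
  case False
  then show ?thesis by (auto simp: not_integrable_integral_eq not_less top_unique)
next
  case True
  interpret finite_measure M by standard (simp add: M)
  have m1: "measure M (space M) = 1" using M by (simp add: measure_def)
  have i2: "integrable M (\<lambda>x. (f x)\<^sup>2)"
    using True by (intro integrableI_bounded) auto
  let ?m = "\<integral>x. f x \<partial>M"
  have "0 \<le> (\<integral>x. (f x - ?m)\<^sup>2 \<partial>M)" by simp
  also have "\<dots> = (\<integral>x. (f x)\<^sup>2 - 2 * ?m * f x + ?m\<^sup>2 \<partial>M)"
    by (simp add: power2_diff algebra_simps)
  also have "\<dots> = (\<integral>x. (f x)\<^sup>2 \<partial>M) - 2 * ?m * ?m + ?m\<^sup>2"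
    using True i2 by (simp add: m1)
  finally have "?m\<^sup>2 \<le> (\<integral>x. (f x)\<^sup>2 \<partial>M)" by (simp add: power2_eq_square)
  then show ?thesis by (simp add: nn_integral_eq_integral[OF i2])
qed

abbreviation sq_diff :: "('a::euclidean_space \<Rightarrow> real) \<Rightarrow> 'a \<Rightarrow> ennreal" where
  "sq_diff f h \<equiv> \<integral>\<^sup>+x. ennreal ((f (x + h) - f x)\<^sup>2) \<partial>lborel"

abbreviation pow4_integral :: "('a::euclidean_space \<Rightarrow> real) \<Rightarrow> ennreal" where
  "pow4_integral f \<equiv> \<integral>\<^sup>+x. ennreal ((f x)^4) \<partial>lborel"

lemma nn_integral_lborel_translate:
  fixes f :: "'a::euclidean_space \<Rightarrow> ennreal"
  assumes [measurable]: "f \<in> borel_measurable borel"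
  shows "(\<integral>\<^sup>+x. f (x + a) \<partial>lborel) = (\<integral>\<^sup>+x. f x \<partial>lborel)"
  by (subst (2) lborel_distr_plus[of a, symmetric]) (simp add: nn_integral_distr add.commute)

lemma lborel_integral_translate:
  fixes f :: "'a::euclidean_space \<Rightarrow> real"
  assumes [measurable]: "f \<in> borel_measurable borel"
  shows "integrable lborel (\<lambda>x. f (x + a)) \<longleftrightarrow> integrable lborel f"
    and "(\<integral>x. f (x + a) \<partial>lborel) = (\<integral>x. f x \<partial>lborel)"
  by (subst (2) lborel_distr_plus[of a, symmetric]; simp add: integrable_distr_eq integral_distr add.commute)+

text \<open>A probability measure when \<open>S\<close> has volume one, as for the unit interval and
  the unit cube. Averages over other cubes are formed by scaling the argument of the integrand, not
  the measure.\<close>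

definition unif :: "'a::euclidean_space set \<Rightarrow> 'a measure" where
  "unif S = density lborel (\<lambda>x. ennreal (indicator S x))"

lemma sets_unif[measurable_cong, simp]: "sets (unif S) = sets borel"
  and space_unif[simp]: "space (unif S) = UNIV"
  by (simp_all add: unif_def)

lemma nn_integral_unif:
  assumes [measurable]: "S \<in> sets borel" "f \<in> borel_measurable borel"
  shows "(\<integral>\<^sup>+x. f x \<partial>unif S) = (\<integral>\<^sup>+x. indicator S x * f x \<partial>lborel)"
  unfolding unif_def by (subst nn_integral_density) (auto simp: indicator_def intro!: nn_integral_cong)

lemma nn_integral_unif_mono:
  assumes [measurable]: "S \<in> sets borel" "f \<in> borel_measurable borel" "g \<in> borel_measurable borel"
    and "\<And>x. x \<in> S \<Longrightarrow> f x \<le> g x"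
  shows "(\<integral>\<^sup>+x. f x \<partial>unif S) \<le> (\<integral>\<^sup>+x. g x \<partial>unif S)"
  using assms(4) by (auto simp: nn_integral_unif indicator_def intro!: nn_integral_mono)

lemma emeasure_unif_space:
  assumes [measurable]: "S \<in> sets borel" and "emeasure lborel S = 1"
  shows "emeasure (unif S) UNIV = 1"
  using assms nn_integral_unif[of S "\<lambda>_. 1"] by simp

lemma pair_sigma_finite_unif:
  assumes "S \<in> sets borel" and "emeasure lborel S = 1"
  shows "pair_sigma_finite (unif S) (lborel :: 'b::euclidean_space measure)"
proof -
  interpret U: finite_measure "unif S"
    by standard (simp add: emeasure_unif_space[OF assms])
  show ?thesis by (intro pair_sigma_finite.intro) (simp_all add: sigma_finite_lborel U.sigma_finite_measure_axioms)
qed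

lemma nn_integral_unif_Fubini:
  fixes f :: "'a::euclidean_space \<Rightarrow> 'b::euclidean_space \<Rightarrow> ennreal"
  assumes "S \<in> sets borel" and "emeasure lborel S = 1"
    and [measurable]: "case_prod f \<in> borel_measurable borel"
  shows "(\<integral>\<^sup>+y. (\<integral>\<^sup>+x. f x y \<partial>unif S) \<partial>lborel) = (\<integral>\<^sup>+x. (\<integral>\<^sup>+y. f x y \<partial>lborel) \<partial>unif S)"
proof -
  interpret pair_sigma_finite "unif S" "lborel :: 'b measure" by (rule pair_sigma_finite_unif[OF assms(1,2)])
  have "case_prod f \<in> borel_measurable (unif S \<Otimes>\<^sub>M lborel)"
    using assms(3) by (simp add: borel_prod[symmetric] cong: measurable_cong_sets sets_pair_measure_cong)
  then show ?thesis by (rule Fubini')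
qed

text \<open>A crude replacement for Hoelder's inequality: a function with integrable fourth power
  becomes integrable against any bounded integrable weight.\<close>

lemma abs_le_one_plus_pow4: "\<bar>a\<bar> \<le> 1 + a^4" for a :: real
proof -
  have "0 \<le> a^4" "2 * \<bar>a\<bar> \<le> a\<^sup>2 + 1" "2 * a\<^sup>2 \<le> a^4 + 1"
    using sum_squares_bound[of "\<bar>a\<bar>" "1"] sum_squares_bound[of "a\<^sup>2" "1"] by simp_all
  then show ?thesis by linarith
qed

text \<open>By Fubini and the weak derivative applied to translates of \<open>\<phi>\<close>, both sides have the same
  integral against every test function \<open>\<phi>\<close>.\<close>

lemma weak_grad_difference:
  fixes h :: R4
  assumes u[measurable]: "u \<in> borel_measurable borel" and u4: "integrable lborel (\<lambda>x. (u x)^4)"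
    and wg: "weak_grad u g"
    and s[measurable]: "s \<in> borel_measurable borel" and s2: "integrable lborel (\<lambda>x. (s x)\<^sup>2)"
    and sg: "AE x in lborel. s x = h \<bullet> g x"
  shows "AE x in lborel. u (x + h) - u x = (\<integral>t. s (x + t *\<^sub>R h) \<partial>unif {0..1::real})"
proof -
  let ?U = "unif {0..1::real}"
  let ?J = "\<lambda>x. (\<integral>t. s (x + t *\<^sub>R h) \<partial>?U)"
  have S: "{0..1::real} \<in> sets borel" "emeasure lborel {0..1::real} = 1" by auto
  interpret U: finite_measure ?U
    by standard (simp add: emeasure_unif_space[OF S])
  interpret P: pair_sigma_finite ?U "lborel :: R4 measure" by (rule pair_sigma_finite_unif[OF S])
  have Jm[measurable]: "?J \<in> borel_measurable borel"
    by (rule U.borel_measurable_lebesgue_integral) simp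
  have main: "integrable lebesgue (\<lambda>x. (u (x + h) - u x - ?J x) * \<phi> x) \<and>
     (\<integral>x. (u (x + h) - u x - ?J x) * \<phi> x \<partial>lebesgue) = 0" if \<phi>: "test_fun \<phi>" for \<phi>
  proof -
    have [measurable]: "\<phi> \<in> borel_measurable borel" using \<phi> by (rule test_fun_borel)
    \<comment> \<open>\<open>\<psi>\<close> is the derivative of \<open>\<phi>\<close> along
      \<open>h\<close>; averaged over the segment from x - h to x it gives the difference of
      \<open>\<phi>\<close> at the end points.\<close>
    define \<psi> where "\<psi> x = (\<Sum>i\<in>UNIV. h $ i * pderiv4 i \<phi> x)" for x
    have \<psi>t: "test_fun \<psi>"
      unfolding \<psi>_def by (intro test_fun_lincomb test_fun_pderiv4 \<phi>)
    have \<psi>[measurable]: "\<psi> \<in> borel_measurable borel" using \<psi>t by (rule test_fun_borel)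
    have \<psi>_cont: "isCont \<psi> x" for x using \<psi>t by (intro smooth4_isCont test_fun_smooth4)
    have \<phi>_deriv: "((\<lambda>t. \<phi> (x - t *\<^sub>R h)) has_real_derivative - \<psi> (x - t *\<^sub>R h)) (at t)" for x t
    proof -
      have d: "(\<phi> has_derivative frechet_derivative \<phi> (at (x - t *\<^sub>R h))) (at (x - t *\<^sub>R h))"
        using \<phi> frechet_derivative_works smooth4_differentiable test_fun_smooth4 by blast
      have l: "linear (frechet_derivative \<phi> (at (x - t *\<^sub>R h)))"
        using d has_derivative_linear by blast
      have "frechet_derivative \<phi> (at (x - t *\<^sub>R h)) h = frechet_derivative \<phi> (at (x - t *\<^sub>R h)) (\<Sum>i\<in>UNIV. h $ i *\<^sub>R axis i 1)"
        using basis_expansion[of h] by (simp add: scalar_mult_eq_scaleR)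
      also have "\<dots> = \<psi> (x - t *\<^sub>R h)"
        using l by (simp add: linear_sum linear_scale \<psi>_def pderiv4_def)
      finally have e: "frechet_derivative \<phi> (at (x - t *\<^sub>R h)) h = \<psi> (x - t *\<^sub>R h)" .
      have d0: "((\<lambda>t. x - t *\<^sub>R h) has_derivative (\<lambda>r. - (r *\<^sub>R h))) (at t)"
        by (auto intro!: derivative_eq_intros)
      have "((\<lambda>t. \<phi> (x - t *\<^sub>R h)) has_derivative (\<lambda>r. frechet_derivative \<phi> (at (x - t *\<^sub>R h)) (- (r *\<^sub>R h)))) (at t)"
        by (rule has_derivative_compose[OF d0 d])
      then show ?thesis
        unfolding has_field_derivative_def
        by (rule has_derivative_eq_rhs) (use l e in \<open>auto simp: linear_neg linear_scale\<close>)
    qed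
    have FTC: "(\<integral>t. \<psi> (x - t *\<^sub>R h) \<partial>?U) = \<phi> x - \<phi> (x - h)" for x
    proof -
      have "(\<integral>t. \<psi> (x - t *\<^sub>R h) \<partial>?U) = (\<integral>t. indicator {0..1::real} t *\<^sub>R \<psi> (x - t *\<^sub>R h) \<partial>lborel)"
        unfolding unif_def by (subst integral_density) auto
      also have "\<dots> = - \<phi> (x - 1 *\<^sub>R h) - (- \<phi> (x - 0 *\<^sub>R h))"
      proof (rule integral_FTC_atLeastAtMost)
        show "((\<lambda>t. - \<phi> (x - t *\<^sub>R h)) has_vector_derivative \<psi> (x - t *\<^sub>R h)) (at t within {0..1})" for t
          using DERIV_minus[OF \<phi>_deriv[of x t]] has_field_derivative_at_within
          by (auto simp: has_real_derivative_iff_has_vector_derivative[symmetric])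
        show "continuous_on {0..1} (\<lambda>t. \<psi> (x - t *\<^sub>R h))"
          by (intro continuous_at_imp_continuous_on ballI isCont_o2[OF _ \<psi>_cont] continuous_intros)
      qed simp
      finally show ?thesis by simp
    qed
    obtain C N where C: "0 < C" "\<And>x. \<bar>\<phi> x\<bar> \<le> C * indicator (cball 0 N) x"
      using test_fun_bound[OF \<phi>] by metis
    have fin: "integrable lborel (\<lambda>x::R4. indicator (cball 0 N) x :: real)" for N :: real
      using emeasure_bounded_finite[OF bounded_cball[of 0 N]] by (intro integrable_real_indicator) auto
    have \<phi>p: "integrable lborel \<phi>"
      by (rule Bochner_Integration.integrable_bound[OF integrable_mult_right[OF fin[of N], of C]]) (use C in \<open>auto intro!: AE_I2 intro: order_trans[OF _ abs_ge_self]\<close>)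
    have \<phi>2: "integrable lborel (\<lambda>x. (\<phi> x)\<^sup>2)"
    proof (rule Bochner_Integration.integrable_bound[OF integrable_mult_right[OF \<phi>p, of C]])
      have "\<bar>\<phi> x\<bar> \<le> C" for x using C(2)[of x] C(1) by (cases "x \<in> cball 0 N") auto
      then have "\<bar>\<phi> x\<bar> * \<bar>\<phi> x\<bar> \<le> C * \<bar>\<phi> x\<bar>" for x by (intro mult_right_mono) auto
      then show "AE x in lborel. norm ((\<phi> x)\<^sup>2) \<le> norm (C * \<phi> x)"
        using C(1) by (intro AE_I2) (simp add: power2_eq_square abs_mult)
    qed simp
    obtain D M where D: "0 < D" "\<And>x. \<bar>\<psi> x\<bar> \<le> D * indicator (cball 0 M) x"
      using test_fun_bound[OF \<psi>t] by metis
    have \<psi>D: "\<bar>\<psi> x\<bar> \<le> D" for x using D(2)[of x] D(1) by (cases "x \<in> cball 0 M") auto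
    have \<psi>p: "integrable lborel \<psi>"
      by (rule Bochner_Integration.integrable_bound[OF integrable_mult_right[OF fin[of M], of D]]) (use D in \<open>auto intro!: AE_I2 intro: order_trans[OF _ abs_ge_self]\<close>)
    have u_bd: "\<bar>u x * \<theta> x\<bar> \<le> \<bar>\<theta> x\<bar> + B * (u x)^4" if "\<bar>\<theta> x\<bar> \<le> B" for \<theta> :: "R4 \<Rightarrow> real" and x B
    proof -
      have "\<bar>u x * \<theta> x\<bar> \<le> (1 + (u x)^4) * \<bar>\<theta> x\<bar>" using abs_le_one_plus_pow4[of "u x"] by (simp add: abs_mult mult_right_mono)
      also have "\<dots> \<le> \<bar>\<theta> x\<bar> + B * (u x)^4" using mult_right_mono[OF that, of "(u x)^4"] by (simp add: algebra_simps)
      finally show ?thesis .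
    qed
    have u\<phi>: "integrable lborel (\<lambda>x. u (x + a) * \<phi> (x + b))" for a b
    proof -
      have "integrable lborel (\<lambda>x. u x * \<phi> (x + (b - a)))"
      proof (rule Bochner_Integration.integrable_bound)
        show "integrable lborel (\<lambda>x. \<bar>\<phi> (x + (b - a))\<bar> + C * (u x)^4)"
          using u4 \<phi>p by (intro Bochner_Integration.integrable_add integrable_mult_right) (auto simp: lborel_integral_translate(1))
        have "\<bar>\<phi> x\<bar> \<le> C" for x using C(2)[of x] C(1) by (cases "x \<in> cball 0 N") auto
        then show "AE x in lborel. norm (u x * \<phi> (x + (b - a))) \<le> norm (\<bar>\<phi> (x + (b - a))\<bar> + C * (u x)^4)"
          using u_bd[of "\<lambda>x. \<phi> (x + (b - a))" _ C] by (intro AE_I2) (auto intro!: order_trans[OF _ abs_ge_self])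
      qed simp
      then show ?thesis
        using lborel_integral_translate(1)[of "\<lambda>x. u x * \<phi> (x + (b - a))" a] by (simp add: algebra_simps)
    qed
    have u\<psi>: "integrable lborel (\<lambda>x. u x * \<psi> (x - t *\<^sub>R h))"
      and u\<psi>n: "(\<integral>x. norm (u x * \<psi> (x - t *\<^sub>R h)) \<partial>lborel) \<le> (\<integral>x. \<bar>\<psi> x\<bar> \<partial>lborel) + D * (\<integral>x. (u x)^4 \<partial>lborel)" for t
    proof -
      have i: "integrable lborel (\<lambda>x. \<bar>\<psi> (x - t *\<^sub>R h)\<bar>)"
        using \<psi>p lborel_integral_translate(1)[of \<psi> "- t *\<^sub>R h"] by simp
      have b: "\<bar>u x * \<psi> (x - t *\<^sub>R h)\<bar> \<le> \<bar>\<psi> (x - t *\<^sub>R h)\<bar> + D * (u x)^4" for x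
        using u_bd[of "\<lambda>x. \<psi> (x - t *\<^sub>R h)" x D] \<psi>D by auto
      show i1: "integrable lborel (\<lambda>x. u x * \<psi> (x - t *\<^sub>R h))"
        by (rule Bochner_Integration.integrable_bound[OF Bochner_Integration.integrable_add[OF i integrable_mult_right[OF u4, of D]]])
           (use b in \<open>auto intro!: AE_I2 intro: order_trans[OF _ abs_ge_self]\<close>)
      have "(\<integral>x. norm (u x * \<psi> (x - t *\<^sub>R h)) \<partial>lborel) \<le> (\<integral>x. \<bar>\<psi> (x - t *\<^sub>R h)\<bar> + D * (u x)^4 \<partial>lborel)"
        using i i1 u4 b by (intro integral_mono) auto
      also have "\<dots> = (\<integral>x. \<bar>\<psi> x\<bar> \<partial>lborel) + D * (\<integral>x. (u x)^4 \<partial>lborel)"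
        using i u4 lborel_integral_translate(2)[of "\<lambda>x. \<bar>\<psi> x\<bar>" "- t *\<^sub>R h"] by simp
      finally show "(\<integral>x. norm (u x * \<psi> (x - t *\<^sub>R h)) \<partial>lborel) \<le> (\<integral>x. \<bar>\<psi> x\<bar> \<partial>lborel) + D * (\<integral>x. (u x)^4 \<partial>lborel)" .
    qed
    have s\<phi>: "integrable lborel (\<lambda>x. s (x + t *\<^sub>R h) * \<phi> x)"
      and s\<phi>n: "(\<integral>x. norm (s (x + t *\<^sub>R h) * \<phi> x) \<partial>lborel) \<le> (\<integral>x. (s x)\<^sup>2 \<partial>lborel) + (\<integral>x. (\<phi> x)\<^sup>2 \<partial>lborel)" for t
    proof -
      have i: "integrable lborel (\<lambda>x. (s (x + t *\<^sub>R h))\<^sup>2)"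
        using s2 lborel_integral_translate(1)[of "\<lambda>x. (s x)\<^sup>2" "t *\<^sub>R h"] by simp
      have b: "\<bar>a * b\<bar> \<le> a\<^sup>2 + b\<^sup>2" for a b :: real
        using sum_squares_bound[of a b] sum_squares_bound[of a "-b"] by (auto simp: abs_real_def)
      show i1: "integrable lborel (\<lambda>x. s (x + t *\<^sub>R h) * \<phi> x)"
        by (rule Bochner_Integration.integrable_bound[OF Bochner_Integration.integrable_add[OF i \<phi>2]])
           (use b in \<open>auto intro!: AE_I2 intro: order_trans[OF _ abs_ge_self]\<close>)
      have "(\<integral>x. norm (s (x + t *\<^sub>R h) * \<phi> x) \<partial>lborel) \<le> (\<integral>x. (s (x + t *\<^sub>R h))\<^sup>2 + (\<phi> x)\<^sup>2 \<partial>lborel)"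
        using i i1 \<phi>2 b by (intro integral_mono) auto
      also have "\<dots> = (\<integral>x. (s x)\<^sup>2 \<partial>lborel) + (\<integral>x. (\<phi> x)\<^sup>2 \<partial>lborel)"
        using i \<phi>2 lborel_integral_translate(2)[of "\<lambda>x. (s x)\<^sup>2" "t *\<^sub>R h"] by simp
      finally show "(\<integral>x. norm (s (x + t *\<^sub>R h) * \<phi> x) \<partial>lborel) \<le> (\<integral>x. (s x)\<^sup>2 \<partial>lborel) + (\<integral>x. (\<phi> x)\<^sup>2 \<partial>lborel)" .
    qed
    have weak: "(\<integral>x. u x * \<psi> (x - t *\<^sub>R h) \<partial>lborel) = - (\<integral>x. s (x + t *\<^sub>R h) * \<phi> x \<partial>lborel)" for t
    proof -
      \<comment> \<open>Testing with the translate of \<open>\<phi>\<close> by t h puts the shift on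
        the test function; the change of variables then moves it to \<open>s\<close>.\<close>
      define \<theta> where "\<theta> = (\<lambda>x. \<phi> (- t *\<^sub>R h + 1 *\<^sub>R x))"
      have \<theta>: "test_fun \<theta>" unfolding \<theta>_def by (intro test_fun_affine \<phi>) simp
      have [measurable]: "\<theta> \<in> borel_measurable borel" using \<theta> by (rule test_fun_borel)
      have \<theta>d: "pderiv4 i \<theta> = (\<lambda>x. 1 * pderiv4 i \<phi> (- t *\<^sub>R h + 1 *\<^sub>R x))" for i
        unfolding \<theta>_def using \<phi> by (intro pderiv4_affine) (simp add: test_fun_smooth4 smooth4_differentiable)
      note w = weak_gradD[OF wg \<theta>]
      have "(\<integral>x. u x * \<psi> (x - t *\<^sub>R h) \<partial>lborel) = (\<integral>x. u x * \<psi> (x - t *\<^sub>R h) \<partial>lebesgue)"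
        by (rule integral_lebesgue_eq[symmetric]) measurable
      also have "\<dots> = (\<integral>x. (\<Sum>i\<in>UNIV. h $ i * (u x * pderiv4 i \<theta> x)) \<partial>lebesgue)"
        by (simp add: \<theta>d \<psi>_def sum_distrib_left algebra_simps)
      also have "\<dots> = (\<Sum>i\<in>UNIV. h $ i * (\<integral>x. u x * pderiv4 i \<theta> x \<partial>lebesgue))"
        using w(1) by (subst Bochner_Integration.integral_sum) auto
      also have "\<dots> = - (\<Sum>i\<in>UNIV. h $ i * (\<integral>x. g x $ i * \<theta> x \<partial>lebesgue))"
        by (simp add: w(3) sum_negf)
      also have "(\<Sum>i\<in>UNIV. h $ i * (\<integral>x. g x $ i * \<theta> x \<partial>lebesgue)) = (\<integral>x. (\<Sum>i\<in>UNIV. h $ i * (g x $ i * \<theta> x)) \<partial>lebesgue)"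
        using w(2) by (subst Bochner_Integration.integral_sum) auto
      also have "\<dots> = (\<integral>x. s x * \<theta> x \<partial>lebesgue)"
      proof (rule integral_cong_AE)
        show "(\<lambda>x. \<Sum>i\<in>UNIV. h $ i * (g x $ i * \<theta> x)) \<in> borel_measurable lebesgue"
          by (intro borel_measurable_sum borel_measurable_times[OF borel_measurable_const] borel_measurable_integrable w(2))
        show "(\<lambda>x. s x * \<theta> x) \<in> borel_measurable lebesgue"
          by (intro measurable_completion) measurable
        have "(\<Sum>i\<in>UNIV. h $ i * (g x $ i * \<theta> x)) = (h \<bullet> g x) * \<theta> x" for x
          by (simp add: inner_vec_def sum_distrib_right mult.assoc)
        then show "AE x in lebesgue. (\<Sum>i\<in>UNIV. h $ i * (g x $ i * \<theta> x)) = s x * \<theta> x"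
          using AE_completion[OF sg] by (auto)
      qed
      also have "\<dots> = (\<integral>x. s x * \<theta> x \<partial>lborel)"
        by (rule integral_lebesgue_eq) measurable
      also have "\<dots> = (\<integral>x. s (x + t *\<^sub>R h) * \<theta> (x + t *\<^sub>R h) \<partial>lborel)"
        by (rule lborel_integral_translate(2)[symmetric]) measurable
      also have "\<dots> = (\<integral>x. s (x + t *\<^sub>R h) * \<phi> x \<partial>lborel)"
        by (simp add: \<theta>_def)
      finally show ?thesis .
    qed
    have p1: "integrable (?U \<Otimes>\<^sub>M lborel) (\<lambda>(t, x). u x * \<psi> (x - t *\<^sub>R h))"
    proof (rule P.Fubini_integrable)
      show "integrable ?U (\<lambda>t. \<integral>x. norm (case (t, x) of (t, x) \<Rightarrow> u x * \<psi> (x - t *\<^sub>R h)) \<partial>lborel)"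
        by (rule U.integrable_const_bound[of _ "(\<integral>x. \<bar>\<psi> x\<bar> \<partial>lborel) + D * (\<integral>x. (u x)^4 \<partial>lborel)"])
           (use u\<psi>n in \<open>auto intro!: sigma_finite_measure.borel_measurable_lebesgue_integral[OF sigma_finite_lborel]\<close>)
    qed (use u\<psi> in auto)
    have p2: "integrable (?U \<Otimes>\<^sub>M lborel) (\<lambda>(t, x). s (x + t *\<^sub>R h) * \<phi> x)"
    proof (rule P.Fubini_integrable)
      show "integrable ?U (\<lambda>t. \<integral>x. norm (case (t, x) of (t, x) \<Rightarrow> s (x + t *\<^sub>R h) * \<phi> x) \<partial>lborel)"
        by (rule U.integrable_const_bound[of _ "(\<integral>x. (s x)\<^sup>2 \<partial>lborel) + (\<integral>x. (\<phi> x)\<^sup>2 \<partial>lborel)"])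
           (use s\<phi>n in \<open>auto intro!: sigma_finite_measure.borel_measurable_lebesgue_integral[OF sigma_finite_lborel]\<close>)
    qed (use s\<phi> in auto)
    have "(\<integral>x. u x * (\<phi> x - \<phi> (x - h)) \<partial>lborel) = (\<integral>x. (\<integral>t. u x * \<psi> (x - t *\<^sub>R h) \<partial>?U) \<partial>lborel)"
      by (simp add: FTC)
    also have "\<dots> = (\<integral>t. (\<integral>x. u x * \<psi> (x - t *\<^sub>R h) \<partial>lborel) \<partial>?U)"
      using P.Fubini_integral[OF p1] by simp
    also have "\<dots> = - (\<integral>t. (\<integral>x. s (x + t *\<^sub>R h) * \<phi> x \<partial>lborel) \<partial>?U)"
      by (simp add: weak)
    also have "\<dots> = - (\<integral>x. (\<integral>t. s (x + t *\<^sub>R h) * \<phi> x \<partial>?U) \<partial>lborel)"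
      using P.Fubini_integral[OF p2] by simp
    finally have eq1: "(\<integral>x. u x * (\<phi> x - \<phi> (x - h)) \<partial>lborel) = - (\<integral>x. ?J x * \<phi> x \<partial>lborel)" by simp
    have iJ: "integrable lborel (\<lambda>x. ?J x * \<phi> x)"
      using P.integrable_snd[OF p2] by simp
    have e2: "(\<integral>x. u (x + h) * \<phi> x \<partial>lborel) = (\<integral>x. u x * \<phi> (x - h) \<partial>lborel)"
      using lborel_integral_translate(2)[of "\<lambda>x. u x * \<phi> (x - h)" h] by simp
    have i1: "integrable lborel (\<lambda>x. u (x + h) * \<phi> x)" and i2: "integrable lborel (\<lambda>x. u x * \<phi> x)" 
      and i3: "integrable lborel (\<lambda>x. u x * \<phi> (x - h))"
      using u\<phi>[of h 0] u\<phi>[of 0 0] u\<phi>[of 0 "-h"] by simp_all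
    have e3: "(\<lambda>x. (u (x + h) - u x - ?J x) * \<phi> x) = (\<lambda>x. u (x + h) * \<phi> x - u x * \<phi> x - ?J x * \<phi> x)"
      by (auto simp: algebra_simps)
    have "(\<integral>x. (u (x + h) - u x - ?J x) * \<phi> x \<partial>lborel) = 0"
      unfolding e3 using i1 i2 i3 iJ eq1 e2 by (simp add: right_diff_distrib)
    moreover have "integrable lborel (\<lambda>x. (u (x + h) - u x - ?J x) * \<phi> x)"
      unfolding e3 using i1 i2 iJ by simp
    ultimately show ?thesis
      by (subst integrable_lebesgue_iff integral_lebesgue_eq; simp)+
  qed
  have "AE x in lebesgue. u (x + h) - u x - ?J x = 0"
    by (rule test_fun_AE_zero) (use main in \<open>auto intro!: measurable_completion\<close>)
  then have "AE x in lborel. u (x + h) - u x - ?J x = 0"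
    by (simp only: AE_completion_iff)
  then show ?thesis by eventually_elim simp
qed

text \<open>The increment of \<open>u\<close> is the mean of h \<bullet> g over the segment from x
  to x + h. Jensen in the segment parameter, Fubini and translation invariance reduce the square
  integral to that of h \<bullet> g, and Cauchy-Schwarz finishes. The Borel representative
  \<open>s\<close> of h \<bullet> g supplies the joint measurability needed for Fubini.\<close>

lemma L2_grad_translation_bound:
  fixes h :: R4
  assumes u[measurable]: "u \<in> borel_measurable borel" and u4: "integrable lborel (\<lambda>x. (u x)^4)"
    and g: "L2_grad u g"
  shows "(sq_diff u h) \<le> ennreal ((norm h)\<^sup>2 * (energy g))"
proof -
  let ?U = "unif {0..1::real}"
  have gm[measurable]: "g \<in> borel_measurable lebesgue" and gi: "integrable lebesgue (\<lambda>x. (norm (g x))\<^sup>2)"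
    and wg: "weak_grad u g"
    using g by (auto simp: L2_grad_def)
  have "(\<lambda>x. h \<bullet> g x) \<in> borel_measurable lebesgue" by measurable
  then obtain s where s[measurable]: "s \<in> borel_measurable borel" and sg: "AE x in lborel. h \<bullet> g x = s x"
    using completion_ex_borel_measurable_real by (metis measurable_lborel2)
  have cs: "(h \<bullet> g x)\<^sup>2 \<le> (norm h)\<^sup>2 * (norm (g x))\<^sup>2" for x
    using Cauchy_Schwarz_ineq[of h "g x"] by (simp add: power2_norm_eq_inner)
  have "(\<integral>\<^sup>+x. ennreal ((s x)\<^sup>2) \<partial>lborel) = (\<integral>\<^sup>+x. ennreal ((s x)\<^sup>2) \<partial>lebesgue)"
    by (simp add: nn_integral_completion)
  also have "\<dots> \<le> (\<integral>\<^sup>+x. ennreal ((norm h)\<^sup>2 * (norm (g x))\<^sup>2) \<partial>lebesgue)"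
  proof (rule nn_integral_mono_AE)
    show "AE x in lebesgue. ennreal ((s x)\<^sup>2) \<le> ennreal ((norm h)\<^sup>2 * (norm (g x))\<^sup>2)"
      using AE_completion[OF sg] by eventually_elim (metis cs ennreal_leI)
  qed
  also have "\<dots> = ennreal ((norm h)\<^sup>2 * (energy g))"
    using gi by (subst nn_integral_eq_integral) auto
  finally have s2: "(\<integral>\<^sup>+x. ennreal ((s x)\<^sup>2) \<partial>lborel) \<le> ennreal ((norm h)\<^sup>2 * (energy g))" .
  then have "integrable lborel (\<lambda>x. (s x)\<^sup>2)"
    by (intro integrableI_bounded) (auto intro: le_less_trans)
  then have "AE x in lborel. u (x + h) - u x = (\<integral>t. s (x + t *\<^sub>R h) \<partial>?U)"
    using sg by (intro weak_grad_difference[OF u u4 wg s]) (auto elim: eventually_mono)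
  then have "(sq_diff u h) = (\<integral>\<^sup>+x. ennreal ((\<integral>t. s (x + t *\<^sub>R h) \<partial>?U)\<^sup>2) \<partial>lborel)"
    by (intro nn_integral_cong_AE) (auto elim: eventually_mono)
  also have "\<dots> \<le> (\<integral>\<^sup>+x. (\<integral>\<^sup>+t. ennreal ((s (x + t *\<^sub>R h))\<^sup>2) \<partial>?U) \<partial>lborel)"
    by (intro nn_integral_mono square_integral_le_nn_integral) (auto simp: emeasure_unif_space)
  also have "\<dots> = (\<integral>\<^sup>+t. (\<integral>\<^sup>+x. ennreal ((s (x + t *\<^sub>R h))\<^sup>2) \<partial>lborel) \<partial>?U)"
    by (rule nn_integral_unif_Fubini) (auto simp: borel_prod[symmetric])
  also have "\<dots> = (\<integral>\<^sup>+t. (\<integral>\<^sup>+x. ennreal ((s x)\<^sup>2) \<partial>lborel) \<partial>?U)"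
    by (intro nn_integral_cong nn_integral_lborel_translate) measurable
  also have "\<dots> = (\<integral>\<^sup>+x. ennreal ((s x)\<^sup>2) \<partial>lborel)"
    by (simp add: emeasure_unif_space)
  finally show ?thesis using s2 by simp
qed

section \<open>Refined Sobolev inequality\<close>

abbreviation Q :: "R4 set" where "Q \<equiv> cbox 0 (\<chi> i. 1)"

lemma unit_cube: "Q \<in> sets borel" "emeasure lborel Q = 1"
proof -
  have "(\<Prod>b\<in>Basis. ((\<chi> i. 1) - (0::R4)) \<bullet> b) = 1"
    by (rule prod.neutral) (auto simp: Basis_vec_def inner_axis)
  moreover have "\<And>b. b \<in> Basis \<Longrightarrow> (0::R4) \<bullet> b \<le> (\<chi> i. 1) \<bullet> b"
    by (auto simp: Basis_vec_def inner_axis)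
  ultimately show "emeasure lborel Q = 1"
    by (subst emeasure_lborel_cbox) auto
qed simp

lemma unit_cube_norm: "h \<in> Q \<Longrightarrow> (norm h)\<^sup>2 \<le> 4"
proof -
  assume "h \<in> Q"
  then have "(\<Sum>i\<in>UNIV. (h $ i)\<^sup>2) \<le> (\<Sum>i\<in>(UNIV::4 set). 1)"
    by (intro sum_mono) (auto simp: mem_box_cart intro!: power_le_one)
  then show ?thesis by (simp add: norm_vec_def L2_set_def sum_nonneg)
qed

text \<open>Splitting a doubled step into two equal steps costs a factor 4, by (a + b)^2 \<le> 2 a^2
  + 2 b^2 and translation invariance. Hence the squared increment divided by the squared step length
  does not decrease when the step is halved.\<close>

lemma nn_integral_translation_double:
  fixes f :: "'a::euclidean_space \<Rightarrow> real"
  assumes [measurable]: "f \<in> borel_measurable borel"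
  shows "(\<integral>\<^sup>+x. ennreal ((f (x + (2^k) *\<^sub>R h) - f x)\<^sup>2) \<partial>lborel) \<le> ennreal (4^k) * (sq_diff f h)"
proof (induction k)
  case (Suc k)
  let ?a = "(2^k) *\<^sub>R h"
  let ?I = "\<integral>\<^sup>+x. ennreal ((f (x + ?a) - f x)\<^sup>2) \<partial>lborel"
  have b: "(a + b)\<^sup>2 \<le> 2 * a\<^sup>2 + 2 * b\<^sup>2" for a b :: real
    using sum_squares_bound[of a b] by (simp add: power2_sum)
  have "(\<integral>\<^sup>+x. ennreal ((f (x + (2^Suc k) *\<^sub>R h) - f x)\<^sup>2) \<partial>lborel)
    \<le> (\<integral>\<^sup>+x. ennreal 2 * ennreal ((f (x + ?a + ?a) - f (x + ?a))\<^sup>2) + ennreal 2 * ennreal ((f (x + ?a) - f x)\<^sup>2) \<partial>lborel)"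
  proof (rule nn_integral_mono)
    fix x
    have "(f (x + (2^Suc k) *\<^sub>R h) - f x)\<^sup>2 \<le> 2 * (f (x + ?a + ?a) - f (x + ?a))\<^sup>2 + 2 * (f (x + ?a) - f x)\<^sup>2"
      using b[of "f (x + ?a + ?a) - f (x + ?a)" "f (x + ?a) - f x"]
      by (simp add: add.assoc flip: scaleR_add_left)
    then have "ennreal ((f (x + (2^Suc k) *\<^sub>R h) - f x)\<^sup>2) \<le> ennreal (2 * (f (x + ?a + ?a) - f (x + ?a))\<^sup>2 + 2 * (f (x + ?a) - f x)\<^sup>2)"
      by (rule ennreal_leI)
    then show "ennreal ((f (x + (2^Suc k) *\<^sub>R h) - f x)\<^sup>2) \<le> ennreal 2 * ennreal ((f (x + ?a + ?a) - f (x + ?a))\<^sup>2) + ennreal 2 * ennreal ((f (x + ?a) - f x)\<^sup>2)"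
      by (simp add: ennreal_plus ennreal_mult)
  qed
  also have "\<dots> = ennreal 2 * (\<integral>\<^sup>+x. ennreal ((f (x + ?a + ?a) - f (x + ?a))\<^sup>2) \<partial>lborel) + ennreal 2 * ?I"
    by (subst nn_integral_add) (auto simp: nn_integral_cmult)
  also have "(\<integral>\<^sup>+x. ennreal ((f (x + ?a + ?a) - f (x + ?a))\<^sup>2) \<partial>lborel) = ?I"
    by (rule nn_integral_lborel_translate[of "\<lambda>x. ennreal ((f (x + ?a) - f x)\<^sup>2)"]) measurable
  also have "ennreal 2 * ?I + ennreal 2 * ?I = ennreal 4 * ?I"
    by (simp flip: distrib_right ennreal_plus)
  also have "\<dots> \<le> ennreal 4 * (ennreal (4^k) * (sq_diff f h))"
    using Suc by (rule mult_left_mono) simp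
  also have "\<dots> = ennreal (4^Suc k) * (sq_diff f h)"
    by (simp add: ennreal_mult flip: mult.assoc)
  finally show ?case .
qed simp

text \<open>A substitute for orthogonality of the slices. For b \<le> a each slice increment lies
  between 0 and a - b, and the increments telescope to at most a - b; so one factor of each square
  is bounded by a - b and the other is summed.\<close>

lemma sum_slice_sq_le:
  fixes l :: "nat \<Rightarrow> real"
  assumes mono: "\<And>j. l j \<le> l (Suc j)"
  shows "(\<Sum>j<n. ((min a (l (Suc j)) - min a (l j)) - (min b (l (Suc j)) - min b (l j)))\<^sup>2) \<le> (a - b)\<^sup>2"
proof (induction a b rule: linorder_wlog)
  case (le b a)
  have d: "0 \<le> (min a (l (Suc j)) - min a (l j)) - (min b (l (Suc j)) - min b (l j))"
    "(min a (l (Suc j)) - min a (l j)) - (min b (l (Suc j)) - min b (l j)) \<le> a - b" for j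
    using mono[of j] le by (auto simp: min_def)
  have ln: "l 0 \<le> l n" by (induction n) (auto intro: order_trans[OF _ mono])
  have "(\<Sum>j<n. ((min b (l (Suc j)) - min b (l j)) - (min a (l (Suc j)) - min a (l j)))\<^sup>2)
    \<le> (\<Sum>j<n. (a - b) * ((min a (l (Suc j)) - min a (l j)) - (min b (l (Suc j)) - min b (l j))))"
    by (intro sum_mono, subst power2_commute, unfold power2_eq_square, intro mult_right_mono d)
  also have "\<dots> = (a - b) * (((min a (l n) - min a (l 0))) - (min b (l n) - min b (l 0)))"
    by (simp add: sum_distrib_left[symmetric] sum_subtractf[where f="\<lambda>j. _ j - _ j"]
      sum_lessThan_telescope[of "\<lambda>j. min a (l j)"] sum_lessThan_telescope[of "\<lambda>j. min b (l j)"])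
  also have "\<dots> \<le> (a - b) * (a - b)"
    using ln le by (intro mult_left_mono) (auto simp: min_def)
  finally show ?case by (simp add: power2_eq_square algebra_simps)
next
  case (sym a b)
  then show ?case by (simp add: power2_commute)
qed

text \<open>The slice of \<open>f\<close> between the levels \<open>l j\<close> and \<open>2 * l j\<close> is compared with its average at the scale
  \<open>r j = 2 * B / l j\<close>, which is at most half its height. The doubling inequality then moves all
  slices to the common scale \<open>r n\<close>, where the squares of their increments add up.\<close>

lemma refined_Sobolev_slices:
  fixes f :: "R4 \<Rightarrow> real"
  assumes f[measurable]: "f \<in> borel_measurable borel" and pos: "\<And>x. 0 \<le> f x" and "0 \<le> D" "0 < B" "0 < l0"
    and diff: "\<And>h. (sq_diff f h) \<le> ennreal (D * (norm h)\<^sup>2)"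
    and avg: "\<And>x r. 0 < r \<Longrightarrow> (\<integral>\<^sup>+h. ennreal (f (x + r *\<^sub>R h)) \<partial>unif Q) \<le> ennreal (B / r)"
  shows "(\<Sum>j<n. ennreal ((l0 * 2^j)^4) * emeasure lborel {x. 2 * (l0 * 2^j) \<le> f x}) \<le> ennreal (64 * B\<^sup>2 * D)"
proof -
  define l where "l j = l0 * 2^j" for j :: nat
  define r where "r j = 2 * B / l j" for j
  define F where "F j s = min s (l (Suc j)) - min s (l j)" for j s
  have lpos: "0 < l j" and lSuc: "l (Suc j) = 2 * l j" for j using \<open>0 < l0\<close> by (auto simp: l_def)
  have rpos: "0 < r j" for j using \<open>0 < B\<close> lpos by (simp add: r_def)
  have Fb: "0 \<le> F j s" "F j s \<le> l j" "F j s \<le> max 0 s" for j s using lpos[of j] by (auto simp: F_def lSuc min_def)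
  have [measurable]: "F j \<in> borel_measurable borel" for j unfolding F_def by measurable
  interpret U: finite_measure "unif Q" by standard (simp add: emeasure_unif_space[OF unit_cube])
  have mU: "measure (unif Q) UNIV = 1" using emeasure_unif_space[OF unit_cube] by (simp add: measure_def)
  define T where "T j h = (\<integral>\<^sup>+x. ennreal ((F j (f (x + h)) - F j (f x))\<^sup>2) \<partial>lborel)" for j h
  have T_meas[measurable]: "(\<lambda>h. T j (c *\<^sub>R h)) \<in> borel_measurable borel" for j c
    unfolding T_def by measurable
  have step1: "ennreal ((l j)^4) * emeasure lborel {x. 2 * l j \<le> f x}
     \<le> ennreal (16 * B\<^sup>2) * (\<integral>\<^sup>+h. ennreal (1 / (r j)\<^sup>2) * T j (r j *\<^sub>R h) \<partial>unif Q)" for j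
  proof -
    have pt: "ennreal ((l j / 2)\<^sup>2) * indicator {x. 2 * l j \<le> f x} x
       \<le> (\<integral>\<^sup>+h. ennreal ((F j (f (x + r j *\<^sub>R h)) - F j (f x))\<^sup>2) \<partial>unif Q)" for x
    proof (cases "2 * l j \<le> f x")
      case True
      have Fx: "F j (f x) = l j" using True lpos[of j] by (simp add: F_def lSuc min_def)
      have i: "integrable (unif Q) (\<lambda>h. F j (f (x + r j *\<^sub>R h)))"
        by (rule U.integrable_const_bound[of _ "l j"]) (use Fb in auto)
      have "ennreal (\<integral>h. F j (f (x + r j *\<^sub>R h)) \<partial>unif Q) = (\<integral>\<^sup>+h. ennreal (F j (f (x + r j *\<^sub>R h))) \<partial>unif Q)"
        using i Fb by (subst nn_integral_eq_integral) auto
      also have "\<dots> \<le> (\<integral>\<^sup>+h. ennreal (f (x + r j *\<^sub>R h)) \<partial>unif Q)"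
        using Fb(3) pos by (intro nn_integral_mono ennreal_leI) (metis max.absorb2)
      also have "\<dots> \<le> ennreal (B / r j)" by (rule avg[OF rpos])
      also have "B / r j = l j / 2" using \<open>0 < B\<close> lpos[of j] by (simp add: r_def)
      finally have "(\<integral>h. F j (f (x + r j *\<^sub>R h)) \<partial>unif Q) \<le> l j / 2"
        using lpos[of j] by (simp add: ennreal_le_iff)
      then have "l j / 2 \<le> (\<integral>h. F j (f x) - F j (f (x + r j *\<^sub>R h)) \<partial>unif Q)"
        using i by (simp add: mU Fx)
      then have "ennreal ((l j / 2)\<^sup>2) \<le> ennreal ((\<integral>h. F j (f x) - F j (f (x + r j *\<^sub>R h)) \<partial>unif Q)\<^sup>2)"
        using lpos[of j] by (intro ennreal_leI power_mono) auto
      also have "\<dots> \<le> (\<integral>\<^sup>+h. ennreal ((F j (f x) - F j (f (x + r j *\<^sub>R h)))\<^sup>2) \<partial>unif Q)"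
        by (rule square_integral_le_nn_integral) (auto simp: emeasure_unif_space[OF unit_cube])
      finally show ?thesis using True by (simp add: power2_commute)
    qed simp
    have "ennreal ((l j / 2)\<^sup>2) * emeasure lborel {x. 2 * l j \<le> f x}
      = (\<integral>\<^sup>+x. ennreal ((l j / 2)\<^sup>2) * indicator {x. 2 * l j \<le> f x} x \<partial>lborel)"
      by (subst nn_integral_cmult_indicator) auto
    also have "\<dots> \<le> (\<integral>\<^sup>+x. (\<integral>\<^sup>+h. ennreal ((F j (f (x + r j *\<^sub>R h)) - F j (f x))\<^sup>2) \<partial>unif Q) \<partial>lborel)"
      by (intro nn_integral_mono pt)
    also have "\<dots> = (\<integral>\<^sup>+h. T j (r j *\<^sub>R h) \<partial>unif Q)"
      unfolding T_def by (rule nn_integral_unif_Fubini[OF unit_cube]) (auto simp: borel_prod[symmetric])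
    \<comment> \<open>Multiplication by 4 l^2 turns l^2 / 4 into l^4 on the left, while the choice
      of \<open>r j\<close> makes 4 l^2 equal to 16 B^2 / r^2 on the right.\<close>
    finally have "ennreal (4 * (l j)\<^sup>2) * (ennreal ((l j / 2)\<^sup>2) * emeasure lborel {x. 2 * l j \<le> f x})
        \<le> ennreal (4 * (l j)\<^sup>2) * (\<integral>\<^sup>+h. T j (r j *\<^sub>R h) \<partial>unif Q)"
      by (rule mult_left_mono) simp
    moreover have "ennreal (4 * (l j)\<^sup>2) * ennreal ((l j / 2)\<^sup>2) = ennreal ((l j)^4)"
      by (simp add: power_divide flip: ennreal_mult power_add)
    moreover have "ennreal (4 * (l j)\<^sup>2) = ennreal (16 * B\<^sup>2) * ennreal (1 / (r j)\<^sup>2)"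
      using \<open>0 < B\<close> lpos[of j] by (simp add: r_def power_divide power_mult_distrib flip: ennreal_mult)
    moreover have "(\<integral>\<^sup>+h. ennreal (1 / (r j)\<^sup>2) * T j (r j *\<^sub>R h) \<partial>unif Q) = ennreal (1 / (r j)\<^sup>2) * (\<integral>\<^sup>+h. T j (r j *\<^sub>R h) \<partial>unif Q)"
      by (rule nn_integral_cmult) measurable
    ultimately show ?thesis by (simp add: mult.assoc[symmetric])
  qed
  have step2: "(\<Sum>j<n. ennreal (1 / (r j)\<^sup>2) * T j (r j *\<^sub>R h)) \<le> ennreal (D * (norm h)\<^sup>2)" for h
  proof -
    let ?c = "ennreal (1 / (r n)\<^sup>2)"
    have sl: "(\<Sum>j<n. (F j a - F j b)\<^sup>2) \<le> (a - b)\<^sup>2" for a b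
      unfolding F_def by (rule sum_slice_sq_le) (simp add: lSuc lpos less_imp_le)
    have "ennreal (1 / (r j)\<^sup>2) * T j (r j *\<^sub>R h) \<le> ?c * T j (r n *\<^sub>R h)" if "j < n" for j
    proof -
      have "l n = 2^(n - j) * l j" using that by (simp add: l_def flip: power_add)
      then have rj: "r j = 2^(n - j) * r n" using lpos[of n] lpos[of j] by (simp add: r_def field_simps)
      have "T j (r j *\<^sub>R h) \<le> ennreal (4^(n - j)) * T j (r n *\<^sub>R h)"
        using nn_integral_translation_double[of "\<lambda>x. F j (f x)" "n - j" "r n *\<^sub>R h"]
        unfolding T_def rj by simp
      then have "ennreal (1 / (r j)\<^sup>2) * T j (r j *\<^sub>R h) \<le> ennreal (1 / (r j)\<^sup>2) * (ennreal (4^(n - j)) * T j (r n *\<^sub>R h))"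
        by (rule mult_left_mono) simp
      also have "\<dots> = ?c * T j (r n *\<^sub>R h)"
      proof -
        have "((2::real)^(n-j))\<^sup>2 = 4^(n-j)" by (simp add: power2_eq_square flip: power_mult_distrib)
        then have "1 / (r j)\<^sup>2 * 4^(n-j) = 1 / (r n)\<^sup>2" using rpos[of n] by (simp add: rj power_mult_distrib)
        then show ?thesis by (simp add: mult.assoc[symmetric] flip: ennreal_mult)
      qed
      finally show ?thesis .
    qed
    then have "(\<Sum>j<n. ennreal (1 / (r j)\<^sup>2) * T j (r j *\<^sub>R h)) \<le> (\<Sum>j<n. ?c * T j (r n *\<^sub>R h))"
      by (intro sum_mono) auto
    also have "\<dots> = ?c * (\<integral>\<^sup>+x. (\<Sum>j<n. ennreal ((F j (f (x + r n *\<^sub>R h)) - F j (f x))\<^sup>2)) \<partial>lborel)"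
      unfolding T_def by (subst nn_integral_sum) (auto simp: sum_distrib_left)
    also have "\<dots> \<le> ?c * (\<integral>\<^sup>+x. ennreal ((f (x + r n *\<^sub>R h) - f x)\<^sup>2) \<partial>lborel)"
      by (intro mult_left_mono nn_integral_mono) (auto intro!: ennreal_leI sl)
    also have "\<dots> \<le> ?c * ennreal (D * (norm (r n *\<^sub>R h))\<^sup>2)"
      by (intro mult_left_mono diff) simp
    also have "\<dots> = ennreal (D * (norm h)\<^sup>2)"
      using rpos[of n] \<open>0 \<le> D\<close> by (simp add: power_mult_distrib flip: ennreal_mult)
    finally show ?thesis .
  qed
  have "(\<Sum>j<n. ennreal ((l j)^4) * emeasure lborel {x. 2 * l j \<le> f x})
     \<le> (\<Sum>j<n. ennreal (16 * B\<^sup>2) * (\<integral>\<^sup>+h. ennreal (1 / (r j)\<^sup>2) * T j (r j *\<^sub>R h) \<partial>unif Q))"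
    by (intro sum_mono step1)
  also have "\<dots> = ennreal (16 * B\<^sup>2) * (\<integral>\<^sup>+h. (\<Sum>j<n. ennreal (1 / (r j)\<^sup>2) * T j (r j *\<^sub>R h)) \<partial>unif Q)"
    by (subst nn_integral_sum) (auto simp: sum_distrib_left)
  \<comment> \<open>The squared diameter of the unit cube is the dimension 4, which turns 16 into
    64.\<close>
  also have "\<dots> \<le> ennreal (16 * B\<^sup>2) * (\<integral>\<^sup>+h. ennreal (D * 4) \<partial>unif Q)"
  proof (intro mult_left_mono nn_integral_unif_mono)
    show "(\<Sum>j<n. ennreal (1 / (r j)\<^sup>2) * T j (r j *\<^sub>R h)) \<le> ennreal (D * 4)" if "h \<in> Q" for h
      using unit_cube_norm[OF that] \<open>0 \<le> D\<close>
      by (intro order_trans[OF step2] ennreal_leI mult_left_mono)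
  qed (auto simp: unit_cube(1))
  also have "\<dots> = ennreal (64 * B\<^sup>2 * D)"
    using \<open>0 \<le> D\<close> by (simp add: emeasure_unif_space[OF unit_cube] flip: ennreal_mult)
  finally show ?thesis by (simp add: l_def)
qed

text \<open>\<open>B\<close> plays the part of a Besov norm of order -1. The slice estimate depends
  neither on the lowest level nor on the number of levels, so values between 2 * 2^-m and 2 * 2^m
  are treated with one bound for all m and Fatou's lemma exhausts the range. Where f lies between 2
  l and 4 l, its fourth power is at most 256 l^4; hence 16384 = 256 * 64.\<close>

theorem refined_Sobolev:
  fixes f :: "R4 \<Rightarrow> real"
  assumes f[measurable]: "f \<in> borel_measurable borel" and pos: "\<And>x. 0 \<le> f x" and "0 \<le> D" "0 < B"
    and diff: "\<And>h. (sq_diff f h) \<le> ennreal (D * (norm h)\<^sup>2)"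
    and avg: "\<And>x r. 0 < r \<Longrightarrow> (\<integral>\<^sup>+h. ennreal (f (x + r *\<^sub>R h)) \<partial>unif Q) \<le> ennreal (B / r)"
  shows "(pow4_integral f) \<le> ennreal (16384 * B\<^sup>2 * D)"
proof -
  define A where "A m = {x. 2 * (1/2)^m \<le> f x \<and> f x < 2 * ((1/2)^m * 2^(2*m))}" for m :: nat
  have [measurable]: "A m \<in> sets borel" for m unfolding A_def by measurable
  have bd: "(\<integral>\<^sup>+x. ennreal ((f x)^4) * indicator (A m) x \<partial>lborel) \<le> ennreal (16384 * B\<^sup>2 * D)" for m
  proof -
    define l where "l j = (1/2::real)^m * 2^j" for j :: nat
    have lpos: "0 < l j" for j by (simp add: l_def)
    have pt: "ennreal ((f x)^4) * indicator (A m) x \<le> (\<Sum>j<2*m. ennreal (256 * (l j)^4) * indicator {x. 2 * l j \<le> f x} x)" for x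
    proof (cases "x \<in> A m")
      case True
      \<comment> \<open>The first level whose double exceeds f x. It is not level 0 on
        \<open>A m\<close>, so it has a predecessor k with 2 l k \<le> f x < 4 l k.\<close>
      define j where "j = (LEAST k. f x < 2 * l k)"
      have ex: "f x < 2 * l (2*m)" using True by (simp add: A_def l_def)
      have j1: "f x < 2 * l j" unfolding j_def by (rule LeastI[where P = "\<lambda>k. f x < 2 * l k", OF ex])
      have "\<not> f x < 2 * l 0" using True by (simp add: A_def l_def)
      then obtain k where k: "j = Suc k" using j1 by (cases j) auto
      have "j \<le> 2 * m" unfolding j_def by (rule Least_le[where P = "\<lambda>k. f x < 2 * l k", OF ex])
      then have km: "k < 2 * m" using k by simp
      have "\<not> f x < 2 * l k" using not_less_Least[of k "\<lambda>k. f x < 2 * l k"] k j_def by simp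
      then have k2: "2 * l k \<le> f x" by simp
      have "(f x)^4 \<le> (4 * l k)^4" using j1 pos[of x] k by (intro power_mono) (auto simp: l_def)
      then have "ennreal ((f x)^4) \<le> ennreal (256 * (l k)^4) * indicator {x. 2 * l k \<le> f x} x"
        using k2 by (simp add: power_mult_distrib ennreal_leI)
      also have "\<dots> \<le> (\<Sum>j<2*m. ennreal (256 * (l j)^4) * indicator {x. 2 * l j \<le> f x} x)"
        using km by (intro member_le_sum) auto
      finally show ?thesis using True by simp
    qed simp
    have "(\<integral>\<^sup>+x. ennreal ((f x)^4) * indicator (A m) x \<partial>lborel)
       \<le> (\<integral>\<^sup>+x. (\<Sum>j<2*m. ennreal (256 * (l j)^4) * indicator {x. 2 * l j \<le> f x} x) \<partial>lborel)"
      by (intro nn_integral_mono pt)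
    also have "\<dots> = (\<Sum>j<2*m. ennreal (256 * (l j)^4) * emeasure lborel {x. 2 * l j \<le> f x})"
      by (subst nn_integral_sum) (auto simp: nn_integral_cmult_indicator)
    also have "\<dots> = ennreal 256 * (\<Sum>j<2*m. ennreal ((l j)^4) * emeasure lborel {x. 2 * l j \<le> f x})"
      by (simp add: sum_distrib_left ennreal_mult mult.assoc)
    also have "\<dots> \<le> ennreal 256 * ennreal (64 * B\<^sup>2 * D)"
      unfolding l_def by (intro mult_left_mono refined_Sobolev_slices assms) auto
    also have "\<dots> = ennreal (16384 * B\<^sup>2 * D)" using \<open>0 \<le> D\<close> by (subst ennreal_mult[symmetric]) auto
    finally show ?thesis .
  qed
  have lim: "(\<lambda>m. ennreal ((f x)^4) * indicator (A m) x) \<longlonglongrightarrow> ennreal ((f x)^4)" for x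
  proof (cases "f x = 0")
    case False
    then have "0 < f x" using pos[of x] by simp
    have p: "(1/2::real)^m * 2^(2*m) = 2^m" for m
    proof -
      have "(4::real)^m = 2^m * 2^m" by (simp flip: power_mult_distrib)
      then show ?thesis by (simp add: power_mult power_divide)
    qed
    have "(\<lambda>m. 2 * (1/2::real)^m) \<longlonglongrightarrow> 2 * 0" by (intro tendsto_intros LIMSEQ_power_zero) simp
    then have 1: "eventually (\<lambda>m. 2 * (1/2::real)^m < f x) sequentially"
      using \<open>0 < f x\<close> by (intro order_tendstoD(2)) auto
    have 2: "eventually (\<lambda>m. f x < 2^m) sequentially"
      using filterlim_realpow_sequentially_gt1[of "2::real"]
      by (auto simp: filterlim_at_infinity_imp_norm_at_top filterlim_at_top_dense dest!: filterlim_at_infinity_imp_norm_at_top)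
    have "eventually (\<lambda>m. ennreal ((f x)^4) * indicator (A m) x = ennreal ((f x)^4)) sequentially"
      using 1 2 by eventually_elim (use \<open>0 < f x\<close> in \<open>auto simp: A_def p\<close>)
    then show ?thesis by (rule tendsto_eventually)
  qed (simp add: zero_power)
  have "(pow4_integral f) = (\<integral>\<^sup>+x. liminf (\<lambda>m. ennreal ((f x)^4) * indicator (A m) x) \<partial>lborel)"
    by (intro nn_integral_cong lim_imp_Liminf[symmetric] lim) simp
  also have "\<dots> \<le> liminf (\<lambda>m. \<integral>\<^sup>+x. ennreal ((f x)^4) * indicator (A m) x \<partial>lborel)"
    by (rule nn_integral_liminf) measurable
  also have "\<dots> \<le> ennreal (16384 * B\<^sup>2 * D)"
    using bd by (intro Liminf_le) auto
  finally show ?thesis .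
qed

section \<open>Local compactness\<close>

lemma square_le_one_plus_pow4: "a\<^sup>2 \<le> 1 + a^4" for a :: real
proof -
  have "0 \<le> a^4" "2 * a\<^sup>2 \<le> a^4 + 1"
    using sum_squares_bound[of "a\<^sup>2" "1"] by simp_all
  then show ?thesis by linarith
qed

lemma integrable_norm_le:
  fixes f :: "'a \<Rightarrow> 'b::{banach, second_countable_topology}"
  assumes "integrable M g" "f \<in> borel_measurable M" "\<And>x. norm (f x) \<le> (g x :: real)"
  shows "integrable M f"
  by (rule Bochner_Integration.integrable_bound[OF assms(1,2)])
     (metis (mono_tags, lifting) AE_I2 abs_ge_self assms(3) order_trans real_norm_def)

lemma nn_integral_unif_cube_affine_le:
  fixes x :: R4
  assumes [measurable]: "F \<in> borel_measurable borel" and r: "0 < r"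
  shows "(\<integral>\<^sup>+h. F (x + r *\<^sub>R h) \<partial>unif Q) \<le> ennreal (1 / r^4) * (\<integral>\<^sup>+z. F z \<partial>lborel)"
proof -
  have "(\<integral>\<^sup>+z. F z \<partial>lborel) = ennreal (r^4) * (\<integral>\<^sup>+h. F (x + r *\<^sub>R h) \<partial>lborel)"
    using r by (subst lborel_affine[of r x]) (auto simp: nn_integral_density nn_integral_distr nn_integral_cmult)
  then have "ennreal (1 / r^4) * (\<integral>\<^sup>+z. F z \<partial>lborel) = ennreal (1 / r^4 * r^4) * (\<integral>\<^sup>+h. F (x + r *\<^sub>R h) \<partial>lborel)"
    using r by (simp only: ennreal_mult mult.assoc zero_le_power less_imp_le zero_le_divide_1_iff)
  also have "\<dots> = (\<integral>\<^sup>+h. F (x + r *\<^sub>R h) \<partial>lborel)" using r by simp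
  also have "\<dots> \<ge> (\<integral>\<^sup>+h. F (x + r *\<^sub>R h) \<partial>unif Q)"
    by (subst nn_integral_unif[OF unit_cube(1)]) (auto intro!: nn_integral_mono simp: indicator_def)
  finally show ?thesis .
qed

text \<open>For r > 0 the mean over the cube of side r with lower corner x. It is a box
  mollification with honest pointwise values, to which an argument of Arzela-Ascoli type
  applies.\<close>

definition avg :: "real \<Rightarrow> (R4 \<Rightarrow> real) \<Rightarrow> R4 \<Rightarrow> real" where
  "avg r v x = (\<integral>h. v (x + r *\<^sub>R h) \<partial>unif Q)"

lemma finite_measure_unif_cube: "finite_measure (unif Q)"
  by standard (simp add: emeasure_unif_space[OF unit_cube])

lemma measure_unif_cube: "measure (unif Q) UNIV = 1"
  using emeasure_unif_space[OF unit_cube] by (simp add: measure_def)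

lemma avg_borel[measurable]: "v \<in> borel_measurable borel \<Longrightarrow> avg r v \<in> borel_measurable borel"
proof -
  assume [measurable]: "v \<in> borel_measurable borel"
  interpret U: finite_measure "unif Q" by (rule finite_measure_unif_cube)
  show ?thesis unfolding avg_def[abs_def]
    by (rule U.borel_measurable_lebesgue_integral) simp
qed

text \<open>Jensen is applied twice, first to v and then to v^2; the change of variables from the
  cube of side r contributes r^-4.\<close>

lemma
  assumes v[measurable]: "v \<in> borel_measurable borel" and r: "0 < r" and A: "0 \<le> A"
    and v4: "(pow4_integral v) \<le> ennreal A"
  shows avg_integrable: "integrable (unif Q) (\<lambda>h. v (x + r *\<^sub>R h))"
    and avg_pow4_le: "(avg r v x)^4 \<le> A / r^4"
proof -
  interpret U: finite_measure "unif Q" by (rule finite_measure_unif_cube)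
  have "(\<integral>\<^sup>+h. ennreal ((v (x + r *\<^sub>R h))^4) \<partial>unif Q) \<le> ennreal (1 / r^4) * (pow4_integral v)"
    by (rule nn_integral_unif_cube_affine_le[OF _ r]) measurable
  also have "\<dots> \<le> ennreal (1 / r^4) * ennreal A" by (rule mult_left_mono[OF v4]) simp
  also have "\<dots> = ennreal (A / r^4)" using r A by (simp flip: ennreal_mult)
  finally have 4: "(\<integral>\<^sup>+h. ennreal ((v (x + r *\<^sub>R h))^4) \<partial>unif Q) \<le> ennreal (A / r^4)" .
  then have i4: "integrable (unif Q) (\<lambda>h. (v (x + r *\<^sub>R h))^4)"
    by (intro integrableI_bounded) (auto intro: le_less_trans)
  have i14: "integrable (unif Q) (\<lambda>h. 1 + (v (x + r *\<^sub>R h))^4)" using i4 by simp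
  show i1: "integrable (unif Q) (\<lambda>h. v (x + r *\<^sub>R h))"
    by (rule integrable_norm_le[OF i14]) (simp_all add: abs_le_one_plus_pow4)
  have i2: "integrable (unif Q) (\<lambda>h. (v (x + r *\<^sub>R h))\<^sup>2)"
    by (rule integrable_norm_le[OF i14]) (simp_all add: square_le_one_plus_pow4)
  let ?m = "\<integral>h. (v (x + r *\<^sub>R h))\<^sup>2 \<partial>unif Q"
  have "ennreal ((avg r v x)\<^sup>2) \<le> ennreal ?m"
    using square_integral_le_nn_integral[of "unif Q" "\<lambda>h. v (x + r *\<^sub>R h)"] i2
    by (simp add: avg_def nn_integral_eq_integral emeasure_unif_space[OF unit_cube])
  then have m1: "(avg r v x)\<^sup>2 \<le> ?m" by (simp add: ennreal_le_iff)
  have "ennreal (?m\<^sup>2) \<le> (\<integral>\<^sup>+h. ennreal (((v (x + r *\<^sub>R h))\<^sup>2)\<^sup>2) \<partial>unif Q)"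
    by (rule square_integral_le_nn_integral) (auto simp: emeasure_unif_space[OF unit_cube])
  also have "\<dots> \<le> ennreal (A / r^4)" using 4 by simp
  finally have "?m\<^sup>2 \<le> A / r^4" using A r by (simp add: ennreal_le_iff)
  moreover have "((avg r v x)\<^sup>2)\<^sup>2 \<le> ?m\<^sup>2" using m1 by (intro power_mono) auto
  ultimately show "(avg r v x)^4 \<le> A / r^4" by simp
qed

text \<open>Both bounds are Jensen over the cube followed by the translation bound: for the
  Lipschitz estimate the shift x - y is the same at all points of the cube, for the L^2 distance the
  shift is r h with h in the cube, of squared length at most 4 r^2.\<close>

lemma
  assumes v[measurable]: "v \<in> borel_measurable borel" and r: "0 < r" and A: "0 \<le> A" and M: "0 \<le> M"
    and v4: "(pow4_integral v) \<le> ennreal A"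
    and diff: "\<And>h. (sq_diff v h) \<le> ennreal (M * (norm h)\<^sup>2)"
  shows avg_lipschitz: "\<bar>avg r v x - avg r v y\<bar> \<le> sqrt (M / r^4) * norm (x - y)"
    and avg_L2_dist: "(\<integral>\<^sup>+x. ennreal ((v x - avg r v x)\<^sup>2) \<partial>lborel) \<le> ennreal (4 * M * r\<^sup>2)"
proof -
  note int = avg_integrable[OF v r A v4]
  interpret U: finite_measure "unif Q" by (rule finite_measure_unif_cube)
  have "ennreal ((avg r v x - avg r v y)\<^sup>2) = ennreal ((\<integral>h. v (x + r *\<^sub>R h) - v (y + r *\<^sub>R h) \<partial>unif Q)\<^sup>2)"
    using int by (simp add: avg_def)
  also have "\<dots> \<le> (\<integral>\<^sup>+h. ennreal ((v (x + r *\<^sub>R h) - v (y + r *\<^sub>R h))\<^sup>2) \<partial>unif Q)"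
    by (rule square_integral_le_nn_integral) (auto simp: emeasure_unif_space[OF unit_cube])
  also have "\<dots> = (\<integral>\<^sup>+h. ennreal ((v ((y + r *\<^sub>R h) + (x - y)) - v (y + r *\<^sub>R h))\<^sup>2) \<partial>unif Q)"
    by (simp add: algebra_simps)
  also have "\<dots> \<le> ennreal (1 / r^4) * (\<integral>\<^sup>+z. ennreal ((v (z + (x - y)) - v z)\<^sup>2) \<partial>lborel)"
    by (rule nn_integral_unif_cube_affine_le[OF _ r, of "\<lambda>z. ennreal ((v (z + (x - y)) - v z)\<^sup>2)"]) measurable
  also have "\<dots> \<le> ennreal (1 / r^4) * ennreal (M * (norm (x - y))\<^sup>2)"
    by (rule mult_left_mono[OF diff]) simp
  also have "\<dots> = ennreal (M / r^4 * (norm (x - y))\<^sup>2)"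
    using r M by (simp flip: ennreal_mult)
  finally have "(avg r v x - avg r v y)\<^sup>2 \<le> M / r^4 * (norm (x - y))\<^sup>2"
    using r M by (subst (asm) ennreal_le_iff) auto
  then have "sqrt ((avg r v x - avg r v y)\<^sup>2) \<le> sqrt (M / r^4 * (norm (x - y))\<^sup>2)"
    by (rule real_sqrt_le_mono)
  then show "\<bar>avg r v x - avg r v y\<bar> \<le> sqrt (M / r^4) * norm (x - y)"
    by (simp only: real_sqrt_abs real_sqrt_mult abs_norm_cancel)
  have "(\<integral>\<^sup>+x. ennreal ((v x - avg r v x)\<^sup>2) \<partial>lborel) \<le> (\<integral>\<^sup>+x. (\<integral>\<^sup>+h. ennreal ((v (x + r *\<^sub>R h) - v x)\<^sup>2) \<partial>unif Q) \<partial>lborel)"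
  proof (rule nn_integral_mono)
    fix x
    have "v x - avg r v x = (\<integral>h. v x - v (x + r *\<^sub>R h) \<partial>unif Q)"
      using int by (simp add: avg_def measure_unif_cube)
    then show "ennreal ((v x - avg r v x)\<^sup>2) \<le> (\<integral>\<^sup>+h. ennreal ((v (x + r *\<^sub>R h) - v x)\<^sup>2) \<partial>unif Q)"
      using square_integral_le_nn_integral[of "unif Q" "\<lambda>h. v x - v (x + r *\<^sub>R h)"]
      by (simp add: emeasure_unif_space[OF unit_cube] power2_commute[of "v x"])
  qed
  also have "\<dots> = (\<integral>\<^sup>+h. (\<integral>\<^sup>+x. ennreal ((v (x + r *\<^sub>R h) - v x)\<^sup>2) \<partial>lborel) \<partial>unif Q)"
    by (rule nn_integral_unif_Fubini[OF unit_cube]) (auto simp: borel_prod[symmetric])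
  also have "\<dots> \<le> (\<integral>\<^sup>+h. ennreal (4 * M * r\<^sup>2) \<partial>unif Q)"
  proof (rule nn_integral_unif_mono[OF unit_cube(1)])
    fix h assume "h \<in> Q"
    then have "M * (norm (r *\<^sub>R h))\<^sup>2 \<le> 4 * M * r\<^sup>2"
      using mult_left_mono[OF unit_cube_norm[of h], of "M * r\<^sup>2"] M by (simp add: power_mult_distrib mult_ac)
    then show "(\<integral>\<^sup>+x. ennreal ((v (x + r *\<^sub>R h) - v x)\<^sup>2) \<partial>lborel) \<le> ennreal (4 * M * r\<^sup>2)"
      by (intro order_trans[OF diff] ennreal_leI)
  qed measurable
  also have "\<dots> = ennreal (4 * M * r\<^sup>2)" by (simp add: emeasure_unif_space[OF unit_cube])
  finally show "(\<integral>\<^sup>+x. ennreal ((v x - avg r v x)\<^sup>2) \<partial>lborel) \<le> ennreal (4 * M * r\<^sup>2)" .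
qed

text \<open>An Arzela-Ascoli argument: a diagonal subsequence converges at all points of a countable
  dense set and for all dyadic radii together. For a fixed radius the averages share a Lipschitz
  constant, so convergence spreads from the dense set to every point.\<close>

lemma avg_convergent_subsequence:
  fixes v :: "nat \<Rightarrow> R4 \<Rightarrow> real"
  assumes v[measurable]: "\<And>m. v m \<in> borel_measurable borel" and A: "0 \<le> A" and M: "0 \<le> M"
    and v4: "\<And>m. (pow4_integral (v m)) \<le> ennreal A"
    and diff: "\<And>m h. (sq_diff (v m) h) \<le> ennreal (M * (norm h)\<^sup>2)"
  obtains r :: "nat \<Rightarrow> nat" where "strict_mono r" "\<And>k x. convergent (\<lambda>m. avg ((1/2)^k) (v (r m)) x)"
proof -
  obtain D :: "R4 set" where D: "countable D" "\<And>X. open X \<Longrightarrow> X \<noteq> {} \<Longrightarrow> \<exists>d\<in>D. d \<in> X"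
    using countable_dense_exists by blast
  \<comment> \<open>The averages alone are bounded only by a multiple of 2^k. The factor (1/2)^k
    gives one bound for all radii, as the joint diagonal extraction requires.\<close>
  have bd: "norm ((1/2)^k * avg ((1/2)^k) (v m) x) \<le> 1 + A" for k m x
  proof -
    have "((1/2)^k * avg ((1/2)^k) (v m) x)^4 \<le> ((1/2)^k)^4 * (A / ((1/2)^k)^4)"
      unfolding power_mult_distrib by (intro mult_left_mono avg_pow4_le[OF v _ A v4]) auto
    then have "((1/2)^k * avg ((1/2)^k) (v m) x)^4 \<le> A" by simp
    then show ?thesis using abs_le_one_plus_pow4[of "(1/2)^k * avg ((1/2)^k) (v m) x"] by simp
  qed
  have cS: "countable ((UNIV :: nat set) \<times> D)" using D(1) by simp
  have bd': "norm (case p of (k, x) \<Rightarrow> (1/2)^k * avg ((1/2)^k) (v m) x) \<le> 1 + A"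
    if "p \<in> (UNIV :: nat set) \<times> D" for m p
    using bd by (cases p) simp
  obtain r :: "nat \<Rightarrow> nat" where r: "strict_mono r"
    "\<And>p. p \<in> UNIV \<times> D \<Longrightarrow> \<exists>l. (\<lambda>m. case p of (k, x) \<Rightarrow> (1/2)^k * avg ((1/2)^k) (v (r m)) x) \<longlonglongrightarrow> l"
    by (rule function_convergent_subsequence
      [where f = "\<lambda>m p. case p of (k, x) \<Rightarrow> (1/2)^k * avg ((1/2)^k) (v m) x", OF cS bd']) (assumption, rule that)
  have cD: "convergent (\<lambda>m. avg ((1/2)^k) (v (r m)) q)" if "q \<in> D" for k q
  proof -
    have "\<exists>l. (\<lambda>m. (1/2)^k * avg ((1/2)^k) (v (r m)) q) \<longlonglongrightarrow> l"
      using r(2)[of "(k, q)"] that by (simp only: prod.case mem_Sigma_iff UNIV_I simp_thms)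
    then obtain l where "(\<lambda>m. (1/2)^k * avg ((1/2)^k) (v (r m)) q) \<longlonglongrightarrow> l" ..
    then have "(\<lambda>m. 2^k * ((1/2)^k * avg ((1/2)^k) (v (r m)) q)) \<longlonglongrightarrow> 2^k * l"
      by (rule tendsto_mult_left)
    moreover have "2^k * ((1/2)^k * a) = a" for a :: real by (simp add: power_divide)
    ultimately show ?thesis by (simp only: convergent_def) blast
  qed
  have "Cauchy (\<lambda>m. avg ((1/2)^k) (v (r m)) x)" for k x
  proof (rule metric_CauchyI)
    fix e :: real assume e: "0 < e"
    define L where "L = sqrt (M / ((1/2)^k)^4)"
    have L: "0 \<le> L" using M by (simp add: L_def)
    have lip: "\<bar>avg ((1/2)^k) (v m) x - avg ((1/2)^k) (v m) y\<bar> \<le> L * norm (x - y)" for m y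
      unfolding L_def by (rule avg_lipschitz[OF v _ A M v4 diff]) simp
    \<comment> \<open>\<open>L + 1\<close> and not \<open>L\<close>, because the Lipschitz constant
      may be zero.\<close>
    have pos: "0 < e / (3 * (L + 1))" using e L by (intro divide_pos_pos) auto
    obtain q where q: "q \<in> D" "q \<in> ball x (e / (3 * (L + 1)))"
      using D(2)[of "ball x (e / (3 * (L + 1)))"] pos by (auto simp del: mem_ball simp: ball_eq_empty not_le)
    have "L * norm (x - q) \<le> (L + 1) * (e / (3 * (L + 1)))"
      using q L by (intro mult_mono) (auto simp: dist_norm less_imp_le)
    also have "\<dots> = e / 3" using L by (simp add: field_simps)
    finally have Lq: "L * norm (x - q) \<le> e / 3" .
    obtain N where N: "\<And>m n. m \<ge> N \<Longrightarrow> n \<ge> N \<Longrightarrow> dist (avg ((1/2)^k) (v (r m)) q) (avg ((1/2)^k) (v (r n)) q) < e / 3"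
      using metric_CauchyD[OF convergent_Cauchy[OF cD[OF q(1), of k]], of "e/3"] e by auto
    show "\<exists>N. \<forall>m\<ge>N. \<forall>n\<ge>N. dist (avg ((1/2)^k) (v (r m)) x) (avg ((1/2)^k) (v (r n)) x) < e"
    proof (intro exI allI impI)
      fix m n assume "N \<le> m" "N \<le> n"
      then show "dist (avg ((1/2)^k) (v (r m)) x) (avg ((1/2)^k) (v (r n)) x) < e"
        using N[of m n] lip[of "r m" q] lip[of "r n" q] Lq unfolding dist_real_def by linarith
    qed
  qed
  then show ?thesis using r(1) Cauchy_convergent that by blast
qed

text \<open>Young's inequality |f| \<le> t f^2 + 1/t in place of Cauchy-Schwarz: the free parameter
  t balances a small L^2 norm against the total weight.\<close>

lemma nn_integral_weight_le:
  fixes f \<rho> :: "'a \<Rightarrow> real"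
  assumes [measurable]: "f \<in> borel_measurable M" "\<rho> \<in> borel_measurable M"
    and \<rho>: "\<And>x. 0 \<le> \<rho> x" "\<And>x. \<rho> x \<le> 1" "integrable M \<rho>"
    and f: "(\<integral>\<^sup>+x. ennreal ((f x)\<^sup>2) \<partial>M) \<le> ennreal C" "0 \<le> C" and t: "0 < t"
  shows "integrable M (\<lambda>x. \<bar>f x\<bar> * \<rho> x)" "(\<integral>x. \<bar>f x\<bar> * \<rho> x \<partial>M) \<le> t * C + (\<integral>x. \<rho> x \<partial>M) / t"
proof -
  have i2: "integrable M (\<lambda>x. (f x)\<^sup>2)"
    using f by (intro integrableI_bounded) (auto intro: le_less_trans)
  have "ennreal (\<integral>x. (f x)\<^sup>2 \<partial>M) \<le> ennreal C" using f i2 by (simp add: nn_integral_eq_integral)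
  then have C: "(\<integral>x. (f x)\<^sup>2 \<partial>M) \<le> C" using f(2) by (simp add: ennreal_le_iff)
  have pt: "\<bar>f x\<bar> * \<rho> x \<le> t * (f x)\<^sup>2 + \<rho> x / t" for x
  proof -
    have "2 * (t * \<bar>f x\<bar>) * 1 \<le> (t * \<bar>f x\<bar>)\<^sup>2 + 1\<^sup>2" by (rule sum_squares_bound)
    then have "t * \<bar>f x\<bar> \<le> t\<^sup>2 * (f x)\<^sup>2 + 1" using t
      by (simp add: power_mult_distrib) (smt (verit) mult_nonneg_nonneg zero_le_power2)
    then have "\<bar>f x\<bar> \<le> t * (f x)\<^sup>2 + 1 / t" using t by (simp add: field_simps power2_eq_square)
    then have "\<bar>f x\<bar> * \<rho> x \<le> (t * (f x)\<^sup>2 + 1 / t) * \<rho> x" using \<rho> by (intro mult_right_mono) auto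
    also have "\<dots> = t * (f x)\<^sup>2 * \<rho> x + \<rho> x / t" by (simp add: algebra_simps)
    also have "\<dots> \<le> t * (f x)\<^sup>2 + \<rho> x / t" using \<rho> t by (intro add_right_mono mult_left_le) auto
    finally show ?thesis .
  qed
  have ib: "integrable M (\<lambda>x. t * (f x)\<^sup>2 + \<rho> x / t)" using i2 \<rho>(3) by simp
  show i: "integrable M (\<lambda>x. \<bar>f x\<bar> * \<rho> x)"
    by (rule integrable_norm_le[OF ib]) (use pt \<rho>(1) in \<open>simp_all add: abs_mult\<close>)
  have "(\<integral>x. \<bar>f x\<bar> * \<rho> x \<partial>M) \<le> (\<integral>x. t * (f x)\<^sup>2 + \<rho> x / t \<partial>M)"
    by (intro integral_mono i ib pt)
  also have "\<dots> = t * (\<integral>x. (f x)\<^sup>2 \<partial>M) + (\<integral>x. \<rho> x \<partial>M) / t" using i2 \<rho>(3) by simp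
  also have "\<dots> \<le> t * C + (\<integral>x. \<rho> x \<partial>M) / t" using C t by simp
  finally show "(\<integral>x. \<bar>f x\<bar> * \<rho> x \<partial>M) \<le> t * C + (\<integral>x. \<rho> x \<partial>M) / t" .
qed

text \<open>The functions are compared through their averages at one small scale. The distance to
  the averages is small uniformly in the index; the averages themselves are bounded and converge
  pointwise, hence converge in the weighted L^1 norm. Four such errors, each below e / 4, separate
  two members of the sequence.\<close>

lemma weighted_L1_Cauchy:
  fixes v :: "nat \<Rightarrow> R4 \<Rightarrow> real"
  assumes v[measurable]: "\<And>m. v m \<in> borel_measurable borel" and A: "0 \<le> A" and M: "0 \<le> M"
    and v4: "\<And>m. (pow4_integral (v m)) \<le> ennreal A"
    and diff: "\<And>m h. (sq_diff (v m) h) \<le> ennreal (M * (norm h)\<^sup>2)"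
    and conv: "\<And>k x. convergent (\<lambda>m. avg ((1/2)^k) (v m) x)"
    and \<rho>m[measurable]: "\<rho> \<in> borel_measurable borel" and \<rho>: "\<And>x. 0 \<le> \<rho> x" "\<And>x. \<rho> x \<le> 1" "integrable lborel \<rho>"
    and e: "0 < e"
  shows "\<exists>N. \<forall>i\<ge>N. \<forall>j\<ge>N. (\<integral>x. \<bar>v i x - v j x\<bar> * \<rho> x \<partial>lborel) < e"
proof -
  let ?C = "4 * M + (\<integral>x. \<rho> x \<partial>lborel)"
  have C0: "0 \<le> ?C" using M \<rho> by simp
  obtain k where k: "(1/2)^k * ?C < e / 4"
  proof -
    have "(\<lambda>k. (1/2)^k * ?C) \<longlonglongrightarrow> 0 * ?C" by (intro tendsto_intros LIMSEQ_power_zero) simp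
    then have "eventually (\<lambda>k. (1/2)^k * ?C < e / 4) sequentially"
      using e by (intro order_tendstoD(2)) auto
    then show ?thesis using that eventually_happens[of _ sequentially] by auto
  qed
  define a where "a m = avg ((1/2)^k) (v m)" for m
  define b where "b x = lim (\<lambda>m. a m x)" for x
  have am[measurable]: "a m \<in> borel_measurable borel" for m unfolding a_def by measurable
  have bm[measurable]: "b \<in> borel_measurable borel" unfolding b_def by measurable
  have lim: "(\<lambda>m. a m x) \<longlonglongrightarrow> b x" for x
    unfolding b_def using conv[of k x] by (simp add: a_def convergent_LIMSEQ_iff)
  define c where "c = 1 + A / ((1/2)^k)^4"
  have ab: "\<bar>a m x\<bar> \<le> c" for m x
    using avg_pow4_le[OF v _ A v4, of "(1/2)^k" m x] abs_le_one_plus_pow4[of "a m x"] by (simp add: a_def c_def)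
  have bb: "\<bar>b x\<bar> \<le> c" for x
    by (rule LIMSEQ_le_const2[OF tendsto_rabs[OF lim[of x]]]) (use ab in auto)
  have abc: "\<bar>a m x - b x\<bar> * \<rho> x \<le> (2 * c) * \<rho> x" for m x
  proof (rule mult_right_mono[OF _ \<rho>(1)])
    show "\<bar>a m x - b x\<bar> \<le> 2 * c" using ab[of m x] bb[of x] by linarith
  qed
  have abi: "integrable lborel (\<lambda>x. \<bar>a m x - b x\<bar> * \<rho> x)" for m
    by (rule integrable_norm_le[OF integrable_mult_right[OF \<rho>(3), of "2 * c"]]) (use abc \<rho>(1) in \<open>simp_all add: abs_mult\<close>)
  have "(\<lambda>m. \<integral>x. \<bar>a m x - b x\<bar> * \<rho> x \<partial>lborel) \<longlonglongrightarrow> (\<integral>x. 0 \<partial>(lborel::R4 measure))"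
  proof (rule integral_dominated_convergence)
    show "integrable lborel (\<lambda>x. (2 * c) * \<rho> x)" using \<rho>(3) by (rule integrable_mult_right)
    show "AE x in lborel. (\<lambda>m. \<bar>a m x - b x\<bar> * \<rho> x) \<longlonglongrightarrow> 0"
    proof (rule AE_I2)
      fix x
      have "(\<lambda>m. \<bar>a m x - b x\<bar> * \<rho> x) \<longlonglongrightarrow> \<bar>b x - b x\<bar> * \<rho> x" by (intro tendsto_intros lim)
      then show "(\<lambda>m. \<bar>a m x - b x\<bar> * \<rho> x) \<longlonglongrightarrow> 0" by simp
    qed
    show "AE x in lborel. norm (\<bar>a m x - b x\<bar> * \<rho> x) \<le> (2 * c) * \<rho> x" for m
      by (rule AE_I2) (use abc \<rho>(1) in \<open>simp add: abs_mult\<close>)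
  qed measurable
  then have "(\<lambda>m. \<integral>x. \<bar>a m x - b x\<bar> * \<rho> x \<partial>lborel) \<longlonglongrightarrow> 0" by simp
  then have "eventually (\<lambda>m. (\<integral>x. \<bar>a m x - b x\<bar> * \<rho> x \<partial>lborel) < e / 4) sequentially"
    using e by (intro order_tendstoD(2)) auto
  then obtain N where N: "\<And>m. m \<ge> N \<Longrightarrow> (\<integral>x. \<bar>a m x - b x\<bar> * \<rho> x \<partial>lborel) < e / 4"
    by (auto simp: eventually_sequentially)
  have vai: "integrable lborel (\<lambda>x. \<bar>v m x - a m x\<bar> * \<rho> x)"
    and va: "(\<integral>x. \<bar>v m x - a m x\<bar> * \<rho> x \<partial>lborel) < e / 4" for m
  proof -
    have L2: "(\<integral>\<^sup>+x. ennreal ((v m x - a m x)\<^sup>2) \<partial>lborel) \<le> ennreal (4 * M * ((1/2)^k)\<^sup>2)"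
      unfolding a_def by (rule avg_L2_dist[OF v _ A M v4 diff]) simp
    \<comment> \<open>The squared L^2 distance to the averages is at most 4 M 4^-k. The parameter
      2^k makes both terms of the Young bound of order 2^-k.\<close>
    note w = nn_integral_weight_le[OF _ _ \<rho> L2, of "2^k"]
    show "integrable lborel (\<lambda>x. \<bar>v m x - a m x\<bar> * \<rho> x)" using M by (intro w) auto
    have "(\<integral>x. \<bar>v m x - a m x\<bar> * \<rho> x \<partial>lborel) \<le> 2^k * (4 * M * ((1/2)^k)\<^sup>2) + (\<integral>x. \<rho> x \<partial>lborel) / 2^k"
      using M by (intro w) auto
    also have "\<dots> = (1/2)^k * ?C"
      by (simp add: power_divide power2_eq_square algebra_simps add_divide_distrib)
    finally show "(\<integral>x. \<bar>v m x - a m x\<bar> * \<rho> x \<partial>lborel) < e / 4" using k by simp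
  qed
  show ?thesis
  proof (intro exI allI impI)
    fix i j assume ij: "N \<le> i" "N \<le> j"
    let ?g = "\<lambda>x. (\<bar>v i x - a i x\<bar> * \<rho> x + \<bar>v j x - a j x\<bar> * \<rho> x) + (\<bar>a i x - b x\<bar> * \<rho> x + \<bar>a j x - b x\<bar> * \<rho> x)"
    have gi: "integrable lborel ?g" by (intro Bochner_Integration.integrable_add vai abi)
    have pt: "\<bar>v i x - v j x\<bar> * \<rho> x \<le> ?g x" for x
    proof -
      have "\<bar>v i x - v j x\<bar> \<le> \<bar>v i x - a i x\<bar> + \<bar>v j x - a j x\<bar> + (\<bar>a i x - b x\<bar> + \<bar>a j x - b x\<bar>)" by linarith
      from mult_right_mono[OF this \<rho>(1)[of x]] show ?thesis by (simp add: algebra_simps)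
    qed
    have "integrable lborel (\<lambda>x. \<bar>v i x - v j x\<bar> * \<rho> x)"
      by (rule integrable_norm_le[OF gi]) (use pt \<rho>(1) in \<open>simp_all add: abs_mult\<close>)
    then have "(\<integral>x. \<bar>v i x - v j x\<bar> * \<rho> x \<partial>lborel) \<le> (\<integral>x. ?g x \<partial>lborel)"
      by (intro integral_mono gi pt)
    also have "\<dots> = ((\<integral>x. \<bar>v i x - a i x\<bar> * \<rho> x \<partial>lborel) + (\<integral>x. \<bar>v j x - a j x\<bar> * \<rho> x \<partial>lborel)) +
      ((\<integral>x. \<bar>a i x - b x\<bar> * \<rho> x \<partial>lborel) + (\<integral>x. \<bar>a j x - b x\<bar> * \<rho> x \<partial>lborel))"
      by (simp add: Bochner_Integration.integral_add vai abi)
    also have "\<dots> < e" using N[OF ij(1)] N[OF ij(2)] va[of i] va[of j] by linarith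
    finally show "(\<integral>x. \<bar>v i x - v j x\<bar> * \<rho> x \<partial>lborel) < e" .
  qed
qed

text \<open>A strictly positive integrable weight permits extracting an almost everywhere convergent
  subsequence on the whole space at once, without an exhaustion by balls.\<close>

lemma lborel_positive_weight:
  obtains \<rho> :: "'a::euclidean_space \<Rightarrow> real" where "\<rho> \<in> borel_measurable borel" "\<And>x. 0 < \<rho> x" "\<And>x. \<rho> x \<le> 1"
    "integrable lborel \<rho>"
proof -
  obtain h :: "'a \<Rightarrow> ennreal" where h[measurable]: "h \<in> borel_measurable borel" and hf: "integral\<^sup>N lborel h \<noteq> \<infinity>"
    and hp: "\<And>x. 0 < h x \<and> h x < \<infinity>"
    using sigma_finite_measure.Ex_finite_integrable_function[OF sigma_finite_lborel] by auto
  let ?\<rho> = "\<lambda>x. min 1 (enn2real (h x))"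
  have "ennreal (norm (?\<rho> x)) \<le> h x" for x
  proof -
    have "ennreal (norm (?\<rho> x)) \<le> ennreal (enn2real (h x))" by (intro ennreal_leI) simp
    also have "\<dots> = h x" using hp[of x] by simp
    finally show ?thesis .
  qed
  then have "(\<integral>\<^sup>+x. ennreal (norm (?\<rho> x)) \<partial>lborel) \<le> integral\<^sup>N lborel h"
    by (intro nn_integral_mono)
  then have "integrable lborel ?\<rho>"
    using hf by (intro integrableI_bounded) (auto simp: less_top[symmetric] top_unique)
  then show ?thesis
    using hp by (intro that[of ?\<rho>]) (auto simp: enn2real_positive_iff)
qed

text \<open>One positive weight selects the almost everywhere convergent subsequence. Indicators of
  balls, used as weights, then give the Cauchy property in local L^1, and Fatou in the second index
  turns it into convergence to \<open>V\<close>; Fatou also passes the L^4 bound on.\<close>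

lemma Rellich:
  fixes v :: "nat \<Rightarrow> R4 \<Rightarrow> real"
  assumes v[measurable]: "\<And>m. v m \<in> borel_measurable borel" and A: "0 \<le> A" and M: "0 \<le> M"
    and v4: "\<And>m. (pow4_integral (v m)) \<le> ennreal A"
    and diff: "\<And>m h. (sq_diff (v m) h) \<le> ennreal (M * (norm h)\<^sup>2)"
  obtains r :: "nat \<Rightarrow> nat" and V where "strict_mono r" "V \<in> borel_measurable borel"
    "AE x in lborel. (\<lambda>i. v (r i) x) \<longlonglongrightarrow> V x"
    "(pow4_integral V) \<le> ennreal A"
    "\<And>N e. 0 < e \<Longrightarrow> \<exists>i0. \<forall>i\<ge>i0. (\<integral>\<^sup>+x. ennreal (\<bar>v (r i) x - V x\<bar> * indicator (cball 0 N) x) \<partial>lborel) \<le> ennreal e"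
proof -
  obtain r :: "nat \<Rightarrow> nat" where r: "strict_mono r" and conv: "\<And>k x. convergent (\<lambda>m. avg ((1/2)^k) (v (r m)) x)"
    by (rule avg_convergent_subsequence[where v = v, OF v A M v4 diff]) (rule that)
  note cauchy = weighted_L1_Cauchy[where v = "\<lambda>m. v (r m)", OF v A M v4 diff conv]
  obtain \<rho> :: "R4 \<Rightarrow> real" where [measurable]: "\<rho> \<in> borel_measurable borel" and \<rho>: "\<And>x. 0 < \<rho> x" "\<And>x. \<rho> x \<le> 1" "integrable lborel \<rho>"
    using lborel_positive_weight by metis
  have i4: "integrable lborel (\<lambda>x. (v m x)^4)" for m
    using v4[of m] by (intro integrableI_bounded) (auto intro: le_less_trans)
  have iw: "integrable lborel (\<lambda>x. v m x * \<sigma> x)" if [measurable]: "\<sigma> \<in> borel_measurable borel" and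
    \<sigma>: "\<And>x. 0 \<le> \<sigma> x" "\<And>x. \<sigma> x \<le> 1" "integrable lborel \<sigma>" for m \<sigma>
  proof (rule integrable_norm_le)
    show "integrable lborel (\<lambda>x. \<sigma> x + (v m x)^4)" using \<sigma>(3) i4[of m] by simp
    have "\<bar>v m x\<bar> * \<sigma> x \<le> \<sigma> x + (v m x)^4" for x
    proof -
      have "\<bar>v m x\<bar> * \<sigma> x \<le> (1 + (v m x)^4) * \<sigma> x" using \<sigma>(1) by (intro mult_right_mono abs_le_one_plus_pow4)
      also have "\<dots> \<le> \<sigma> x + (v m x)^4" using mult_left_mono[OF \<sigma>(2)[of x], of "(v m x)^4"] by (simp add: algebra_simps)
      finally show ?thesis .
    qed
    then show "norm (v m x * \<sigma> x) \<le> \<sigma> x + (v m x)^4" for x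
      using \<sigma>(1) by (simp add: abs_mult)
  qed measurable
  obtain q where q: "strict_mono q" "AE x in lborel. Cauchy (\<lambda>i. v (r (q i)) x * \<rho> x)"
  proof (rule cauchy_L1_AE_cauchy_subseq[of lborel "\<lambda>n x. v (r n) x * \<rho> x"])
    show "integrable lborel (\<lambda>x. v (r n) x * \<rho> x)" for n
      using \<rho> by (intro iw) (auto intro: less_imp_le)
    fix e :: real assume e: "0 < e"
    have "\<exists>N. \<forall>i\<ge>N. \<forall>j\<ge>N. (\<integral>x. \<bar>v (r i) x - v (r j) x\<bar> * \<rho> x \<partial>lborel) < e"
      by (rule cauchy) (use \<rho> e in \<open>auto intro: less_imp_le\<close>)
    moreover have "norm (v (r i) x * \<rho> x - v (r j) x * \<rho> x) = \<bar>v (r i) x - v (r j) x\<bar> * \<rho> x" for i j x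
      using \<rho>(1)[of x] by (simp add: abs_mult flip: left_diff_distrib)
    ultimately show "\<exists>N. \<forall>i\<ge>N. \<forall>j\<ge>N. LINT x|lborel. norm (v (r i) x * \<rho> x - v (r j) x * \<rho> x) < e"
      by simp
  qed
  define s where "s i = r (q i)" for i
  have s: "strict_mono s" using r q(1) by (simp add: s_def strict_mono_def)
  \<comment> \<open>\<open>lim\<close> yields a Borel function defined everywhere, including the
    null set on which the sequence may diverge.\<close>
  define V where "V x = lim (\<lambda>i. v (s i) x)" for x
  have Vm[measurable]: "V \<in> borel_measurable borel" unfolding V_def by measurable
  have ae: "AE x in lborel. (\<lambda>i. v (s i) x) \<longlonglongrightarrow> V x"
    using q(2)
  proof eventually_elim
    case (elim x)
    then have "convergent (\<lambda>i. v (s i) x * \<rho> x)" by (simp add: Cauchy_convergent s_def)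
    then obtain l where "(\<lambda>i. v (s i) x * \<rho> x) \<longlonglongrightarrow> l" by (auto simp: convergent_def)
    then have "(\<lambda>i. v (s i) x * \<rho> x / \<rho> x) \<longlonglongrightarrow> l / \<rho> x"
      using \<rho>(1)[of x] by (intro tendsto_divide tendsto_const) auto
    then have "convergent (\<lambda>i. v (s i) x * \<rho> x / \<rho> x)" by (rule convergentI)
    then have "convergent (\<lambda>i. v (s i) x)" using \<rho>(1)[of x] by simp
    then show ?case by (simp add: V_def convergent_LIMSEQ_iff)
  qed
  have V4: "(pow4_integral V) \<le> ennreal A"
  proof -
    have "(pow4_integral V) = (\<integral>\<^sup>+x. liminf (\<lambda>i. ennreal ((v (s i) x)^4)) \<partial>lborel)"
    proof (rule nn_integral_cong_AE)
      show "AE x in lborel. ennreal ((V x)^4) = liminf (\<lambda>i. ennreal ((v (s i) x)^4))"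
        using ae by eventually_elim (intro lim_imp_Liminf[symmetric] tendsto_intros; simp)
    qed
    also have "\<dots> \<le> liminf (\<lambda>i. \<integral>\<^sup>+x. ennreal ((v (s i) x)^4) \<partial>lborel)"
      by (rule nn_integral_liminf) measurable
    also have "\<dots> \<le> ennreal A" using v4 by (intro Liminf_le) auto
    finally show ?thesis .
  qed
  have L1: "\<exists>i0. \<forall>i\<ge>i0. (\<integral>\<^sup>+x. ennreal (\<bar>v (s i) x - V x\<bar> * indicator (cball 0 N) x) \<partial>lborel) \<le> ennreal e" if e: "0 < e" for N e
  proof -
    let ?\<sigma> = "indicator (cball 0 N) :: R4 \<Rightarrow> real"
    have [measurable]: "cball 0 N \<in> sets (borel :: R4 measure)" by (intro borel_closed closed_cball)
    have \<sigma>: "integrable lborel ?\<sigma>"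
      using emeasure_bounded_finite[OF bounded_cball[of 0 N]] by (intro integrable_real_indicator) auto
    have "\<exists>i0. \<forall>i\<ge>i0. \<forall>j\<ge>i0. (\<integral>x. \<bar>v (r i) x - v (r j) x\<bar> * ?\<sigma> x \<partial>lborel) < e"
      by (rule cauchy) (use \<sigma> e in auto)
    then obtain i0 where i0: "\<And>i j. i \<ge> i0 \<Longrightarrow> j \<ge> i0 \<Longrightarrow> (\<integral>x. \<bar>v (r i) x - v (r j) x\<bar> * ?\<sigma> x \<partial>lborel) < e" by blast
    have le: "(\<integral>\<^sup>+x. ennreal (\<bar>v (s i) x - v (s j) x\<bar> * ?\<sigma> x) \<partial>lborel) \<le> ennreal e" if "i \<ge> i0" "j \<ge> i0" for i j
    proof -
      have "integrable lborel (\<lambda>x. v (s i) x * ?\<sigma> x - v (s j) x * ?\<sigma> x)"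
        by (intro Bochner_Integration.integrable_diff iw) (use \<sigma> in auto)
      then have "integrable lborel (\<lambda>x. \<bar>v (s i) x - v (s j) x\<bar> * ?\<sigma> x)"
        by (subst (asm) integrable_abs_iff[symmetric]) (auto simp: abs_mult simp flip: left_diff_distrib)
      moreover have "s i = r (q i)" "s j = r (q j)" "i0 \<le> q i" "i0 \<le> q j"
        using that seq_suble[OF q(1)] order_trans by (auto simp: s_def)
      ultimately show ?thesis
        using i0[of "q i" "q j"] by (subst nn_integral_eq_integral) (auto intro!: ennreal_leI)
    qed
    have "(\<integral>\<^sup>+x. ennreal (\<bar>v (s i) x - V x\<bar> * ?\<sigma> x) \<partial>lborel) \<le> ennreal e" if "i \<ge> i0" for i
    proof -
      have "(\<integral>\<^sup>+x. ennreal (\<bar>v (s i) x - V x\<bar> * ?\<sigma> x) \<partial>lborel) = (\<integral>\<^sup>+x. liminf (\<lambda>j. ennreal (\<bar>v (s i) x - v (s j) x\<bar> * ?\<sigma> x)) \<partial>lborel)"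
      proof (rule nn_integral_cong_AE)
        show "AE x in lborel. ennreal (\<bar>v (s i) x - V x\<bar> * ?\<sigma> x) = liminf (\<lambda>j. ennreal (\<bar>v (s i) x - v (s j) x\<bar> * ?\<sigma> x))"
          using ae by eventually_elim (intro lim_imp_Liminf[symmetric] tendsto_intros; simp)
      qed
      also have "\<dots> \<le> liminf (\<lambda>j. \<integral>\<^sup>+x. ennreal (\<bar>v (s i) x - v (s j) x\<bar> * ?\<sigma> x) \<partial>lborel)"
        by (rule nn_integral_liminf) measurable
      also have "\<dots> \<le> ennreal e"
      proof (rule Liminf_le)
        show "eventually (\<lambda>j. (\<integral>\<^sup>+x. ennreal (\<bar>v (s i) x - v (s j) x\<bar> * ?\<sigma> x) \<partial>lborel) \<le> ennreal e) sequentially"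
          using le[OF that] by (auto simp: eventually_sequentially)
      qed simp
      finally show ?thesis .
    qed
    then show ?thesis by blast
  qed
  show ?thesis by (rule that[OF s Vm ae V4 L1])
qed

section \<open>The space of square-integrable fields\<close>

text \<open>The expansion of the squared norm along a line is kept as a separate fact, since the
  variational argument for gradients rests on it. Cauchy-Schwarz follows from its nonnegativity by
  evaluating at the minimizing t.\<close>

lemma
  fixes f k :: "'a \<Rightarrow> 'b::euclidean_space"
  assumes [measurable]: "f \<in> borel_measurable M" "k \<in> borel_measurable M"
    and f: "integrable M (\<lambda>x. (norm (f x))\<^sup>2)" and k: "integrable M (\<lambda>x. (norm (k x))\<^sup>2)"
  shows L2_inner_integrable: "integrable M (\<lambda>x. f x \<bullet> k x)"
    and L2_norm_expand: "(\<integral>x. (norm (f x + t *\<^sub>R k x))\<^sup>2 \<partial>M) =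
       (\<integral>x. (norm (f x))\<^sup>2 \<partial>M) + 2 * t * (\<integral>x. f x \<bullet> k x \<partial>M) + t\<^sup>2 * (\<integral>x. (norm (k x))\<^sup>2 \<partial>M)"
    and L2_Cauchy_Schwarz: "\<bar>\<integral>x. f x \<bullet> k x \<partial>M\<bar> \<le> sqrt (\<integral>x. (norm (f x))\<^sup>2 \<partial>M) * sqrt (\<integral>x. (norm (k x))\<^sup>2 \<partial>M)"
proof -
  show i: "integrable M (\<lambda>x. f x \<bullet> k x)"
  proof (rule integrable_norm_le)
    show "integrable M (\<lambda>x. (norm (f x))\<^sup>2 + (norm (k x))\<^sup>2)" using f k by simp
    show "norm (f x \<bullet> k x) \<le> (norm (f x))\<^sup>2 + (norm (k x))\<^sup>2" for x
    proof -
      have "norm (f x \<bullet> k x) \<le> norm (f x) * norm (k x)" using Cauchy_Schwarz_ineq2 by auto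
      moreover have "2 * norm (f x) * norm (k x) \<le> (norm (f x))\<^sup>2 + (norm (k x))\<^sup>2" by (rule sum_squares_bound)
      moreover have "0 \<le> norm (f x) * norm (k x)" by simp
      ultimately show ?thesis by linarith
    qed
  qed measurable
  have expand: "(\<integral>x. (norm (f x + t *\<^sub>R k x))\<^sup>2 \<partial>M) =
       (\<integral>x. (norm (f x))\<^sup>2 \<partial>M) + 2 * t * (\<integral>x. f x \<bullet> k x \<partial>M) + t\<^sup>2 * (\<integral>x. (norm (k x))\<^sup>2 \<partial>M)" for t
  proof -
    have "(norm (f x + t *\<^sub>R k x))\<^sup>2 = (norm (f x))\<^sup>2 + 2 * t * (f x \<bullet> k x) + t\<^sup>2 * (norm (k x))\<^sup>2" for x
      unfolding power2_norm_eq_inner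
      by (simp add: inner_add_left inner_add_right inner_commute[of "k x" "f x"] power2_eq_square[of t] algebra_simps)
    then show ?thesis using f k i by simp
  qed
  then show "(\<integral>x. (norm (f x + t *\<^sub>R k x))\<^sup>2 \<partial>M) =
       (\<integral>x. (norm (f x))\<^sup>2 \<partial>M) + 2 * t * (\<integral>x. f x \<bullet> k x \<partial>M) + t\<^sup>2 * (\<integral>x. (norm (k x))\<^sup>2 \<partial>M)" .
  let ?E = "\<integral>x. (norm (f x))\<^sup>2 \<partial>M" and ?K = "\<integral>x. (norm (k x))\<^sup>2 \<partial>M" and ?I = "\<integral>x. f x \<bullet> k x \<partial>M"
  have E0: "0 \<le> ?E" and K0: "0 \<le> ?K" by simp_all
  have q: "0 \<le> ?E + 2 * t * ?I + t\<^sup>2 * ?K" for t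
    unfolding expand[symmetric] by simp
  have "?I\<^sup>2 \<le> ?E * ?K"
  proof (cases "?K = 0")
    case True
    have "?I = 0"
    proof (rule ccontr)
      assume I: "?I \<noteq> 0"
      \<comment> \<open>With no quadratic term the expression is affine in t; this t gives it the
        negative value -?E - 2.\<close>
      have "0 \<le> ?E + 2 * (- (?E + 1) / ?I) * ?I" using q[of "- (?E + 1) / ?I"] True by simp
      also have "\<dots> = - ?E - 2" using I by (simp add: field_simps)
      finally show False using E0 by linarith
    qed
    then show ?thesis using True by simp
  next
    case False
    then have K: "0 < ?K" using K0 by linarith
    have "0 \<le> ?E + 2 * (- ?I / ?K) * ?I + (- ?I / ?K)\<^sup>2 * ?K" by (rule q)
    also have "\<dots> = ?E - ?I\<^sup>2 / ?K" using K by (simp add: field_simps power2_eq_square)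
    finally show ?thesis using K by (simp add: field_simps)
  qed
  then have "sqrt (?I\<^sup>2) \<le> sqrt (?E * ?K)" by (rule real_sqrt_le_mono)
  then show "\<bar>?I\<bar> \<le> sqrt ?E * sqrt ?K" by (simp only: real_sqrt_abs real_sqrt_mult)
qed

text \<open>Riesz-Fischer for vector fields. A positive weight turns the L^2 Cauchy property into an
  L^1 one, which yields an almost everywhere convergent subsequence; Fatou along it then gives L^2
  convergence of the whole sequence.\<close>

lemma L2_complete:
  fixes p :: "nat \<Rightarrow> 'a::euclidean_space \<Rightarrow> 'b::euclidean_space"
  assumes p[measurable]: "\<And>n. p n \<in> borel_measurable lebesgue"
    and p2: "\<And>n. integrable lebesgue (\<lambda>x. (norm (p n x))\<^sup>2)"
    and cauchy: "\<And>e. 0 < e \<Longrightarrow> \<exists>N. \<forall>i\<ge>N. \<forall>j\<ge>N. (energy (\<lambda>x. p i x - p j x)) \<le> e"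
  obtains G where "G \<in> borel_measurable lebesgue" "integrable lebesgue (\<lambda>x. (norm (G x))\<^sup>2)"
    "(\<lambda>n. energy (\<lambda>x. p n x - G x)) \<longlonglongrightarrow> 0"
proof -
  obtain \<rho> :: "'a \<Rightarrow> real" where \<rho>b: "\<rho> \<in> borel_measurable borel" and \<rho>: "\<And>x. 0 < \<rho> x" "\<And>x. \<rho> x \<le> 1" "integrable lborel \<rho>"
    using lborel_positive_weight by metis
  have [measurable]: "\<rho> \<in> borel_measurable lebesgue" using \<rho>b by (intro measurable_completion) simp
  have \<rho>i: "integrable lebesgue \<rho>" using \<rho>(3) \<rho>b by (simp add: integrable_lebesgue_iff)
  have \<rho>0: "0 \<le> \<rho> x" for x using \<rho>(1) less_imp_le by blast
  have pd: "integrable lebesgue (\<lambda>x. (norm (p i x - p j x))\<^sup>2)" for i j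
    using integrable_norm_lincomb_sq[OF p[of i] p[of j] p2 p2, of 1 "-1"] by simp
  have i1: "integrable lebesgue (\<lambda>x. \<rho> x *\<^sub>R p n x)" for n
  proof (rule integrable_norm_le)
    show "integrable lebesgue (\<lambda>x. \<rho> x + (norm (p n x))\<^sup>2)" using \<rho>i p2 by simp
    show "norm (\<rho> x *\<^sub>R p n x) \<le> \<rho> x + (norm (p n x))\<^sup>2" for x
    proof -
      have "2 * norm (p n x) * 1 \<le> (norm (p n x))\<^sup>2 + 1\<^sup>2" by (rule sum_squares_bound)
      then have "norm (p n x) \<le> 1 + (norm (p n x))\<^sup>2" 
        using norm_ge_zero[of "p n x"] unfolding mult_1_right one_power2 by linarith
      then have "\<rho> x * norm (p n x) \<le> \<rho> x * (1 + (norm (p n x))\<^sup>2)" using \<rho>0 by (intro mult_left_mono) auto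
      also have "\<dots> \<le> \<rho> x + (norm (p n x))\<^sup>2"
        using mult_right_mono[OF \<rho>(2)[of x], of "(norm (p n x))\<^sup>2"] by (simp add: algebra_simps)
      finally show ?thesis using \<rho>0 by simp
    qed
  qed measurable
  obtain q where q: "strict_mono q" "AE x in lebesgue. Cauchy (\<lambda>i. \<rho> x *\<^sub>R p (q i) x)"
  proof (rule cauchy_L1_AE_cauchy_subseq[of lebesgue "\<lambda>n x. \<rho> x *\<^sub>R p n x", OF i1])
    fix e :: real assume e: "0 < e"
    \<comment> \<open>Large enough to bring the weight term below e / 2; energies at most e / (2 t)
      then contribute exactly the other half.\<close>
    define t where "t = 2 * (1 + (\<integral>x. \<rho> x \<partial>lebesgue)) / e"
    have r0: "0 \<le> (\<integral>x. \<rho> x \<partial>lebesgue)" using \<rho>0 by simp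
    have t: "0 < t" using e r0 by (simp add: t_def)
    have rt: "(\<integral>x. \<rho> x \<partial>lebesgue) / t < e / 2" using e r0 by (simp add: t_def field_simps)
    obtain N where N: "\<And>i j. i \<ge> N \<Longrightarrow> j \<ge> N \<Longrightarrow> (energy (\<lambda>x. p i x - p j x)) \<le> e / (2 * t)"
      using cauchy[of "e / (2 * t)"] e t by auto
    have "(\<integral>x. norm (\<rho> x *\<^sub>R p i x - \<rho> x *\<^sub>R p j x) \<partial>lebesgue) < e" if "i \<ge> N" "j \<ge> N" for i j
    proof -
      have "(\<integral>\<^sup>+x. ennreal ((norm (p i x - p j x))\<^sup>2) \<partial>lebesgue) \<le> ennreal (e / (2 * t))"
        using N[OF that] pd[of i j] by (subst nn_integral_eq_integral) (auto intro!: ennreal_leI)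
      then have "(\<integral>x. \<bar>norm (p i x - p j x)\<bar> * \<rho> x \<partial>lebesgue) \<le> t * (e / (2 * t)) + (\<integral>x. \<rho> x \<partial>lebesgue) / t"
        using \<rho>0 \<rho>(2) \<rho>i e t by (intro nn_integral_weight_le) auto
      also have "t * (e / (2 * t)) = e / 2" using t by simp
      also have "e / 2 + (\<integral>x. \<rho> x \<partial>lebesgue) / t < e" using rt by linarith
      finally show ?thesis using \<rho>0 by (simp add: mult.commute flip: scaleR_diff_right)
    qed
    then show "\<exists>N. \<forall>i\<ge>N. \<forall>j\<ge>N. LINT x|lebesgue. norm (\<rho> x *\<^sub>R p i x - \<rho> x *\<^sub>R p j x) < e" by blast
  qed
  define G where "G x = lim (\<lambda>i. p (q i) x)" for x
  have Gm[measurable]: "G \<in> borel_measurable lebesgue" unfolding G_def by measurable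
  have ae: "AE x in lebesgue. (\<lambda>i. p (q i) x) \<longlonglongrightarrow> G x"
    using q(2)
  proof eventually_elim
    case (elim x)
    then have "convergent (\<lambda>i. \<rho> x *\<^sub>R p (q i) x)" by (simp add: Cauchy_convergent)
    then obtain l where "(\<lambda>i. \<rho> x *\<^sub>R p (q i) x) \<longlonglongrightarrow> l" by (auto simp: convergent_def)
    then have "(\<lambda>i. (1 / \<rho> x) *\<^sub>R (\<rho> x *\<^sub>R p (q i) x)) \<longlonglongrightarrow> (1 / \<rho> x) *\<^sub>R l"
      by (intro tendsto_scaleR tendsto_const)
    then have "convergent (\<lambda>i. (1 / \<rho> x) *\<^sub>R (\<rho> x *\<^sub>R p (q i) x))" by (rule convergentI)
    then have "convergent (\<lambda>i. p (q i) x)" using \<rho>(1)[of x] by simp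
    then show ?case by (simp add: G_def convergent_LIMSEQ_iff)
  qed
  have fatou: "\<exists>N. \<forall>i\<ge>N. (\<integral>\<^sup>+x. ennreal ((norm (p i x - G x))\<^sup>2) \<partial>lebesgue) \<le> ennreal e" if e: "0 < e" for e
  proof -
    obtain N where N: "\<And>i j. i \<ge> N \<Longrightarrow> j \<ge> N \<Longrightarrow> (energy (\<lambda>x. p i x - p j x)) \<le> e"
      using cauchy[OF e] by blast
    have "(\<integral>\<^sup>+x. ennreal ((norm (p i x - G x))\<^sup>2) \<partial>lebesgue) \<le> ennreal e" if i: "i \<ge> N" for i
    proof -
      have "(\<integral>\<^sup>+x. ennreal ((norm (p i x - G x))\<^sup>2) \<partial>lebesgue) = (\<integral>\<^sup>+x. liminf (\<lambda>j. ennreal ((norm (p i x - p (q j) x))\<^sup>2)) \<partial>lebesgue)"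
      proof (rule nn_integral_cong_AE)
        show "AE x in lebesgue. ennreal ((norm (p i x - G x))\<^sup>2) = liminf (\<lambda>j. ennreal ((norm (p i x - p (q j) x))\<^sup>2))"
          using ae by eventually_elim (intro lim_imp_Liminf[symmetric] tendsto_intros; simp)
      qed
      also have "\<dots> \<le> liminf (\<lambda>j. \<integral>\<^sup>+x. ennreal ((norm (p i x - p (q j) x))\<^sup>2) \<partial>lebesgue)"
        by (rule nn_integral_liminf) measurable
      also have "\<dots> \<le> ennreal e"
      proof (rule Liminf_le)
        have "(\<integral>\<^sup>+x. ennreal ((norm (p i x - p (q j) x))\<^sup>2) \<partial>lebesgue) \<le> ennreal e" if "j \<ge> N" for j
          using N[OF i order_trans[OF that seq_suble[OF q(1)]]] pd[of i "q j"]
          by (subst nn_integral_eq_integral) (auto intro!: ennreal_leI)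
        then show "eventually (\<lambda>j. (\<integral>\<^sup>+x. ennreal ((norm (p i x - p (q j) x))\<^sup>2) \<partial>lebesgue) \<le> ennreal e) sequentially"
          by (auto simp: eventually_sequentially)
      qed simp
      finally show ?thesis .
    qed
    then show ?thesis by blast
  qed
  have Gi: "integrable lebesgue (\<lambda>x. (norm (G x))\<^sup>2)"
  proof -
    obtain N where N: "(\<integral>\<^sup>+x. ennreal ((norm (p N x - G x))\<^sup>2) \<partial>lebesgue) \<le> ennreal 1"
      using fatou[of 1] by auto
    have "integrable lebesgue (\<lambda>x. (norm (p N x - G x))\<^sup>2)"
      using N by (intro integrableI_bounded) (auto intro: le_less_trans)
    then have "integrable lebesgue (\<lambda>x. (norm (1 *\<^sub>R p N x + (-1) *\<^sub>R (p N x - G x)))\<^sup>2)"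
      by (intro integrable_norm_lincomb_sq p2) auto
    then show ?thesis by simp
  qed
  have pG: "integrable lebesgue (\<lambda>x. (norm (p n x - G x))\<^sup>2)" for n
    using integrable_norm_lincomb_sq[OF p[of n] Gm p2 Gi, of 1 "-1"] by simp
  have "(\<lambda>n. energy (\<lambda>x. p n x - G x)) \<longlonglongrightarrow> 0"
  proof (rule LIMSEQ_I)
    fix e :: real assume e: "0 < e"
    then obtain N where N: "\<And>i. i \<ge> N \<Longrightarrow> (\<integral>\<^sup>+x. ennreal ((norm (p i x - G x))\<^sup>2) \<partial>lebesgue) \<le> ennreal (e / 2)"
      using fatou[of "e/2"] by auto
    have "norm ((energy (\<lambda>x. p i x - G x)) - 0) < e" if "i \<ge> N" for i
      using N[OF that] e by (simp add: nn_integral_eq_integral[OF pG] ennreal_le_iff)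
    then show "\<exists>N. \<forall>i\<ge>N. norm ((energy (\<lambda>x. p i x - G x)) - 0) < e" by blast
  qed
  then show ?thesis using that[OF Gm Gi] by blast
qed

lemma integrable_pow4_test_fun:
  assumes v: "v \<in> borel_measurable lebesgue" and v4: "integrable lebesgue (\<lambda>x. (v x)^4)" and \<phi>: "test_fun \<phi>"
  shows "integrable lebesgue (\<lambda>x. v x * \<phi> x)"
proof -
  obtain C N where C: "0 < C" "\<And>x. \<bar>\<phi> x\<bar> \<le> C * indicator (cball 0 N) x"
    using test_fun_bound[OF \<phi>] by metis
  have fin: "integrable lebesgue (indicator (cball 0 N) :: R4 \<Rightarrow> real)"
    using emeasure_bounded_finite[OF bounded_cball[of "0::R4" N]] by (intro integrable_real_indicator) auto
  show ?thesis
  proof (rule integrable_norm_le)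
    show "integrable lebesgue (\<lambda>x. C * indicator (cball 0 N) x + C * (v x)^4)" using fin v4 by simp
    show "(\<lambda>x. v x * \<phi> x) \<in> borel_measurable lebesgue"
      by (intro borel_measurable_times v test_fun_borel_lebesgue[OF \<phi>])
    show "norm (v x * \<phi> x) \<le> C * indicator (cball 0 N) x + C * (v x)^4" for x
    proof -
      have "norm (v x * \<phi> x) \<le> (1 + (v x)^4) * (C * indicator (cball 0 N) x)"
        unfolding real_norm_def abs_mult by (intro mult_mono abs_le_one_plus_pow4 C) auto
      also have "\<dots> \<le> C * indicator (cball 0 N) x + C * (v x)^4"
        using C(1) by (auto simp: indicator_def algebra_simps)
      finally show ?thesis .
    qed
  qed
qed

section \<open>Lower semicontinuity of the Dirichlet energy\<close>

text \<open>The energy-minimal elements among all functions close to \<open>v\<close> form a Cauchy sequence, whose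
  limit is \<open>grad v\<close>; minimality also gives the one-sided Pythagoras inequality, which replaces weak
  convergence of the gradients.\<close>

lemma L2_grad_lower_semicontinuity:
  fixes u :: "nat \<Rightarrow> R4 \<Rightarrow> real"
  assumes u: "\<And>m. u m \<in> borel_measurable lebesgue" and gu: "\<And>m. L2_grad (u m) (g m)"
    and gM: "\<And>m. (energy (g m)) \<le> M"
    and v[measurable]: "v \<in> borel_measurable lebesgue" and v4: "integrable lebesgue (\<lambda>x. (v x)^4)"
    and conv: "\<And>N e. 0 < e \<Longrightarrow> \<exists>m0. \<forall>m\<ge>m0. (\<integral>\<^sup>+x. ennreal (\<bar>u m x - v x\<bar> * indicator (cball 0 N) x) \<partial>lebesgue) \<le> ennreal e"
  obtains G where "L2_grad v G"
    "\<And>e. 0 < e \<Longrightarrow> \<exists>m0. \<forall>m\<ge>m0. (energy (\<lambda>x. g m x - G x)) + (energy G)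
        \<le> (energy (g m)) + e"
proof -

  \<comment> \<open>Convex sets of gradients of functions near v\<close>
  define E :: "(R4 \<Rightarrow> R4) \<Rightarrow> real" where "E k = energy k" for k
  \<comment> \<open>A single index controls both the radius of the ball and the tolerance, so the
    sets \<open>C n\<close> decrease in n while together they force local L^1 convergence to
    \<open>v\<close>.\<close>
  define close where "close n w \<longleftrightarrow> w \<in> borel_measurable lebesgue \<and>
     (\<integral>\<^sup>+x. ennreal (\<bar>w x - v x\<bar> * indicator (cball 0 (real n)) x) \<partial>lebesgue) \<le> ennreal (1 / real (Suc n))" for n w
  define C where "C n = {k. \<exists>w. close n w \<and> L2_grad w k}" for n
  have E0: "0 \<le> E k" for k by (simp add: E_def)
  have M0: "0 \<le> M" by (rule order_trans[OF _ gM[of 0]]) simp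
  have Cm: "k \<in> borel_measurable lebesgue" "integrable lebesgue (\<lambda>x. (norm (k x))\<^sup>2)" if "k \<in> C n" for k n
    using that by (auto simp: C_def L2_grad_def)
  have C_in: "\<exists>m0. \<forall>m\<ge>m0. g m \<in> C n" for n
  proof -
    have "0 < 1 / real (Suc n)" by simp
    from conv[OF this, of "real n"] show ?thesis
      using u gu unfolding C_def close_def by blast
  qed
  have ball_meas[measurable]: "cball 0 r \<in> sets lebesgue" for r :: real and x :: R4
    by (rule lmeasurable_cball[THEN fmeasurableD])
  have C_convex: "(\<lambda>x. (1 - t) *\<^sub>R k x + t *\<^sub>R l x) \<in> C n" if k: "k \<in> C n" and l: "l \<in> C n" and t: "0 \<le> t" "t \<le> 1" for k l t n
  proof -
    let ?i = "indicator (cball 0 (real n)) :: R4 \<Rightarrow> real" and ?c = "1 / real (Suc n)"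
    obtain w where w: "close n w" "L2_grad w k" using k by (auto simp: C_def)
    obtain w' where w': "close n w'" "L2_grad w' l" using l by (auto simp: C_def)
    have [measurable]: "w \<in> borel_measurable lebesgue" "w' \<in> borel_measurable lebesgue"
      using w w' by (auto simp: close_def)
    have "(\<integral>\<^sup>+x. ennreal (\<bar>((1 - t) * w x + t * w' x) - v x\<bar> * ?i x) \<partial>lebesgue)
      \<le> (\<integral>\<^sup>+x. ennreal (1 - t) * ennreal (\<bar>w x - v x\<bar> * ?i x) + ennreal t * ennreal (\<bar>w' x - v x\<bar> * ?i x) \<partial>lebesgue)"
    proof (rule nn_integral_mono)
      fix x
      have "((1 - t) * w x + t * w' x) - v x = (1 - t) * (w x - v x) + t * (w' x - v x)" by (simp add: algebra_simps)
      then have "\<bar>((1 - t) * w x + t * w' x) - v x\<bar> \<le> (1 - t) * \<bar>w x - v x\<bar> + t * \<bar>w' x - v x\<bar>"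
        using t abs_triangle_ineq[of "(1 - t) * (w x - v x)" "t * (w' x - v x)"] by (simp add: abs_mult)
      from mult_right_mono[OF this, of "?i x"]
      have "ennreal (\<bar>((1 - t) * w x + t * w' x) - v x\<bar> * ?i x)
        \<le> ennreal ((1 - t) * (\<bar>w x - v x\<bar> * ?i x) + t * (\<bar>w' x - v x\<bar> * ?i x))"
        by (intro ennreal_leI) (simp add: algebra_simps)
      also have "\<dots> = ennreal (1 - t) * ennreal (\<bar>w x - v x\<bar> * ?i x) + ennreal t * ennreal (\<bar>w' x - v x\<bar> * ?i x)"
        using t by (simp add: ennreal_plus ennreal_mult)
      finally show "ennreal (\<bar>((1 - t) * w x + t * w' x) - v x\<bar> * ?i x)
        \<le> ennreal (1 - t) * ennreal (\<bar>w x - v x\<bar> * ?i x) + ennreal t * ennreal (\<bar>w' x - v x\<bar> * ?i x)" .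
    qed
    also have "\<dots> = ennreal (1 - t) * (\<integral>\<^sup>+x. ennreal (\<bar>w x - v x\<bar> * ?i x) \<partial>lebesgue)
       + ennreal t * (\<integral>\<^sup>+x. ennreal (\<bar>w' x - v x\<bar> * ?i x) \<partial>lebesgue)"
      by (subst nn_integral_add) (auto simp: nn_integral_cmult)
    also have "\<dots> \<le> ennreal (1 - t) * ennreal ?c + ennreal t * ennreal ?c"
      using w w' unfolding close_def by (intro add_mono mult_left_mono) auto
    also have "\<dots> = (ennreal (1 - t) + ennreal t) * ennreal ?c" by (rule distrib_right[symmetric])
    also have "\<dots> = ennreal ?c" using t by (simp flip: ennreal_plus)
    finally have "close n (\<lambda>x. (1 - t) * w x + t * w' x)"
      unfolding close_def by auto
    with L2_grad_lincomb[OF w(2) w'(2), of "1 - t" t] show ?thesis unfolding C_def by blast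
  qed
  have C_anti: "k \<in> C n" if kC: "k \<in> C n'" and nn: "n \<le> n'" for k n n'
  proof -
    obtain w where w: "close n' w" "L2_grad w k" using kC by (auto simp: C_def)
    have "(\<integral>\<^sup>+x. ennreal (\<bar>w x - v x\<bar> * indicator (cball 0 (real n)) x) \<partial>lebesgue)
      \<le> (\<integral>\<^sup>+x. ennreal (\<bar>w x - v x\<bar> * indicator (cball 0 (real n')) x) \<partial>lebesgue)"
      using nn by (intro nn_integral_mono ennreal_leI mult_left_mono indicator_leI) auto
    also have "\<dots> \<le> ennreal (1 / real (Suc n'))" using w by (simp add: close_def)
    also have "\<dots> \<le> ennreal (1 / real (Suc n))" using nn by (intro ennreal_leI) (simp add: frac_le)
    finally have "close n w" using w by (simp add: close_def)
    then show ?thesis using w by (auto simp: C_def)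
  qed

  \<comment> \<open>Almost minimal gradients and their limit\<close>
  define d where "d n = Inf (E ` C n)" for n
  have bdd: "bdd_below (E ` C n)" for n using E0 by (auto intro!: bdd_belowI[of _ 0])
  have d_le: "d n \<le> E k" if "k \<in> C n" for n k
    unfolding d_def using that bdd by (intro cInf_lower) auto
  have C_ne: "C n \<noteq> {}" for n using C_in[of n] by auto
  have d_M: "d n \<le> M" for n
    using C_in[of n] d_le gM unfolding E_def by (meson order_refl order_trans)
  have d_mono: "incseq d"
    unfolding incseq_def d_def using C_anti C_ne bdd by (auto intro!: cInf_superset_mono)
  \<comment> \<open>The excess is the square of t = 1 / (n + 1). A variation of step t has
    first-order term 2 t times an inner product, so after division by t the excess contributes only
    t.\<close>
  have "\<exists>k. k \<in> C n \<and> E k < d n + (1 / real (Suc n))\<^sup>2" for n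
  proof -
    have "Inf (E ` C n) < d n + (1 / real (Suc n))\<^sup>2" by (simp add: d_def)
    then show ?thesis using cInf_lessD[of "E ` C n"] C_ne[of n] by blast
  qed
  then obtain p where p: "\<And>n. p n \<in> C n" and pE: "\<And>n. E (p n) < d n + (1 / real (Suc n))\<^sup>2" by metis
  note pm[measurable] = Cm(1)[OF p] and pi = Cm(2)[OF p]
  obtain D where D: "d \<longlonglongrightarrow> D" "\<And>n. d n \<le> D"
    using incseq_convergent[OF d_mono] d_M by (metis)
  have lin: "integrable lebesgue (\<lambda>x. (norm (a *\<^sub>R k x + b *\<^sub>R l x))\<^sup>2)" "(\<lambda>x. a *\<^sub>R k x + b *\<^sub>R l x) \<in> borel_measurable lebesgue"
    if "k \<in> borel_measurable lebesgue" "l \<in> borel_measurable lebesgue" "integrable lebesgue (\<lambda>x. (norm (k x))\<^sup>2)"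
      "integrable lebesgue (\<lambda>x. (norm (l x))\<^sup>2)" for a b and k l :: "R4 \<Rightarrow> R4"
    using that by (auto intro!: integrable_norm_lincomb_sq borel_measurable_add borel_measurable_scaleR)
  have dif: "(\<lambda>x. k x - l x) \<in> borel_measurable lebesgue" "integrable lebesgue (\<lambda>x. (norm (k x - l x))\<^sup>2)"
    if "k \<in> borel_measurable lebesgue" "l \<in> borel_measurable lebesgue" "integrable lebesgue (\<lambda>x. (norm (k x))\<^sup>2)"
      "integrable lebesgue (\<lambda>x. (norm (l x))\<^sup>2)" for k l :: "R4 \<Rightarrow> R4"
    using lin[OF that, of 1 "-1"] by simp_all
  define ip where "ip k l = (\<integral>x. k x \<bullet> l x \<partial>lebesgue)" for k l :: "R4 \<Rightarrow> R4"
  have ex: "E (\<lambda>x. (1 - t) *\<^sub>R k x + t *\<^sub>R l x) = E k + 2 * t * ip k (\<lambda>x. l x - k x) + t\<^sup>2 * E (\<lambda>x. l x - k x)"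
    if h: "k \<in> borel_measurable lebesgue" "l \<in> borel_measurable lebesgue" "integrable lebesgue (\<lambda>x. (norm (k x))\<^sup>2)"
      "integrable lebesgue (\<lambda>x. (norm (l x))\<^sup>2)" for k l t
  proof -
    have eq: "(1 - t) *\<^sub>R k x + t *\<^sub>R l x = k x + t *\<^sub>R (l x - k x)" for x
      by (simp add: algebra_simps)
    show ?thesis
      unfolding E_def ip_def eq by (rule L2_norm_expand[OF h(1) dif(1)[OF h(2,1,4,3)] h(3) dif(2)[OF h(2,1,4,3)]])
  qed
  \<comment> \<open>The parallelogram law, in the form that measures distance by the energy deficit
    of the midpoint.\<close>
  have par: "E (\<lambda>x. l x - k x) \<le> 2 * E k + 2 * E l"
    "E (\<lambda>x. l x - k x) = 2 * E k + 2 * E l - 4 * E (\<lambda>x. (1 - 1/2) *\<^sub>R k x + (1/2) *\<^sub>R l x)"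
    if h: "k \<in> borel_measurable lebesgue" "l \<in> borel_measurable lebesgue" "integrable lebesgue (\<lambda>x. (norm (k x))\<^sup>2)"
      "integrable lebesgue (\<lambda>x. (norm (l x))\<^sup>2)" for k l
  proof -
    have "E l = E k + 2 * ip k (\<lambda>x. l x - k x) + E (\<lambda>x. l x - k x)"
      using ex[OF h, of 1] by simp
    moreover have "E (\<lambda>x. (1 - 1/2) *\<^sub>R k x + (1/2) *\<^sub>R l x) = E k + ip k (\<lambda>x. l x - k x) + E (\<lambda>x. l x - k x) / 4"
      using ex[OF h, of "1/2"] by (simp add: power2_eq_square)
    ultimately show "E (\<lambda>x. l x - k x) = 2 * E k + 2 * E l - 4 * E (\<lambda>x. (1 - 1/2) *\<^sub>R k x + (1/2) *\<^sub>R l x)"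
      by linarith
    then show "E (\<lambda>x. l x - k x) \<le> 2 * E k + 2 * E l" using E0[of "\<lambda>x. (1 - 1/2) *\<^sub>R k x + (1/2) *\<^sub>R l x"] by linarith
  qed
  obtain G where G[measurable]: "G \<in> borel_measurable lebesgue" and Gi: "integrable lebesgue (\<lambda>x. (norm (G x))\<^sup>2)"
    and pG: "(\<lambda>n. E (\<lambda>x. p n x - G x)) \<longlonglongrightarrow> 0"
  proof (rule L2_complete[of p, OF pm pi])
    fix e :: real assume e: "0 < e"
    have "(\<lambda>n. 4 * (D - d n) + 4 * (1 / real (Suc n))) \<longlonglongrightarrow> 4 * (D - D) + 4 * 0"
      by (intro tendsto_intros D LIMSEQ_Suc[OF lim_1_over_n])
    then have "eventually (\<lambda>n. 4 * (D - d n) + 4 * (1 / real (Suc n)) < e) sequentially"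
      using e by (intro order_tendstoD(2)) auto
    then obtain N where N: "4 * (D - d N) + 4 * (1 / real (Suc N)) < e" by (auto simp: eventually_sequentially)
    have "E (\<lambda>x. p i x - p j x) \<le> e" if ij: "i \<ge> N" "j \<ge> N" for i j
    proof -
      \<comment> \<open>The midpoint of two almost minimal fields stays in the convex set
        \<open>C N\<close>, so its energy is at least d N. The parallelogram law then bounds their
        distance by 4 (D - d N) plus the tolerances.\<close>
      have "d N \<le> E (\<lambda>x. (1 - 1/2) *\<^sub>R p j x + (1/2) *\<^sub>R p i x)"
        by (intro d_le C_convex C_anti[OF p] ij) auto
      moreover have "E (p n) \<le> D + 1 / real (Suc N)" if "n \<ge> N" for n
      proof -
        have "(1 / real (Suc n))\<^sup>2 \<le> (1 / real (Suc n)) * 1"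
          unfolding power2_eq_square by (intro mult_left_mono) auto
        also have "\<dots> \<le> 1 / real (Suc N)" using that by (simp add: frac_le)
        finally show ?thesis using pE[of n] D(2)[of n] by linarith
      qed
      ultimately show ?thesis
        using par(2)[OF pm pm pi pi, of i j] N ij by (smt (verit))
    qed
    then show "\<exists>N. \<forall>i\<ge>N. \<forall>j\<ge>N. (energy (\<lambda>x. p i x - p j x)) \<le> e"
      unfolding E_def by blast
  qed (auto simp: E_def intro: that)

  \<comment> \<open>The limit field is the weak gradient of v\<close>
  have "weak_grad v G"
    unfolding weak_grad_def
  proof (intro allI impI)
    fix \<phi> i assume \<phi>: "test_fun \<phi>"
    obtain w where w: "\<And>n. close n (w n)" "\<And>n. L2_grad (w n) (p n)"
      using p unfolding C_def by (simp only: mem_Collect_eq) metis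
    have wm[measurable]: "w n \<in> borel_measurable lebesgue" for n using w(1) by (simp add: close_def)
    let ?d = "pderiv4 i \<phi>"
    have dm[measurable]: "?d \<in> borel_measurable lebesgue" and \<phi>m[measurable]: "\<phi> \<in> borel_measurable lebesgue"
      using \<phi> by (auto intro: test_fun_borel_lebesgue test_fun_pderiv4)
    have iv: "integrable lebesgue (\<lambda>x. v x * ?d x)"
      by (rule integrable_pow4_test_fun[OF v v4 test_fun_pderiv4[OF \<phi>]])
    have "weak_grad (w n) (p n)" for n using w(2) by (simp add: L2_grad_def)
    note wp = weak_gradD[OF this \<phi>, of _ i]
    have iw: "integrable lebesgue (\<lambda>x. w n x * ?d x)" and ip: "integrable lebesgue (\<lambda>x. p n x $ i * \<phi> x)"
      and ew: "(\<integral>x. w n x * ?d x \<partial>lebesgue) = - (\<integral>x. p n x $ i * \<phi> x \<partial>lebesgue)" for n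
      by (rule wp)+
    obtain B N where B: "0 < B" "\<And>x. \<bar>?d x\<bar> \<le> B * indicator (cball 0 N) x"
      using test_fun_bound[OF test_fun_pderiv4[OF \<phi>]] by metis
    have "(\<lambda>n. (\<integral>x. w n x * ?d x \<partial>lebesgue) - (\<integral>x. v x * ?d x \<partial>lebesgue)) \<longlonglongrightarrow> 0"
    proof (rule Lim_null_comparison)
      show "(\<lambda>n. B * (1 / real (Suc n))) \<longlonglongrightarrow> 0"
        using tendsto_mult_right_zero[OF LIMSEQ_Suc[OF lim_1_over_n]] by blast
      \<comment> \<open>Once the ball of radius n contains the support of the derivative of the test
        function, closeness of \<open>w n\<close> to \<open>v\<close> bounds the difference.\<close>
      have "norm ((\<integral>x. w n x * ?d x \<partial>lebesgue) - (\<integral>x. v x * ?d x \<partial>lebesgue)) \<le> B * (1 / real (Suc n))"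
        if n: "real n \<ge> N" for n
      proof -
        have "ennreal (norm ((\<integral>x. w n x * ?d x \<partial>lebesgue) - (\<integral>x. v x * ?d x \<partial>lebesgue)))
          = ennreal (norm (\<integral>x. w n x * ?d x - v x * ?d x \<partial>lebesgue))"
          using iw iv by simp
        also have "\<dots> \<le> (\<integral>\<^sup>+x. ennreal (norm (w n x * ?d x - v x * ?d x)) \<partial>lebesgue)"
          by (rule integral_norm_bound_ennreal) (use iw iv in simp)
        also have "\<dots> \<le> (\<integral>\<^sup>+x. ennreal B * ennreal (\<bar>w n x - v x\<bar> * indicator (cball 0 (real n)) x) \<partial>lebesgue)"
        proof (rule nn_integral_mono)
          fix x
          have "\<bar>?d x\<bar> \<le> B * indicator (cball 0 (real n)) x"
            by (rule order_trans[OF B(2)]) (use n B(1) in \<open>intro mult_left_mono indicator_leI, auto\<close>)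
          then have "\<bar>w n x - v x\<bar> * \<bar>?d x\<bar> \<le> \<bar>w n x - v x\<bar> * (B * indicator (cball 0 (real n)) x)"
            by (rule mult_left_mono) simp
          then show "ennreal (norm (w n x * ?d x - v x * ?d x)) \<le> ennreal B * ennreal (\<bar>w n x - v x\<bar> * indicator (cball 0 (real n)) x)"
            using B(1) by (subst ennreal_mult[symmetric]) (auto intro!: ennreal_leI simp: abs_mult mult_ac simp flip: left_diff_distrib)
        qed
        also have "\<dots> = ennreal B * (\<integral>\<^sup>+x. ennreal (\<bar>w n x - v x\<bar> * indicator (cball 0 (real n)) x) \<partial>lebesgue)"
          by (rule nn_integral_cmult) measurable
        also have "\<dots> \<le> ennreal B * ennreal (1 / real (Suc n))"
          using w(1)[of n] by (intro mult_left_mono) (auto simp: close_def)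
        also have "\<dots> = ennreal (B * (1 / real (Suc n)))" using B(1) by (simp flip: ennreal_mult)
        finally show ?thesis using B(1) by (subst (asm) ennreal_le_iff) auto
      qed
      then show "\<forall>\<^sub>F n in sequentially. norm ((\<integral>x. w n x * ?d x \<partial>lebesgue) - (\<integral>x. v x * ?d x \<partial>lebesgue)) \<le> B * (1 / real (Suc n))"
        using eventually_ge_at_top[of "nat \<lceil>N\<rceil>"] by (auto elim!: eventually_mono)
    qed
    then have lim1: "(\<lambda>n. \<integral>x. w n x * ?d x \<partial>lebesgue) \<longlonglongrightarrow> (\<integral>x. v x * ?d x \<partial>lebesgue)"
      by (simp add: LIM_zero_iff)
    have \<phi>2: "integrable lebesgue (\<lambda>x. (\<phi> x)\<^sup>2)"
    proof -
      obtain B' N' where B': "0 < B'" "\<And>x. \<bar>\<phi> x\<bar> \<le> B' * indicator (cball 0 N') x"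
        using test_fun_bound[OF \<phi>] by metis
      have fin: "integrable lebesgue (indicator (cball 0 N') :: R4 \<Rightarrow> real)"
        using emeasure_bounded_finite[OF bounded_cball[of "0::R4" N']] by (intro integrable_real_indicator) auto
      have "(\<phi> x)\<^sup>2 \<le> B'\<^sup>2 * indicator (cball 0 N') x" for x
        using power_mono[OF B'(2)[of x], of 2] by (cases "x \<in> cball 0 N'") (auto simp: power_mult_distrib)
      then show ?thesis
        by (intro integrable_norm_le[OF integrable_mult_right[OF fin, of "B'\<^sup>2"]]) auto
    qed
    note [measurable] = vec_nth_borel
    have ci: "integrable lebesgue (\<lambda>x. (norm (k x $ i))\<^sup>2)" "(\<integral>x. (norm (k x $ i))\<^sup>2 \<partial>lebesgue) \<le> E k"
      if [measurable]: "k \<in> borel_measurable lebesgue" and k: "integrable lebesgue (\<lambda>x. (norm (k x))\<^sup>2)" for k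
    proof -
      have b: "(norm (k x $ i))\<^sup>2 \<le> (norm (k x))\<^sup>2" for x
        by (intro power_mono) (auto simp: component_le_norm_cart)
      show i: "integrable lebesgue (\<lambda>x. (norm (k x $ i))\<^sup>2)"
        by (rule integrable_norm_le[OF k]) (use b in auto)
      show "(\<integral>x. (norm (k x $ i))\<^sup>2 \<partial>lebesgue) \<le> E k"
        unfolding E_def by (intro integral_mono i k b)
    qed
    have iG: "integrable lebesgue (\<lambda>x. G x $ i * \<phi> x)"
      using L2_inner_integrable[of "\<lambda>x. G x $ i" lebesgue \<phi>] ci(1)[OF G Gi] \<phi>2 by simp
    have "(\<lambda>n. (\<integral>x. p n x $ i * \<phi> x \<partial>lebesgue) - (\<integral>x. G x $ i * \<phi> x \<partial>lebesgue)) \<longlonglongrightarrow> 0"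
    proof (rule Lim_null_comparison)
      have "(\<lambda>n. sqrt (E (\<lambda>x. p n x - G x)) * sqrt (\<integral>x. (norm (\<phi> x))\<^sup>2 \<partial>lebesgue)) \<longlonglongrightarrow> sqrt 0 * sqrt (\<integral>x. (norm (\<phi> x))\<^sup>2 \<partial>lebesgue)"
        by (intro tendsto_intros pG)
      then show "(\<lambda>n. sqrt (E (\<lambda>x. p n x - G x)) * sqrt (\<integral>x. (norm (\<phi> x))\<^sup>2 \<partial>lebesgue)) \<longlonglongrightarrow> 0" by simp
      have "norm ((\<integral>x. p n x $ i * \<phi> x \<partial>lebesgue) - (\<integral>x. G x $ i * \<phi> x \<partial>lebesgue)) \<le> sqrt (E (\<lambda>x. p n x - G x)) * sqrt (\<integral>x. (norm (\<phi> x))\<^sup>2 \<partial>lebesgue)" for n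
      proof -
        note h = dif[OF pm G pi Gi, of n]
        have "(\<integral>x. p n x $ i * \<phi> x \<partial>lebesgue) - (\<integral>x. G x $ i * \<phi> x \<partial>lebesgue) = (\<integral>x. (p n x - G x) $ i * \<phi> x \<partial>lebesgue)"
          using ip iG by (subst Bochner_Integration.integral_diff[symmetric]) (auto simp: algebra_simps)
        also have "norm \<dots> \<le> sqrt (\<integral>x. (norm ((p n x - G x) $ i))\<^sup>2 \<partial>lebesgue) * sqrt (\<integral>x. (norm (\<phi> x))\<^sup>2 \<partial>lebesgue)"
          using L2_Cauchy_Schwarz[of "\<lambda>x. (p n x - G x) $ i" lebesgue \<phi>] ci(1)[OF h] \<phi>2 by simp
        also have "\<dots> \<le> sqrt (E (\<lambda>x. p n x - G x)) * sqrt (\<integral>x. (norm (\<phi> x))\<^sup>2 \<partial>lebesgue)"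
          by (intro mult_right_mono real_sqrt_le_mono ci(2)[OF h]) simp
        finally show ?thesis .
      qed
      then show "\<forall>\<^sub>F n in sequentially. norm ((\<integral>x. p n x $ i * \<phi> x \<partial>lebesgue) - (\<integral>x. G x $ i * \<phi> x \<partial>lebesgue)) \<le> sqrt (E (\<lambda>x. p n x - G x)) * sqrt (\<integral>x. (norm (\<phi> x))\<^sup>2 \<partial>lebesgue)"
        by simp
    qed
    then have "(\<lambda>n. \<integral>x. p n x $ i * \<phi> x \<partial>lebesgue) \<longlonglongrightarrow> (\<integral>x. G x $ i * \<phi> x \<partial>lebesgue)"
      by (simp add: LIM_zero_iff)
    then have "(\<lambda>n. \<integral>x. w n x * ?d x \<partial>lebesgue) \<longlonglongrightarrow> - (\<integral>x. G x $ i * \<phi> x \<partial>lebesgue)"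
      unfolding ew by (rule tendsto_minus)
    with lim1 have "(\<integral>x. v x * ?d x \<partial>lebesgue) = - (\<integral>x. G x $ i * \<phi> x \<partial>lebesgue)"
      by (rule LIMSEQ_unique)
    with iv iG show "integrable lebesgue (\<lambda>x. v x * pderiv4 i \<phi> x) \<and> integrable lebesgue (\<lambda>x. G x $ i * \<phi> x) \<and>
      (\<integral>x. v x * pderiv4 i \<phi> x \<partial>lebesgue) = - (\<integral>x. G x $ i * \<phi> x \<partial>lebesgue)" by blast
  qed
  then have LG: "L2_grad v G" using G Gi by (simp add: L2_grad_def)

  \<comment> \<open>The one-sided Pythagoras inequality\<close>
  define L where "L = 4 * M + 2"
  have main: "\<exists>m0. \<forall>m\<ge>m0. E (\<lambda>x. g m x - G x) + E G \<le> E (g m) + e" if e: "0 < e" for e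
  proof -
    have "(\<lambda>n. (L + 1) * (1 / real (Suc n)) + 4 * (sqrt L * sqrt (E (\<lambda>x. p n x - G x))) + 2 * E (\<lambda>x. p n x - G x))
       \<longlonglongrightarrow> (L + 1) * 0 + 4 * (sqrt L * sqrt 0) + 2 * 0"
      by (intro tendsto_intros pG LIMSEQ_Suc[OF lim_1_over_n])
    then have "eventually (\<lambda>n. (L + 1) * (1 / real (Suc n)) + 4 * (sqrt L * sqrt (E (\<lambda>x. p n x - G x))) + 2 * E (\<lambda>x. p n x - G x) < e) sequentially"
      using e by (intro order_tendstoD(2)) auto
    then obtain n where n: "(L + 1) * (1 / real (Suc n)) + 4 * (sqrt L * sqrt (E (\<lambda>x. p n x - G x))) + 2 * E (\<lambda>x. p n x - G x) < e"
      by (auto simp: eventually_sequentially)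
    obtain m0 where m0: "\<And>m. m \<ge> m0 \<Longrightarrow> g m \<in> C n" using C_in[of n] by blast
    have "E (\<lambda>x. g m x - G x) + E G \<le> E (g m) + e" if m: "m \<ge> m0" for m
    proof -
      define t where "t = 1 / real (Suc n)"
      have t: "0 < t" "t \<le> 1" by (auto simp: t_def)
      note gC = m0[OF m]
      note gm = Cm[OF gC]
      define a where "a = (\<lambda>x. g m x - p n x)"
      define \<eta> where "\<eta> = E (\<lambda>x. p n x - G x)"
      have am: "a \<in> borel_measurable lebesgue" "integrable lebesgue (\<lambda>x. (norm (a x))\<^sup>2)"
        unfolding a_def using dif[OF gm(1) pm gm(2) pi, of n] by auto
      have Ep: "E (p n) \<le> M + 1"
      proof -
        have "(1 / real (Suc n))\<^sup>2 \<le> 1" by (intro power_le_one) auto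
        then show ?thesis using pE[of n] d_M[of n] by linarith
      qed
      have Eg: "E (g m) \<le> M" using gM[of m] by (simp add: E_def)
      \<comment> \<open>\<open>L\<close> is 2 (M + 1) + 2 M: the energy of \<open>p n\<close>
        exceeds \<open>M\<close> by at most 1, that of \<open>g m\<close> not at all.\<close>
      have Ea: "E a \<le> L" using par(1)[OF pm gm(1) pi gm(2), of n] Ep Eg by (simp add: a_def L_def)
      \<comment> \<open>Moving from \<open>p n\<close> towards \<open>g m\<close> by the step t
        stays in \<open>C n\<close> and cannot bring the energy below d n. This bounds the inner
        product of \<open>p n\<close> with \<open>a\<close> from below by a term of order t, which
        is the Pythagoras inequality up to an error.\<close>
      have "d n \<le> E (\<lambda>x. (1 - t) *\<^sub>R p n x + t *\<^sub>R g m x)"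
        using t by (intro d_le C_convex p gC) auto
      also have "\<dots> = E (p n) + 2 * t * ip (p n) a + t\<^sup>2 * E a"
        using ex[OF pm gm(1) pi gm(2), of t n] by (simp add: a_def)
      finally have "0 \<le> t * (2 * ip (p n) a + t * (1 + E a))"
        using pE[of n, folded t_def] by (simp add: power2_eq_square algebra_simps)
      then have "0 \<le> 2 * ip (p n) a + t * (1 + E a)"
        using t(1) by (simp add: zero_le_mult_iff)
      moreover have "t * (1 + E a) \<le> t * (1 + L)" using Ea t by (intro mult_left_mono) auto
      moreover have "E (g m) = E (p n) + 2 * ip (p n) a + E a"
        using ex[OF pm gm(1) pi gm(2), of 1 n] by (simp add: a_def)
      ultimately have 1: "E a \<le> E (g m) - E (p n) + t * (1 + L)" by linarith
      note bm = dif[OF pm G pi Gi, of n]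
      have eq: "g m x - G x = a x + 1 *\<^sub>R (p n x - G x)" for x by (simp add: a_def)
      have "E (\<lambda>x. g m x - G x) = E a + 2 * ip a (\<lambda>x. p n x - G x) + \<eta>"
        unfolding E_def ip_def \<eta>_def eq using L2_norm_expand[OF am(1) bm(1) am(2) bm(2), of 1] by simp
      moreover have "ip a (\<lambda>x. p n x - G x) \<le> sqrt (E a) * sqrt \<eta>"
        using L2_Cauchy_Schwarz[OF am(1) bm(1) am(2) bm(2)] by (simp add: E_def ip_def \<eta>_def)
      moreover have "sqrt (E a) * sqrt \<eta> \<le> sqrt L * sqrt \<eta>"
        by (intro mult_right_mono real_sqrt_le_mono Ea) (simp add: \<eta>_def E0)
      ultimately have 2: "E (\<lambda>x. g m x - G x) \<le> E a + 2 * (sqrt L * sqrt \<eta>) + \<eta>" by linarith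
      have "G = (\<lambda>x. p n x + (-1) *\<^sub>R (p n x - G x))" by auto
      then have "E G = E (\<lambda>x. p n x + (-1) *\<^sub>R (p n x - G x))" by simp
      also have "\<dots> = E (p n) - 2 * ip (p n) (\<lambda>x. p n x - G x) + \<eta>"
        unfolding E_def ip_def \<eta>_def using L2_norm_expand[OF pm bm(1) pi bm(2), of n "-1"] by simp
      finally have "E G = E (p n) - 2 * ip (p n) (\<lambda>x. p n x - G x) + \<eta>" .
      moreover have "- ip (p n) (\<lambda>x. p n x - G x) \<le> sqrt (E (p n)) * sqrt \<eta>"
        using L2_Cauchy_Schwarz[OF pm bm(1) pi bm(2), of n] by (simp add: E_def ip_def \<eta>_def)
      moreover have "sqrt (E (p n)) * sqrt \<eta> \<le> sqrt L * sqrt \<eta>"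
        using Ep M0 by (intro mult_right_mono real_sqrt_le_mono) (auto simp: \<eta>_def E0 L_def)
      ultimately have 3: "E G \<le> E (p n) + 2 * (sqrt L * sqrt \<eta>) + \<eta>" by linarith
      have "t * (1 + L) + 4 * (sqrt L * sqrt \<eta>) + 2 * \<eta> < e"
        using n by (simp add: t_def \<eta>_def algebra_simps)
      then show ?thesis using 1 2 3 by linarith
    qed
    then show ?thesis by blast
  qed
  show ?thesis by (rule that[OF LG]) (use main in \<open>simp add: E_def\<close>)
qed

section \<open>The quartic functional\<close>

definition Fpoly :: "real \<Rightarrow> real \<Rightarrow> real" where
  "Fpoly a b = (1/36) * a^4 + (9/4) * b^4 + a^2 * b^2 + (1/9) * a^3 * b"

lemma Nfun_Fpoly: "Nfun u w = (\<integral>x. Fpoly (u x) (w x) \<partial>lebesgue)"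
  by (simp add: Nfun_def Fpoly_def)

text \<open>Only the term a^3 b / 9 has no sign. It is absorbed by a^2 (a + 4 b)^2 / 72, which uses
  half of a^4 / 36 and 2/9 of a^2 b^2. Consequently the quartic functional controls both L^4 norms
  for pairs of any sign.\<close>

lemma Fpoly_lower: "(a^4 + b^4) / 72 \<le> Fpoly a b"
proof -
  have "0 \<le> a\<^sup>2 * (a + 4 * b)\<^sup>2" by simp
  then have 1: "0 \<le> a^4 + 8 * (a^3 * b) + 16 * (a\<^sup>2 * b\<^sup>2)"
    by (simp add: power2_eq_square power4_eq_xxxx power3_eq_cube algebra_simps)
  have lin: "0 \<le> p + 8 * t + 16 * s \<Longrightarrow> 0 \<le> s \<Longrightarrow> 0 \<le> q \<Longrightarrow> (p + q) / 72 \<le> (1/36) * p + (9/4) * q + s + (1/9) * t"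
    for p q s t :: real by (simp add: field_simps)
  show ?thesis unfolding Fpoly_def mult.assoc by (rule lin[OF 1]) simp_all
qed

lemma Fpoly_nonneg: "0 \<le> Fpoly a b"
proof -
  have "0 \<le> (a^4 + b^4) / 72" by simp
  also note Fpoly_lower
  finally show ?thesis .
qed

lemma Fpoly_abs_le: "Fpoly a b \<le> 3 * (\<bar>a\<bar> + \<bar>b\<bar>)^4"
proof -
  have e: "(\<bar>a\<bar> + \<bar>b\<bar>)^4 = a^4 + 4 * (\<bar>a\<bar>^3 * \<bar>b\<bar>) + 6 * (a\<^sup>2 * b\<^sup>2) + 4 * (\<bar>a\<bar> * \<bar>b\<bar>^3) + b^4"
  proof -
    have "(x + y)^4 = x^4 + 4 * (x^3 * y) + 6 * (x\<^sup>2 * y\<^sup>2) + 4 * (x * y^3) + y^4" for x y :: real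
      by (simp add: power2_eq_square power4_eq_xxxx power3_eq_cube algebra_simps)
    from this[of "\<bar>a\<bar>" "\<bar>b\<bar>"] show ?thesis by simp
  qed
  have "a^3 * b \<le> \<bar>a^3 * b\<bar>" by simp
  then have "a^3 * b \<le> \<bar>a\<bar>^3 * \<bar>b\<bar>" by (simp add: abs_mult power_abs)
  moreover have lin: "t \<le> t' \<Longrightarrow> 0 \<le> t' \<Longrightarrow> 0 \<le> p \<Longrightarrow> 0 \<le> q \<Longrightarrow> 0 \<le> s \<Longrightarrow> 0 \<le> s' \<Longrightarrow>
      (1/36) * p + (9/4) * q + s + (1/9) * t \<le> 3 * (p + 4 * t' + 6 * s + 4 * s' + q)"
    for p q s s' t t' :: real by (simp add: field_simps)
  ultimately show ?thesis unfolding Fpoly_def e mult.assoc by (intro lin) simp_all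
qed

lemma pow4_sum_le: "(a + b)^4 \<le> 8 * (a^4 + b^4)" for a b :: real
proof -
  have 1: "(x + y)\<^sup>2 \<le> 2 * (x\<^sup>2 + y\<^sup>2)" for x y :: real
    using sum_squares_bound[of x y] by (simp add: power2_sum)
  have "(a + b)^4 = ((a + b)\<^sup>2)\<^sup>2" by simp
  also have "\<dots> \<le> (2 * (a\<^sup>2 + b\<^sup>2))\<^sup>2" by (intro power_mono 1) simp
  also have "\<dots> = 4 * (a\<^sup>2 + b\<^sup>2)\<^sup>2" by (simp only: power_mult_distrib) simp
  also have "\<dots> \<le> 4 * (2 * ((a\<^sup>2)\<^sup>2 + (b\<^sup>2)\<^sup>2))" by (intro mult_left_mono 1) simp
  finally show ?thesis by simp
qed

lemma Fpoly_upper: "Fpoly a b \<le> 24 * (a^4 + b^4)"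
  using Fpoly_abs_le[of a b] pow4_sum_le[of "\<bar>a\<bar>" "\<bar>b\<bar>"] by simp

text \<open>A calculus of majorants: if the values and increments of two factors are dominated by
  those of A and B, the same holds for the product. Two rounds of it reach degree four.\<close>

lemma prod_diff_le:
  fixes x x' y y' A A' B B' :: real
  assumes "\<bar>x'\<bar> \<le> A'" "\<bar>x - x'\<bar> \<le> A - A'" "\<bar>y'\<bar> \<le> B'" "\<bar>y - y'\<bar> \<le> B - B'"
  shows "\<bar>x * y - x' * y'\<bar> \<le> A * B - A' * B'"
proof -
  have "x * y - x' * y' = (x - x') * y' + x' * (y - y') + (x - x') * (y - y')" by (simp add: algebra_simps)
  also have "\<bar>\<dots>\<bar> \<le> \<bar>x - x'\<bar> * \<bar>y'\<bar> + \<bar>x'\<bar> * \<bar>y - y'\<bar> + \<bar>x - x'\<bar> * \<bar>y - y'\<bar>"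
    unfolding abs_mult[symmetric] by linarith
  also have "\<dots> \<le> (A - A') * B' + A' * (B - B') + (A - A') * (B - B')"
    by (intro add_mono mult_mono) (use assms abs_ge_zero order_trans in \<open>blast+\<close>)
  also have "\<dots> = A * B - A' * B'" by (simp add: algebra_simps)
  finally show ?thesis .
qed

text \<open>Every monomial of degree four has its increment dominated by that of r^4. The
  coefficients 1/36, 9/4, 1 and 1/9 add up to less than 4.\<close>

lemma Fpoly_diff_le:
  assumes r: "r = \<bar>a\<bar> + \<bar>b\<bar>" and s: "s = \<bar>c\<bar> + \<bar>d\<bar>"
  shows "\<bar>Fpoly (a + c) (b + d) - Fpoly a b\<bar> \<le> 4 * ((r + s)^4 - r^4)"
proof -
  have r0: "0 \<le> r" "0 \<le> s" using r s by auto
  have 1: "\<bar>a\<bar> \<le> r" "\<bar>(a + c) - a\<bar> \<le> (r + s) - r" "\<bar>b\<bar> \<le> r" "\<bar>(b + d) - b\<bar> \<le> (r + s) - r"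
    using r s by auto
  have sq: "\<bar>x * y\<bar> \<le> r * r" if "\<bar>x\<bar> \<le> r" "\<bar>y\<bar> \<le> r" for x y
    unfolding abs_mult using that r0 by (intro mult_mono) auto
  have aa: "\<bar>(a + c) * (a + c) - a * a\<bar> \<le> (r + s) * (r + s) - r * r"
   and bb: "\<bar>(b + d) * (b + d) - b * b\<bar> \<le> (r + s) * (r + s) - r * r"
   and ab: "\<bar>(a + c) * (b + d) - a * b\<bar> \<le> (r + s) * (r + s) - r * r"
    using 1 by (intro prod_diff_le; simp)+
  let ?P = "(r + s) * (r + s) * ((r + s) * (r + s)) - r * r * (r * r)"
  have m: "\<bar>(a + c) * (a + c) * ((a + c) * (a + c)) - a * a * (a * a)\<bar> \<le> ?P"
    "\<bar>(b + d) * (b + d) * ((b + d) * (b + d)) - b * b * (b * b)\<bar> \<le> ?P"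
    "\<bar>(a + c) * (a + c) * ((b + d) * (b + d)) - a * a * (b * b)\<bar> \<le> ?P"
    "\<bar>(a + c) * (a + c) * ((a + c) * (b + d)) - a * a * (a * b)\<bar> \<le> ?P"
    using 1 by (intro prod_diff_le sq aa bb ab; simp)+
  have F: "Fpoly x y = (1/36) * (x * x * (x * x)) + (9/4) * (y * y * (y * y)) + x * x * (y * y) + (1/9) * (x * x * (x * y))" for x y
    by (simp add: Fpoly_def power2_eq_square power4_eq_xxxx power3_eq_cube mult_ac)
  have P: "?P = (r + s)^4 - r^4" by (simp add: power4_eq_xxxx mult_ac)
  have lin: "\<bar>x1 - y1\<bar> \<le> p \<Longrightarrow> \<bar>x2 - y2\<bar> \<le> p \<Longrightarrow> \<bar>x3 - y3\<bar> \<le> p \<Longrightarrow> \<bar>x4 - y4\<bar> \<le> p \<Longrightarrow>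
     \<bar>(1/36) * x1 + (9/4) * x2 + x3 + (1/9) * x4 - ((1/36) * y1 + (9/4) * y2 + y3 + (1/9) * y4)\<bar> \<le> 4 * p"
    for x1 x2 x3 x4 y1 y2 y3 y4 p :: real by linarith
  show ?thesis unfolding F P[symmetric] by (intro lin m)
qed

text \<open>If s is small against \<epsilon> r, every term of the binomial difference is at most a
  multiple of s r^3, and the coefficients 4 + 6 + 4 + 1 = 15 explain the threshold. Otherwise r
  itself is at most 15 s / \<epsilon>, and 30 = 15 + 15 covers r + s.\<close>

lemma pow4_diff_Young:
  assumes "0 \<le> r" "0 \<le> s" "0 < \<epsilon>" "\<epsilon> \<le> (1::real)"
  shows "(r + s)^4 - r^4 \<le> \<epsilon> * r^4 + (30 / \<epsilon>)^4 * s^4"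
proof (cases "15 * s \<le> \<epsilon> * r")
  case True
  then have sr: "s \<le> r" using assms by (smt (verit) mult_left_le_one_le)
  have "(r + s)^4 - r^4 = s * (4 * r^3 + 6 * r\<^sup>2 * s + 4 * r * s\<^sup>2 + s^3)"
    by (simp add: power2_eq_square power4_eq_xxxx power3_eq_cube algebra_simps)
  also have "\<dots> \<le> s * (4 * r^3 + 6 * r\<^sup>2 * r + 4 * r * r\<^sup>2 + r^3)"
    using assms sr by (intro mult_left_mono add_mono mult_left_mono power_mono order_refl) auto
  also have "\<dots> = (15 * s) * r^3" by (simp add: power2_eq_square power3_eq_cube algebra_simps)
  also have "\<dots> \<le> (\<epsilon> * r) * r^3" using True assms by (intro mult_right_mono) auto
  also have "\<dots> = \<epsilon> * r^4" by (simp add: power4_eq_xxxx power3_eq_cube)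
  also have "\<dots> \<le> \<epsilon> * r^4 + (30 / \<epsilon>)^4 * s^4" by simp
  finally show ?thesis .
next
  case False
  then have "r \<le> (15 / \<epsilon>) * s" using assms by (simp add: field_simps)
  moreover have "s \<le> (15 / \<epsilon>) * s" using assms mult_right_mono[of 1 "15 / \<epsilon>" s] by (simp add: field_simps)
  moreover have "(30 / \<epsilon>) * s = 2 * ((15 / \<epsilon>) * s)" by simp
  ultimately have "r + s \<le> (30 / \<epsilon>) * s" by linarith
  then have "(r + s)^4 \<le> ((30 / \<epsilon>) * s)^4" using assms by (intro power_mono) auto
  also have "\<dots> = (30 / \<epsilon>)^4 * s^4" by (rule power_mult_distrib)
  finally have "(r + s)^4 \<le> (30 / \<epsilon>)^4 * s^4" .
  moreover have "0 \<le> \<epsilon> * r^4" "0 \<le> r^4" using assms by simp_all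
  ultimately show ?thesis by linarith
qed

text \<open>The asymmetry is deliberate: (a, b) will be the remainder, whose L^4 norm is merely
  bounded and which therefore carries the small factor, while the large constant falls on the fixed
  limit (c, d).\<close>

lemma Fpoly_Brezis_Lieb_bound:
  assumes "0 < \<epsilon>" "\<epsilon> \<le> 1"
  shows "\<bar>Fpoly (a + c) (b + d) - Fpoly a b - Fpoly c d\<bar> \<le> 32 * \<epsilon> * (a^4 + b^4) + (32 * (30 / \<epsilon>)^4 + 24) * (c^4 + d^4)"
proof -
  let ?r = "\<bar>a\<bar> + \<bar>b\<bar>" and ?s = "\<bar>c\<bar> + \<bar>d\<bar>"
  have "\<bar>Fpoly (a + c) (b + d) - Fpoly a b - Fpoly c d\<bar> \<le> 4 * ((?r + ?s)^4 - ?r^4) + Fpoly c d"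
    using Fpoly_diff_le[OF refl refl, of a c b d] Fpoly_nonneg[of c d] by linarith
  also have "\<dots> \<le> 4 * (\<epsilon> * ?r^4 + (30 / \<epsilon>)^4 * ?s^4) + 24 * (c^4 + d^4)"
    by (intro add_mono mult_left_mono pow4_diff_Young Fpoly_upper) (use assms in auto)
  also have "\<dots> \<le> 4 * (\<epsilon> * (8 * (a^4 + b^4)) + (30 / \<epsilon>)^4 * (8 * (c^4 + d^4))) + 24 * (c^4 + d^4)"
    using pow4_sum_le[of "\<bar>a\<bar>" "\<bar>b\<bar>"] pow4_sum_le[of "\<bar>c\<bar>" "\<bar>d\<bar>"] assms
    by (intro add_mono mult_left_mono order_refl) auto
  finally show ?thesis by (simp add: algebra_simps)
qed

lemma Fpoly_tendsto: "(f \<longlongrightarrow> a) F \<Longrightarrow> (g \<longlongrightarrow> b) F \<Longrightarrow> ((\<lambda>x. Fpoly (f x) (g x)) \<longlongrightarrow> Fpoly a b) F"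
  unfolding Fpoly_def by (intro tendsto_intros)

lemma Fpoly_borel[measurable (raw)]:
  "f \<in> borel_measurable M \<Longrightarrow> g \<in> borel_measurable M \<Longrightarrow> (\<lambda>x. Fpoly (f x) (g x)) \<in> borel_measurable M"
  unfolding Fpoly_def
  by (intro borel_measurable_add borel_measurable_times borel_measurable_power borel_measurable_const)

lemma integrable_Fpoly:
  assumes [measurable]: "f \<in> borel_measurable M" "g \<in> borel_measurable M"
    and "integrable M (\<lambda>x. (f x)^4)" "integrable M (\<lambda>x. (g x)^4)"
  shows "integrable M (\<lambda>x. Fpoly (f x) (g x))"
proof (rule integrable_norm_le)
  show "integrable M (\<lambda>x. 24 * ((f x)^4 + (g x)^4))" using assms by simp
  show "norm (Fpoly (f x) (g x)) \<le> 24 * ((f x)^4 + (g x)^4)" for x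
    using Fpoly_upper[of "f x" "g x"] Fpoly_nonneg[of "f x" "g x"] by simp
qed measurable

lemma integrable_pow4_lincomb:
  assumes [measurable]: "f \<in> borel_measurable M" "g \<in> borel_measurable M"
    and "integrable M (\<lambda>x. (f x)^4)" "integrable M (\<lambda>x. (g x :: real)^4)"
  shows "integrable M (\<lambda>x. (a * f x + b * g x)^4)"
proof (rule integrable_norm_le)
  show "integrable M (\<lambda>x. 8 * (a^4 * (f x)^4 + b^4 * (g x)^4))" using assms by simp
  show "norm ((a * f x + b * g x)^4) \<le> 8 * (a^4 * (f x)^4 + b^4 * (g x)^4)" for x
    using pow4_sum_le[of "a * f x" "b * g x"] by (simp add: power_mult_distrib)
qed measurable

text \<open>The defect \<open>H\<close> tends to 0 almost everywhere but has no integrable majorant.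
  The part of |H| above a small multiple of the remainder does have one, built from \<open>V\<close>
  and \<open>Z\<close> alone, so it vanishes in the limit; the small multiple is controlled by the
  uniform L^4 bound.\<close>

lemma Nfun_Brezis_Lieb:
  fixes v z :: "nat \<Rightarrow> R4 \<Rightarrow> real"
  assumes m[measurable]: "\<And>i. v i \<in> borel_measurable lebesgue" "\<And>i. z i \<in> borel_measurable lebesgue"
    "V \<in> borel_measurable lebesgue" "Z \<in> borel_measurable lebesgue"
    and i4: "\<And>i. integrable lebesgue (\<lambda>x. (v i x)^4)" "\<And>i. integrable lebesgue (\<lambda>x. (z i x)^4)"
    and b4: "\<And>i. (\<integral>x. (v i x)^4 \<partial>lebesgue) \<le> A" "\<And>i. (\<integral>x. (z i x)^4 \<partial>lebesgue) \<le> A"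
    and I4: "integrable lebesgue (\<lambda>x. (V x)^4)" "integrable lebesgue (\<lambda>x. (Z x)^4)"
    and lim: "AE x in lebesgue. (\<lambda>i. v i x) \<longlonglongrightarrow> V x" "AE x in lebesgue. (\<lambda>i. z i x) \<longlonglongrightarrow> Z x"
    and e: "0 < e"
  shows "\<exists>i0. \<forall>i\<ge>i0. Nfun (v i) (z i) \<le> Nfun (\<lambda>x. v i x - V x) (\<lambda>x. z i x - Z x) + Nfun V Z + e"
proof -
  have d4: "integrable lebesgue (\<lambda>x. (v i x - V x)^4)" "integrable lebesgue (\<lambda>x. (z i x - Z x)^4)" for i
    using integrable_pow4_lincomb[OF m(1)[of i] m(3) i4(1) I4(1), of 1 "-1"]
      integrable_pow4_lincomb[OF m(2)[of i] m(4) i4(2) I4(2), of 1 "-1"] by simp_all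
  define S where "S = 8 * (A + (\<integral>x. (V x)^4 \<partial>lebesgue)) + 8 * (A + (\<integral>x. (Z x)^4 \<partial>lebesgue))"
  have A0: "0 \<le> A" by (rule order_trans[OF _ b4(1)[of 0]]) simp
  have S0: "0 \<le> S" using A0 by (simp add: S_def)
  have dS: "(\<integral>x. (v i x - V x)^4 + (z i x - Z x)^4 \<partial>lebesgue) \<le> S" for i
  proof -
    have "(v i x - V x)^4 \<le> 8 * ((v i x)^4 + (V x)^4)" "(z i x - Z x)^4 \<le> 8 * ((z i x)^4 + (Z x)^4)" for x
      using pow4_sum_le[of "v i x" "- V x"] pow4_sum_le[of "z i x" "- Z x"] by simp_all
    then have "(\<integral>x. (v i x - V x)^4 + (z i x - Z x)^4 \<partial>lebesgue)
      \<le> (\<integral>x. 8 * ((v i x)^4 + (V x)^4) + 8 * ((z i x)^4 + (Z x)^4) \<partial>lebesgue)"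
      using d4 i4 I4 by (intro integral_mono Bochner_Integration.integrable_add integrable_mult_right add_mono) auto
    also have "\<dots> \<le> S" using i4 I4 b4[of i] by (simp add: S_def)
    finally show ?thesis .
  qed
  \<comment> \<open>Chosen so that 32 \<epsilon> S \<le> e / 2; \<open>S + 1\<close> avoids division
    by zero, and the cap 1 is the range of the pointwise bound.\<close>
  define \<epsilon> where "\<epsilon> = min 1 (e / (64 * (S + 1)))"
  have \<epsilon>: "0 < \<epsilon>" "\<epsilon> \<le> 1" using e S0 by (auto simp: \<epsilon>_def)
  have \<epsilon>S: "32 * \<epsilon> * S \<le> e / 2"
  proof -
    have "\<epsilon> * S \<le> e / (64 * (S + 1)) * (S + 1)" using S0 \<epsilon> e by (intro mult_mono) (auto simp: \<epsilon>_def)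
    also have "\<dots> = e / 64"
    proof -
      have "S + 1 \<noteq> 0" using S0 by linarith
      then show ?thesis by (metis divide_divide_eq_left nonzero_divide_eq_eq)
    qed
    finally show ?thesis by linarith
  qed
  let ?C = "32 * (30 / \<epsilon>)^4 + 24"
  define H where "H i x = Fpoly (v i x) (z i x) - Fpoly (v i x - V x) (z i x - Z x) - Fpoly (V x) (Z x)" for i x
  \<comment> \<open>The truncated defect of Brezis and Lieb, to which dominated convergence
    applies.\<close>
  define k where "k i x = max 0 (\<bar>H i x\<bar> - 32 * \<epsilon> * ((v i x - V x)^4 + (z i x - Z x)^4))" for i x
  have [measurable]: "H i \<in> borel_measurable lebesgue" for i unfolding H_def[abs_def] by measurable
  have [measurable]: "k i \<in> borel_measurable lebesgue" for i unfolding k_def[abs_def] by measurable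
  have Hb: "\<bar>H i x\<bar> \<le> 32 * \<epsilon> * ((v i x - V x)^4 + (z i x - Z x)^4) + ?C * ((V x)^4 + (Z x)^4)" for i x
    using Fpoly_Brezis_Lieb_bound[OF \<epsilon>, of "v i x - V x" "V x" "z i x - Z x" "Z x"] by (simp add: H_def)
  have kb: "0 \<le> k i x" "k i x \<le> ?C * ((V x)^4 + (Z x)^4)" for i x
  proof -
    show "0 \<le> k i x" by (simp add: k_def)
    have "0 \<le> ?C * ((V x)^4 + (Z x)^4)" by (intro mult_nonneg_nonneg add_nonneg_nonneg) auto
    then show "k i x \<le> ?C * ((V x)^4 + (Z x)^4)" unfolding k_def using Hb[of i x] by (intro max.boundedI) linarith+
  qed
  have Ci: "integrable lebesgue (\<lambda>x. ?C * ((V x)^4 + (Z x)^4))"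
    using I4 by (intro integrable_mult_right Bochner_Integration.integrable_add)
  have ki: "integrable lebesgue (k i)" for i
    by (rule integrable_norm_le[OF Ci]) (use kb in auto)
  have "(\<lambda>i. \<integral>x. k i x \<partial>lebesgue) \<longlonglongrightarrow> (\<integral>x. 0 \<partial>(lebesgue :: R4 measure))"
  proof (rule integral_dominated_convergence[OF _ _ Ci])
    show "AE x in lebesgue. (\<lambda>i. k i x) \<longlonglongrightarrow> 0"
      using lim
    proof eventually_elim
      case (elim x)
      have "(\<lambda>i. H i x) \<longlonglongrightarrow> Fpoly (V x) (Z x) - Fpoly (V x - V x) (Z x - Z x) - Fpoly (V x) (Z x)"
        unfolding H_def by (intro tendsto_diff Fpoly_tendsto tendsto_const elim)
      then have "(\<lambda>i. \<bar>H i x\<bar>) \<longlonglongrightarrow> 0" by (simp add: Fpoly_def tendsto_rabs_zero_iff)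
      moreover have "norm (k i x) \<le> \<bar>H i x\<bar>" for i
      proof -
        have "0 \<le> 32 * \<epsilon> * ((v i x - V x)^4 + (z i x - Z x)^4)" using \<epsilon> by simp
        then show ?thesis by (simp add: k_def)
      qed
      ultimately show ?case by (intro Lim_null_comparison[of "\<lambda>i. k i x" "\<lambda>i. \<bar>H i x\<bar>"]) auto
    qed
    show "AE x in lebesgue. norm (k i x) \<le> ?C * ((V x)^4 + (Z x)^4)" for i
      using kb by (intro AE_I2) simp
  qed auto
  then have "(\<lambda>i. \<integral>x. k i x \<partial>lebesgue) \<longlonglongrightarrow> 0" by simp
  then have "eventually (\<lambda>i. (\<integral>x. k i x \<partial>lebesgue) < e / 2) sequentially"
    using e by (intro order_tendstoD(2)) auto
  then obtain i0 where i0: "\<And>i. i \<ge> i0 \<Longrightarrow> (\<integral>x. k i x \<partial>lebesgue) < e / 2" by (auto simp: eventually_sequentially)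
  have "Nfun (v i) (z i) \<le> Nfun (\<lambda>x. v i x - V x) (\<lambda>x. z i x - Z x) + Nfun V Z + e" if "i \<ge> i0" for i
  proof -
    have f1: "integrable lebesgue (\<lambda>x. Fpoly (v i x) (z i x))" and f2: "integrable lebesgue (\<lambda>x. Fpoly (v i x - V x) (z i x - Z x))"
      and f3: "integrable lebesgue (\<lambda>x. Fpoly (V x) (Z x))"
      by (auto intro!: integrable_Fpoly i4 I4 d4)
    have i4d: "integrable lebesgue (\<lambda>x. (v i x - V x)^4 + (z i x - Z x)^4)" using d4 by simp
    have "Nfun (v i) (z i) - Nfun (\<lambda>x. v i x - V x) (\<lambda>x. z i x - Z x) - Nfun V Z = (\<integral>x. H i x \<partial>lebesgue)"
      unfolding H_def Nfun_Fpoly using f1 f2 f3 by simp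
    also have "\<dots> \<le> (\<integral>x. k i x + 32 * \<epsilon> * ((v i x - V x)^4 + (z i x - Z x)^4) \<partial>lebesgue)"
    proof (rule integral_mono)
      show "integrable lebesgue (H i)" unfolding H_def[abs_def] using f1 f2 f3 by simp
      show "integrable lebesgue (\<lambda>x. k i x + 32 * \<epsilon> * ((v i x - V x)^4 + (z i x - Z x)^4))"
        by (intro Bochner_Integration.integrable_add integrable_mult_right ki d4)
      show "H i x \<le> k i x + 32 * \<epsilon> * ((v i x - V x)^4 + (z i x - Z x)^4)" for x
        unfolding k_def by linarith
    qed
    also have "\<dots> = (\<integral>x. k i x \<partial>lebesgue) + 32 * \<epsilon> * (\<integral>x. (v i x - V x)^4 + (z i x - Z x)^4 \<partial>lebesgue)"
      using ki[of i] i4d by (subst Bochner_Integration.integral_add) auto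
    also have "\<dots> \<le> e / 2 + 32 * \<epsilon> * S"
      using i0[OF that] dS[of i] \<epsilon> by (intro add_mono mult_left_mono) auto
    finally show ?thesis using \<epsilon>S by linarith
  qed
  then show ?thesis by blast
qed

lemma Nfun_nonneg: "0 \<le> Nfun u w"
  unfolding Nfun_Fpoly by (intro integral_nonneg_AE) (auto simp: Fpoly_nonneg)

lemma Nfun_scale: "Nfun (\<lambda>x. c * u x) (\<lambda>x. c * w x) = c^4 * Nfun u w"
proof -
  have "Fpoly (c * a) (c * b) = c^4 * Fpoly a b" for a b
    by (simp add: Fpoly_def power_mult_distrib algebra_simps power4_eq_xxxx power3_eq_cube power2_eq_square)
  then show ?thesis by (simp add: Nfun_Fpoly)
qed

lemma Iinf_le:
  assumes "(u, w) \<in> NN" "Nfun u w = 1" shows "Iinf \<le> Kfun u w"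
  unfolding Iinf_def
proof (rule cInf_lower)
  show "bdd_below {Kfun u w |u w. (u, w) \<in> NN \<and> Nfun u w = 1}"
    by (rule bdd_belowI[of _ 0]) (auto simp: Kfun_def)
qed (use assms in blast)

lemma Hdot1D:
  assumes "u \<in> Hdot1" shows "u \<in> borel_measurable lebesgue" "integrable lebesgue (\<lambda>x. (u x)^4)" "L2_grad u (grad u)"
  using assms L2_grad_grad by (auto simp: Hdot1_def)

lemma Hdot1I:
  "u \<in> borel_measurable lebesgue \<Longrightarrow> integrable lebesgue (\<lambda>x. (u x)^4) \<Longrightarrow> L2_grad u g \<Longrightarrow> u \<in> Hdot1"
  by (auto simp: Hdot1_def)

text \<open>Homogeneity: multiplying the pair by c with c^4 = 1 / N normalizes the quartic
  functional and multiplies the energy by c^2 = 1 / sqrt N. For N = 0 the left side is zero.\<close>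

lemma Kfun_ge_sqrt_Nfun:
  assumes u: "u \<in> Hdot1" and w: "w \<in> Hdot1"
  shows "Iinf * sqrt (Nfun u w) \<le> Kfun u w"
proof (cases "Nfun u w = 0")
  case True
  then show ?thesis by (simp add: Kfun_def)
next
  case False
  then have N: "0 < Nfun u w" using Nfun_nonneg[of u w] by linarith
  define c where "c = sqrt (1 / sqrt (Nfun u w))"
  have c: "0 < c" and c2: "c\<^sup>2 = 1 / sqrt (Nfun u w)" using N by (auto simp: c_def)
  have c4: "c^4 * Nfun u w = 1"
  proof -
    have "c^4 = (c\<^sup>2)\<^sup>2" by simp
    also have "\<dots> = 1 / Nfun u w" unfolding c2 using N by (simp add: power_divide)
    finally show ?thesis using N by simp
  qed
  note u' = Hdot1D[OF u] and w' = Hdot1D[OF w]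
  have gu: "L2_grad (\<lambda>x. c * u x) (\<lambda>x. c *\<^sub>R grad u x)" and gw: "L2_grad (\<lambda>x. c * w x) (\<lambda>x. c *\<^sub>R grad w x)"
    using L2_grad_lincomb[OF u'(3) u'(3), of c 0] L2_grad_lincomb[OF w'(3) w'(3), of c 0] by simp_all
  have "(\<lambda>x. c * u x) \<in> Hdot1" "(\<lambda>x. c * w x) \<in> Hdot1"
    using u' w' by (auto intro!: Hdot1I[OF _ _ gu] Hdot1I[OF _ _ gw] simp: power_mult_distrib)
  moreover have N1: "Nfun (\<lambda>x. c * u x) (\<lambda>x. c * w x) = 1" using c4 by (simp add: Nfun_scale)
  ultimately have "Iinf \<le> Kfun (\<lambda>x. c * u x) (\<lambda>x. c * w x)" by (intro Iinf_le) (auto simp: NN_def)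
  also have "\<dots> = c\<^sup>2 * Kfun u w"
    unfolding Kfun_eq[OF gu gw] Kfun_eq[OF u'(3) w'(3)] by (simp add: power_mult_distrib algebra_simps)
  also have "\<dots> = Kfun u w / sqrt (Nfun u w)" by (simp add: c2)
  finally show ?thesis using N by (simp add: field_simps)
qed

section \<open>Compactness of minimizing sequences\<close>

lemma borel_imp_lebesgue: "f \<in> borel_measurable borel \<Longrightarrow> f \<in> borel_measurable lebesgue"
  by (intro measurable_completion) simp

lemma integrable_pow4I:
  fixes f :: "R4 \<Rightarrow> real"
  assumes f: "f \<in> borel_measurable borel" and "(pow4_integral f) \<le> ennreal A"
  shows "integrable lebesgue (\<lambda>x. (f x)^4)"
proof (rule integrableI_bounded)
  have "(\<integral>\<^sup>+x. ennreal (norm ((f x)^4)) \<partial>lebesgue) \<le> ennreal A"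
    using assms(2) by (simp add: nn_integral_completion)
  then show "(\<integral>\<^sup>+x. ennreal (norm ((f x)^4)) \<partial>lebesgue) < \<infinity>"
    by (rule le_less_trans) simp
qed (intro borel_measurable_power borel_imp_lebesgue f)

lemma Nfun_cong_AE:
  assumes "u \<in> borel_measurable lebesgue" "w \<in> borel_measurable lebesgue" "u' \<in> borel_measurable lebesgue" "w' \<in> borel_measurable lebesgue"
    and "AE x in lebesgue. u x = u' x" "AE x in lebesgue. w x = w' x"
  shows "Nfun u w = Nfun u' w'"
  unfolding Nfun_Fpoly
proof (rule integral_cong_AE)
  show "AE x in lebesgue. Fpoly (u x) (w x) = Fpoly (u' x) (w' x)"
    using assms(5,6) by eventually_elim simp
qed (intro Fpoly_borel assms)+

text \<open>The factor c^4 from homogeneity cancels the Jacobian c^-4 in dimension four.\<close>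

lemma Nfun_affine:
  assumes "u \<in> borel_measurable lebesgue" "w \<in> borel_measurable lebesgue" "0 < c"
  shows "Nfun (\<lambda>x. c * u (y + c *\<^sub>R x)) (\<lambda>x. c * w (y + c *\<^sub>R x)) = Nfun u w"
proof -
  have "(\<lambda>x. Fpoly (u x) (w x)) \<in> borel_measurable lebesgue" by (intro Fpoly_borel assms)
  from lebesgue_integral_affine(2)[OF this, of c y]
  have "Nfun (\<lambda>x. u (y + c *\<^sub>R x)) (\<lambda>x. w (y + c *\<^sub>R x)) = Nfun u w / c^4"
    using assms(3) unfolding Nfun_Fpoly by simp
  then show ?thesis using assms(3) by (simp add: Nfun_scale)
qed

text \<open>Fubini for translates needs joint measurability of u(x + h), which Borel functions
  provide. The chosen gradient of the original function is kept as a weak gradient of the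
  representative, so energies carry over unchanged.\<close>

lemma Hdot1_borel_representative:
  assumes "u \<in> Hdot1"
  obtains u' where "u' \<in> borel_measurable borel" "AE x in lebesgue. u x = u' x" "integrable lborel (\<lambda>x. (u' x)^4)"
    "L2_grad u' (grad u)"
proof -
  note u = Hdot1D[OF assms]
  obtain u' where u'[measurable]: "u' \<in> borel_measurable borel" and ae: "AE x in lborel. u x = u' x"
    using completion_ex_borel_measurable_real[OF u(1)] by auto
  have ae': "AE x in lebesgue. u x = u' x" using ae by (rule AE_completion)
  have ul: "u' \<in> borel_measurable lebesgue" by (rule borel_imp_lebesgue[OF u'])
  have "integrable lebesgue (\<lambda>x. (u' x)^4)"
  proof (rule integrable_cong_AE_imp[OF u(2)])
    show "AE x in lebesgue. (u x)^4 = (u' x)^4" using ae' by eventually_elim simp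
  qed (intro borel_measurable_power ul)
  then have "integrable lborel (\<lambda>x. (u' x)^4)"
    by (rule integrable_lebesgue_iff[OF borel_measurable_power[OF u'], THEN iffD1])
  then show ?thesis by (rule that[OF u' ae' _ L2_grad_cong_AE[OF u(3) ul ae']])
qed

text \<open>Taking absolute values does not increase translation increments. This makes the single
  function |a| + |b| accessible to the refined inequality without differentiating an absolute
  value.\<close>

lemma L2_grad_abs_sum_translation_bound:
  fixes h :: R4
  assumes [measurable]: "a \<in> borel_measurable borel" "b \<in> borel_measurable borel"
    and a4: "integrable lborel (\<lambda>x. (a x)^4)" and b4: "integrable lborel (\<lambda>x. (b x)^4)"
    and ga: "L2_grad a ga" and gb: "L2_grad b gb"
  shows "(\<integral>\<^sup>+x. ennreal (((\<bar>a (x + h)\<bar> + \<bar>b (x + h)\<bar>) - (\<bar>a x\<bar> + \<bar>b x\<bar>))\<^sup>2) \<partial>lborel)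
    \<le> ennreal (2 * ((energy ga) + (energy gb)) * (norm h)\<^sup>2)"
proof -
  let ?A = "energy ga" and ?B = "energy gb"
  have pt: "((\<bar>p\<bar> + \<bar>q\<bar>) - (\<bar>r\<bar> + \<bar>s\<bar>))\<^sup>2 \<le> 2 * (p - r)\<^sup>2 + 2 * (q - s)\<^sup>2" for p q r s :: real
  proof -
    have "((\<bar>p\<bar> + \<bar>q\<bar>) - (\<bar>r\<bar> + \<bar>s\<bar>))\<^sup>2 \<le> (\<bar>p - r\<bar> + \<bar>q - s\<bar>)\<^sup>2"
      by (subst abs_le_square_iff[symmetric]) linarith
    also have "\<dots> \<le> 2 * (p - r)\<^sup>2 + 2 * (q - s)\<^sup>2"
      using sum_squares_bound[of "\<bar>p - r\<bar>" "\<bar>q - s\<bar>"] by (simp add: power2_sum)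
    finally show ?thesis .
  qed
  have "(\<integral>\<^sup>+x. ennreal (((\<bar>a (x + h)\<bar> + \<bar>b (x + h)\<bar>) - (\<bar>a x\<bar> + \<bar>b x\<bar>))\<^sup>2) \<partial>lborel)
    \<le> (\<integral>\<^sup>+x. ennreal 2 * ennreal ((a (x + h) - a x)\<^sup>2) + ennreal 2 * ennreal ((b (x + h) - b x)\<^sup>2) \<partial>lborel)"
  proof (rule nn_integral_mono)
    fix x
    have "ennreal (((\<bar>a (x + h)\<bar> + \<bar>b (x + h)\<bar>) - (\<bar>a x\<bar> + \<bar>b x\<bar>))\<^sup>2) \<le> ennreal (2 * (a (x + h) - a x)\<^sup>2 + 2 * (b (x + h) - b x)\<^sup>2)"
      by (rule ennreal_leI[OF pt])
    then show "ennreal (((\<bar>a (x + h)\<bar> + \<bar>b (x + h)\<bar>) - (\<bar>a x\<bar> + \<bar>b x\<bar>))\<^sup>2)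
      \<le> ennreal 2 * ennreal ((a (x + h) - a x)\<^sup>2) + ennreal 2 * ennreal ((b (x + h) - b x)\<^sup>2)"
      by (simp add: ennreal_plus ennreal_mult)
  qed
  also have "\<dots> = ennreal 2 * (sq_diff a h) + ennreal 2 * (sq_diff b h)"
    by (subst nn_integral_add) (auto simp: nn_integral_cmult)
  also have "\<dots> \<le> ennreal 2 * ennreal ((norm h)\<^sup>2 * ?A) + ennreal 2 * ennreal ((norm h)\<^sup>2 * ?B)"
    using a4 b4 ga gb by (intro add_mono mult_left_mono L2_grad_translation_bound) auto
  also have "\<dots> = ennreal (2 * ((norm h)\<^sup>2 * ?A) + 2 * ((norm h)\<^sup>2 * ?B))"
    by (simp add: ennreal_plus ennreal_mult)
  also have "2 * ((norm h)\<^sup>2 * ?A) + 2 * ((norm h)\<^sup>2 * ?B) = 2 * (?A + ?B) * (norm h)\<^sup>2"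
    by (simp add: algebra_simps)
  finally show ?thesis .
qed

text \<open>If no cube exceeded the bound, the refined inequality with D = 2 M would give 1 = N
  \<le> 3 * 16384 * B^2 * 2 M = 98304 B^2 M < 1, where 3 is the constant of
  \<open>Fpoly_abs_le\<close>.\<close>

lemma nonvanishing:
  assumes [measurable]: "a \<in> borel_measurable borel" "b \<in> borel_measurable borel"
    and a4: "integrable lborel (\<lambda>x. (a x)^4)" and b4: "integrable lborel (\<lambda>x. (b x)^4)"
    and ga: "L2_grad a ga" and gb: "L2_grad b gb" and N: "Nfun a b = 1"
    and K: "(energy ga) + (energy gb) \<le> M"
    and B: "0 < B" "98304 * B\<^sup>2 * M < 1"
  shows "\<exists>x r. 0 < r \<and> ennreal (B / r) < (\<integral>\<^sup>+h. ennreal (\<bar>a (x + r *\<^sub>R h)\<bar> + \<bar>b (x + r *\<^sub>R h)\<bar>) \<partial>unif Q)"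
proof (rule ccontr)
  assume "\<not> ?thesis"
  then have avg: "(\<integral>\<^sup>+h. ennreal (\<bar>a (x + r *\<^sub>R h)\<bar> + \<bar>b (x + r *\<^sub>R h)\<bar>) \<partial>unif Q) \<le> ennreal (B / r)" if "0 < r" for x r
    using that by (meson not_less)
  let ?E = "energy ga + energy gb"
  have E0: "0 \<le> ?E" by simp
  have "(\<integral>\<^sup>+x. ennreal ((\<bar>a x\<bar> + \<bar>b x\<bar>)^4) \<partial>lborel) \<le> ennreal (16384 * B\<^sup>2 * (2 * ?E))"
  proof (rule refined_Sobolev[OF _ _ _ B(1)])
    show "(\<integral>\<^sup>+x. ennreal (((\<bar>a (x + h)\<bar> + \<bar>b (x + h)\<bar>) - (\<bar>a x\<bar> + \<bar>b x\<bar>))\<^sup>2) \<partial>lborel) \<le> ennreal (2 * ?E * (norm h)\<^sup>2)" for h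
      by (rule L2_grad_abs_sum_translation_bound[OF assms(1,2) a4 b4 ga gb])
  qed (use avg in auto)
  also have "\<dots> \<le> ennreal (16384 * B\<^sup>2 * (2 * M))"
    using K by (intro ennreal_leI mult_left_mono) auto
  finally have f4: "(\<integral>\<^sup>+x. ennreal ((\<bar>a x\<bar> + \<bar>b x\<bar>)^4) \<partial>lborel) \<le> ennreal (16384 * B\<^sup>2 * (2 * M))" .
  have Fi: "integrable lborel (\<lambda>x. Fpoly (a x) (b x))" using a4 b4 by (intro integrable_Fpoly) auto
  have "(\<integral>x. Fpoly (a x) (b x) \<partial>lborel) = 1"
    using N unfolding Nfun_Fpoly by (subst (asm) integral_lebesgue_eq) auto
  then have "1 = (\<integral>\<^sup>+x. ennreal (Fpoly (a x) (b x)) \<partial>lborel)"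
    by (subst nn_integral_eq_integral[OF Fi]) (auto simp: Fpoly_nonneg)
  also have "\<dots> \<le> (\<integral>\<^sup>+x. ennreal 3 * ennreal ((\<bar>a x\<bar> + \<bar>b x\<bar>)^4) \<partial>lborel)"
    by (intro nn_integral_mono, subst ennreal_mult[symmetric]) (auto intro!: ennreal_leI Fpoly_abs_le)
  also have "\<dots> = ennreal 3 * (\<integral>\<^sup>+x. ennreal ((\<bar>a x\<bar> + \<bar>b x\<bar>)^4) \<partial>lborel)"
    by (rule nn_integral_cmult) measurable
  also have "\<dots> \<le> ennreal 3 * ennreal (16384 * B\<^sup>2 * (2 * M))" by (rule mult_left_mono[OF f4]) simp
  also have "\<dots> = ennreal (98304 * B\<^sup>2 * M)"
    using order_trans[OF E0 K] by (subst ennreal_mult[symmetric]) (auto simp: mult_ac)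
  also have "\<dots> < ennreal 1" using B by (intro ennreal_lessI) auto
  finally show False by simp
qed

lemma Nfun_controls_L4:
  assumes [measurable]: "a \<in> borel_measurable lebesgue" "b \<in> borel_measurable lebesgue"
    and a4: "integrable lebesgue (\<lambda>x. (a x)^4)" and b4: "integrable lebesgue (\<lambda>x. (b x)^4)"
  shows "(\<integral>x. (a x)^4 \<partial>lebesgue) + (\<integral>x. (b x)^4 \<partial>lebesgue) \<le> 72 * Nfun a b"
proof -
  have "(\<integral>x. ((a x)^4 + (b x)^4) / 72 \<partial>lebesgue) \<le> Nfun a b"
    unfolding Nfun_Fpoly using a4 b4 by (intro integral_mono integrable_Fpoly Fpoly_lower) auto
  then show ?thesis using a4 b4 by simp
qed

text \<open>An energy below 1 / (98304 * 5^2) would force a cube with average above 5 / r. But N = 1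
  bounds the integral of (|a| + |b|)^4 by 8 * 72 = 576, hence the fourth power of the average by 576
  / r^4, and 5^4 = 625 is larger.\<close>

lemma Sobolev_lower_bound:
  assumes [measurable]: "a \<in> borel_measurable borel" "b \<in> borel_measurable borel"
    and a4: "integrable lborel (\<lambda>x. (a x)^4)" and b4: "integrable lborel (\<lambda>x. (b x)^4)"
    and ga: "L2_grad a ga" and gb: "L2_grad b gb" and N: "Nfun a b = 1"
  shows "1 / 2457600 \<le> (energy ga) + (energy gb)"
proof (rule ccontr)
  let ?E = "energy ga + energy gb"
  let ?f = "\<lambda>x. \<bar>a x\<bar> + \<bar>b x\<bar>"
  assume "\<not> 1 / 2457600 \<le> ?E"
  then have "98304 * 5\<^sup>2 * ?E < 1" by simp
  then obtain x r where r: "0 < r" and xr: "ennreal (5 / r) < (\<integral>\<^sup>+h. ennreal (?f (x + r *\<^sub>R h)) \<partial>unif Q)"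
    using nonvanishing[OF assms order_refl, of 5] by auto
  have [measurable]: "a \<in> borel_measurable lebesgue" "b \<in> borel_measurable lebesgue"
    by (rule borel_imp_lebesgue, measurable)+
  have l4: "integrable lebesgue (\<lambda>x. (a x)^4)" "integrable lebesgue (\<lambda>x. (b x)^4)"
    using a4 b4 by (auto simp: integrable_lebesgue_iff)
  have e4: "(\<integral>x. (a x)^4 \<partial>lebesgue) = (\<integral>x. (a x)^4 \<partial>lborel)" "(\<integral>x. (b x)^4 \<partial>lebesgue) = (\<integral>x. (b x)^4 \<partial>lborel)"
    by (intro integral_lebesgue_eq; measurable)+
  have ab: "(\<integral>x. (a x)^4 \<partial>lborel) + (\<integral>x. (b x)^4 \<partial>lborel) \<le> 72"
    using Nfun_controls_L4[of a b] l4 N e4 by simp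
  have "(\<integral>\<^sup>+x. ennreal ((?f x)^4) \<partial>lborel) \<le> (\<integral>\<^sup>+x. ennreal (8 * ((a x)^4 + (b x)^4)) \<partial>lborel)"
  proof (intro nn_integral_mono ennreal_leI)
    show "(?f x)^4 \<le> 8 * ((a x)^4 + (b x)^4)" for x using pow4_sum_le[of "\<bar>a x\<bar>" "\<bar>b x\<bar>"] by simp
  qed
  also have "\<dots> = ennreal (\<integral>x. 8 * ((a x)^4 + (b x)^4) \<partial>lborel)"
    using a4 b4 by (intro nn_integral_eq_integral) auto
  also have "\<dots> \<le> ennreal 576" using a4 b4 ab by (intro ennreal_leI) simp
  finally have f4: "(\<integral>\<^sup>+x. ennreal ((?f x)^4) \<partial>lborel) \<le> ennreal 576" .
  have fm: "?f \<in> borel_measurable borel" by measurable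
  note avi = avg_integrable[OF fm r _ f4, of x] and av4 = avg_pow4_le[OF fm r _ f4, of x]
  have "(\<integral>\<^sup>+h. ennreal (?f (x + r *\<^sub>R h)) \<partial>unif Q) = ennreal (avg r ?f x)"
    unfolding avg_def using avi by (intro nn_integral_eq_integral) auto
  with xr have "5 / r < avg r ?f x" using r by (simp add: ennreal_less_iff)
  then have "(5 / r)^4 < (avg r ?f x)^4" using r by (intro power_strict_mono) auto
  also have "\<dots> \<le> 576 / r^4" using av4 by simp
  finally show False using r by (simp add: power_divide divide_less_cancel)
qed

text \<open>The hypothesis supplies a competitor: a lower bound of a set passes to its real
  \<open>Inf\<close> only when the set is nonempty.\<close>

lemma Iinf_pos:
  assumes "(u, w) \<in> NN" "Nfun u w = 1"
  shows "0 < Iinf"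
proof -
  have "1 / 2457600 \<le> Iinf"
    unfolding Iinf_def
  proof (rule cInf_greatest)
    show "{Kfun u w |u w. (u, w) \<in> NN \<and> Nfun u w = 1} \<noteq> {}" using assms by blast
    fix k assume "k \<in> {Kfun u w |u w. (u, w) \<in> NN \<and> Nfun u w = 1}"
    then obtain a b where k: "k = Kfun a b" and ab: "a \<in> Hdot1" "b \<in> Hdot1" "Nfun a b = 1" by (auto simp: NN_def)
    obtain a' where a': "a' \<in> borel_measurable borel" "AE x in lebesgue. a x = a' x" "integrable lborel (\<lambda>x. (a' x)^4)" "L2_grad a' (grad a)"
      by (rule Hdot1_borel_representative[OF ab(1)]) (rule that)
    obtain b' where b': "b' \<in> borel_measurable borel" "AE x in lebesgue. b x = b' x" "integrable lborel (\<lambda>x. (b' x)^4)" "L2_grad b' (grad b)"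
      by (rule Hdot1_borel_representative[OF ab(2)]) (rule that)
    have "a' \<in> borel_measurable lebesgue" "b' \<in> borel_measurable lebesgue"
      by (rule borel_imp_lebesgue[OF a'(1)], rule borel_imp_lebesgue[OF b'(1)])
    then have "Nfun a' b' = 1"
      using Nfun_cong_AE[of a b a' b'] Hdot1D(1)[OF ab(1)] Hdot1D(1)[OF ab(2)] a'(2) b'(2) ab(3) by simp
    from Sobolev_lower_bound[OF a'(1) b'(1) a'(3) b'(3) a'(4) b'(4) this]
    show "1 / 2457600 \<le> k" using Kfun_eq[OF Hdot1D(3)[OF ab(1)] Hdot1D(3)[OF ab(2)]] k by simp
  qed
  then show ?thesis by linarith
qed

text \<open>Strict subadditivity of the square root: no mass \<open>1 - \<theta>\<close> can be left in the remainder.\<close>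

lemma mass_eq_1:
  fixes I \<theta> :: real
  assumes I: "0 < I" and \<theta>: "0 < \<theta>"
    and le: "\<And>e. 0 < e \<Longrightarrow> I * sqrt (max 0 (1 - \<theta> - e)) + I * sqrt \<theta> \<le> I + 2 * e"
  shows "\<theta> = 1"
proof -
  have t: "(\<lambda>n. 1 / real (Suc n)) \<longlonglongrightarrow> 0" by (rule LIMSEQ_Suc[OF lim_1_over_n])
  have "I * sqrt (max 0 (1 - \<theta> - 0)) + I * sqrt \<theta> \<le> I + 2 * 0"
  proof (rule LIMSEQ_le)
    show "(\<lambda>n. I * sqrt (max 0 (1 - \<theta> - 1 / real (Suc n))) + I * sqrt \<theta>) \<longlonglongrightarrow> I * sqrt (max 0 (1 - \<theta> - 0)) + I * sqrt \<theta>"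
      by (intro tendsto_intros t)
    show "(\<lambda>n. I + 2 * (1 / real (Suc n))) \<longlonglongrightarrow> I + 2 * 0" by (intro tendsto_intros t)
    have "I * sqrt (max 0 (1 - \<theta> - 1 / real (Suc n))) + I * sqrt \<theta> \<le> I + 2 * (1 / real (Suc n))" for n
      by (rule le) simp
    then show "\<exists>N. \<forall>n\<ge>N. I * sqrt (max 0 (1 - \<theta> - 1 / real (Suc n))) + I * sqrt \<theta> \<le> I + 2 * (1 / real (Suc n))" by blast
  qed
  then have "I * (sqrt (max 0 (1 - \<theta>)) + sqrt \<theta>) \<le> I * 1" by (simp add: algebra_simps)
  then have s: "sqrt (max 0 (1 - \<theta>)) + sqrt \<theta> \<le> 1" using I by (simp only: mult_le_cancel_left_pos)
  have "0 \<le> sqrt (max 0 (1 - \<theta>))" by simp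
  then have "sqrt \<theta> \<le> 1" using s by linarith
  then have "\<theta> \<le> 1" by simp
  moreover have "\<not> \<theta> < 1"
  proof
    assume 1: "\<theta> < 1"
    \<comment> \<open>Strictly between 0 and 1 a number lies below its square root, so the two roots
      would add up to more than 1.\<close>
    have "\<theta> < sqrt \<theta>" using 1 \<theta> by (intro real_less_rsqrt) (simp add: power2_eq_square)
    moreover have "1 - \<theta> < sqrt (1 - \<theta>)" using 1 \<theta> by (intro real_less_rsqrt) (simp add: power2_eq_square mult_less_cancel_left2)
    ultimately show False using s 1 by simp
  qed
  ultimately show ?thesis by simp
qed

theorem theorem3p11:
  fixes u w :: "nat \<Rightarrow> R4 \<Rightarrow> real"
  assumes inN: "\<And>m. (u m, w m) \<in> NN"
    and N1: "\<And>m. Nfun (u m) (w m) = 1"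
    and Klim: "(\<lambda>m. Kfun (u m) (w m)) \<longlonglongrightarrow> Iinf"
    and upos: "\<And>m. AE x in lebesgue. u m x \<ge> 0"
    and wpos: "\<And>m. AE x in lebesgue. w m x \<ge> 0"
  shows "\<exists>(r :: nat \<Rightarrow> nat) (R :: nat \<Rightarrow> real) (y :: nat \<Rightarrow> R4) v z.
           strict_mono r \<and> (\<forall>j. R j > 0) \<and>
           Hdot1_conv (\<lambda>j x. (1 / R j) * u (r j) ((1 / R j) *\<^sub>R (x - y j))) v \<and>
           Hdot1_conv (\<lambda>j x. (1 / R j) * w (r j) ((1 / R j) *\<^sub>R (x - y j))) z \<and>
           (v, z) \<in> NN \<and> Nfun v z = 1 \<and> Kfun v z = Iinf"
proof -

  \<comment> \<open>Borel representatives and the energy bound\<close>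
  have I: "0 < Iinf" by (rule Iinf_pos[OF inN N1])
  have uH: "u m \<in> Hdot1" and wH: "w m \<in> Hdot1" for m using inN[of m] by (auto simp: NN_def)
  have Keq: "Kfun (u m) (w m) = energy (grad (u m)) + energy (grad (w m))" for m
    by (rule Kfun_eq[OF Hdot1D(3)[OF uH] Hdot1D(3)[OF wH]])
  \<comment> \<open>The representative is tied to the gradient of the original function, so that the
    values of \<open>Kfun\<close> along the minimizing sequence need no recomputation.\<close>
  define rep where "rep f f' \<longleftrightarrow> f' \<in> borel_measurable borel \<and> (AE x in lebesgue. f x = f' x) \<and>
     integrable lborel (\<lambda>x. (f' x)^4) \<and> L2_grad f' (grad f)" for f f' :: "R4 \<Rightarrow> real"
  have rep_ex: "\<exists>f'. rep f f'" if "f \<in> Hdot1" for f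
    by (rule Hdot1_borel_representative[OF that]) (unfold rep_def, intro exI conjI)
  obtain ub where ub: "\<And>m. rep (u m) (ub m)"
    using choice[of "\<lambda>m. rep (u m)"] rep_ex[OF uH] by blast
  obtain wb where wb: "\<And>m. rep (w m) (wb m)"
    using choice[of "\<lambda>m. rep (w m)"] rep_ex[OF wH] by blast
  have ubm[measurable]: "ub m \<in> borel_measurable borel" and wbm[measurable]: "wb m \<in> borel_measurable borel"
    and ub4: "integrable lborel (\<lambda>x. (ub m x)^4)" and wb4: "integrable lborel (\<lambda>x. (wb m x)^4)"
    and gub: "L2_grad (ub m) (grad (u m))" and gwb: "L2_grad (wb m) (grad (w m))"
    and aeu: "AE x in lebesgue. u m x = ub m x" and aew: "AE x in lebesgue. w m x = wb m x" for m
    using ub[of m] wb[of m] unfolding rep_def by blast+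
  have ubl[measurable]: "ub m \<in> borel_measurable lebesgue" and wbl[measurable]: "wb m \<in> borel_measurable lebesgue" for m
    by (rule borel_imp_lebesgue, measurable)+
  have Nb: "Nfun (ub m) (wb m) = 1" for m
    using Nfun_cong_AE[OF Hdot1D(1)[OF uH] Hdot1D(1)[OF wH] ubl wbl aeu aew, of m] N1[of m] by simp
  obtain M where M': "\<And>m. norm (Kfun (u m) (w m)) \<le> M"
    using BseqE[OF convergent_imp_Bseq[OF convergentI[OF Klim]]] by blast
  have M: "Kfun (u m) (w m) \<le> M" for m using M'[of m] abs_le_D1 unfolding real_norm_def by blast
  have M0: "0 \<le> M" by (rule order_trans[OF _ M[of 0]]) (simp add: Kfun_def)

  \<comment> \<open>Scales and centres of cubes with nonvanishing average\<close>
  define B where "B = sqrt (1 / (98304 * (M + 1)))"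
  \<comment> \<open>With this \<open>B\<close> the critical product equals M / (M + 1).\<close>
  have B: "0 < B" "98304 * B\<^sup>2 * M < 1" using M0 by (auto simp: B_def field_simps)
  define NV where "NV m p \<longleftrightarrow> 0 < snd p \<and> ennreal (B / snd p) <
     (\<integral>\<^sup>+h. ennreal (\<bar>ub m (fst p + snd p *\<^sub>R h)\<bar> + \<bar>wb m (fst p + snd p *\<^sub>R h)\<bar>) \<partial>unif Q)" for m and p :: "R4 \<times> real"
  have "\<exists>p. NV m p" for m
  proof -
    have "(energy (grad (u m))) + (energy (grad (w m))) \<le> M"
      using M[of m] Keq[of m] by simp
    from nonvanishing[OF ubm wbm ub4 wb4 gub gwb Nb this B] obtain x r where
      "0 < r" "ennreal (B / r) < (\<integral>\<^sup>+h. ennreal (\<bar>ub m (x + r *\<^sub>R h)\<bar> + \<bar>wb m (x + r *\<^sub>R h)\<bar>) \<partial>unif Q)" by blast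
    then have "NV m (x, r)" by (simp add: NV_def)
    then show ?thesis by blast
  qed
  then obtain p where p: "\<And>m. NV m (p m)" using choice[of NV] by blast
  define c where "c m = fst (p m)" for m
  define \<rho> where "\<rho> m = snd (p m)" for m
  have \<rho>: "0 < \<rho> m"
    and nv: "ennreal (B / \<rho> m) < (\<integral>\<^sup>+h. ennreal (\<bar>ub m (c m + \<rho> m *\<^sub>R h)\<bar> + \<bar>wb m (c m + \<rho> m *\<^sub>R h)\<bar>) \<partial>unif Q)" for m
    using p[of m] unfolding NV_def c_def \<rho>_def by blast+

  \<comment> \<open>The rescaled pairs and their uniform bounds\<close>
  define vb where "vb m x = \<rho> m * ub m (c m + \<rho> m *\<^sub>R x)" for m x
  define zb where "zb m x = \<rho> m * wb m (c m + \<rho> m *\<^sub>R x)" for m x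
  define gv where "gv m x = (\<rho> m)\<^sup>2 *\<^sub>R grad (u m) (c m + \<rho> m *\<^sub>R x)" for m x
  define gz where "gz m x = (\<rho> m)\<^sup>2 *\<^sub>R grad (w m) (c m + \<rho> m *\<^sub>R x)" for m x
  have vbm[measurable]: "vb m \<in> borel_measurable borel" and zbm[measurable]: "zb m \<in> borel_measurable borel" for m
    unfolding vb_def[abs_def] zb_def[abs_def] by measurable
  have vbl[measurable]: "vb m \<in> borel_measurable lebesgue" and zbl[measurable]: "zb m \<in> borel_measurable lebesgue" for m
    by (rule borel_imp_lebesgue, measurable)+
  have gvb: "L2_grad (vb m) (gv m)" and Ev: "energy (gv m) = energy (grad (u m))" for m
    using L2_grad_affine[OF gub[of m] ubl[of m] \<rho>[of m], of "c m"] by (simp_all add: vb_def[abs_def] gv_def[abs_def])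
  have gzb: "L2_grad (zb m) (gz m)" and Ez: "energy (gz m) = energy (grad (w m))" for m
    using L2_grad_affine[OF gwb[of m] wbl[of m] \<rho>[of m], of "c m"] by (simp_all add: zb_def[abs_def] gz_def[abs_def])
  have KE: "Kfun (u m) (w m) = energy (gv m) + energy (gz m)" for m by (simp add: Keq Ev Ez)
  have EvM: "energy (gv m) \<le> M" and EzM: "energy (gz m) \<le> M" for m
  proof -
    have "0 \<le> energy (gv m)" "0 \<le> energy (gz m)" by simp_all
    then show "energy (gv m) \<le> M" "energy (gz m) \<le> M" using M[of m] KE[of m] by linarith+
  qed
  have Nvz: "Nfun (vb m) (zb m) = 1" for m
    using Nfun_affine[OF ubl[of m] wbl[of m] \<rho>[of m], of "c m"] Nb by (simp add: vb_def[abs_def] zb_def[abs_def])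
  have l4: "integrable lebesgue (\<lambda>x. (vb m x)^4)" "integrable lebesgue (\<lambda>x. (zb m x)^4)" for m
  proof -
    have *: "integrable lebesgue (\<lambda>x. (\<rho> m * f (c m + \<rho> m *\<^sub>R x))^4)" if [measurable]: "f \<in> borel_measurable borel" and "integrable lborel (\<lambda>x. (f x)^4)" for f :: "R4 \<Rightarrow> real"
    proof -
      have "integrable lebesgue (\<lambda>x. (f x)^4)" using that by (simp add: integrable_lebesgue_iff)
      then show ?thesis
        using integrable_lebesgue_affine[of "\<lambda>x. (f x)^4" "\<rho> m" "c m"] \<rho>[of m] by (simp add: power_mult_distrib)
    qed
    show "integrable lebesgue (\<lambda>x. (vb m x)^4)" "integrable lebesgue (\<lambda>x. (zb m x)^4)"
      unfolding vb_def zb_def using ub4 wb4 by (intro *; simp)+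
  qed
  have b72: "(\<integral>x. (vb m x)^4 \<partial>lebesgue) \<le> 72" "(\<integral>x. (zb m x)^4 \<partial>lebesgue) \<le> 72" for m
  proof -
    have "(\<integral>x. (vb m x)^4 \<partial>lebesgue) + (\<integral>x. (zb m x)^4 \<partial>lebesgue) \<le> 72"
      using Nfun_controls_L4[OF vbl[of m] zbl[of m] l4] Nvz[of m] by simp
    moreover have "0 \<le> (\<integral>x. (vb m x)^4 \<partial>lebesgue)" "0 \<le> (\<integral>x. (zb m x)^4 \<partial>lebesgue)" by simp_all
    ultimately show "(\<integral>x. (vb m x)^4 \<partial>lebesgue) \<le> 72" "(\<integral>x. (zb m x)^4 \<partial>lebesgue) \<le> 72" by linarith+
  qed
  have n72: "(pow4_integral (vb m)) \<le> ennreal 72" "(pow4_integral (zb m)) \<le> ennreal 72" for m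
  proof -
    have "(pow4_integral f) \<le> ennreal 72"
      if "integrable lebesgue (\<lambda>x. (f x)^4)" "(\<integral>x. (f x)^4 \<partial>lebesgue) \<le> 72" for f :: "R4 \<Rightarrow> real"
      unfolding nn_integral_completion[of lborel, symmetric]
      by (subst nn_integral_eq_integral[OF that(1)]) (use that(2) in \<open>auto intro!: ennreal_leI simp del: ennreal_numeral\<close>)
    from this[OF l4(1) b72(1)] this[OF l4(2) b72(2)]
    show "(pow4_integral (vb m)) \<le> ennreal 72" "(pow4_integral (zb m)) \<le> ennreal 72" .
  qed
  have tb: "(sq_diff f h) \<le> ennreal (M * (norm h)\<^sup>2)"
    if [measurable]: "f \<in> borel_measurable borel" and f4: "integrable lebesgue (\<lambda>x. (f x)^4)" and g: "L2_grad f g" and gM: "energy g \<le> M" for f g h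
  proof -
    have "integrable lborel (\<lambda>x. (f x)^4)" using f4 by (subst (asm) integrable_lebesgue_iff) auto
    from L2_grad_translation_bound[OF that(1) this g]
    have "(sq_diff f h) \<le> ennreal ((norm h)\<^sup>2 * energy g)" .
    also have "\<dots> \<le> ennreal (M * (norm h)\<^sup>2)" using mult_left_mono[OF gM, of "(norm h)\<^sup>2"] by (intro ennreal_leI) (simp add: mult.commute)
    finally show ?thesis .
  qed
  have tv: "(sq_diff (vb m) h) \<le> ennreal (M * (norm h)\<^sup>2)"
    and tz: "(sq_diff (zb m) h) \<le> ennreal (M * (norm h)\<^sup>2)" for m h
    by (rule tb[OF vbm l4(1) gvb EvM] tb[OF zbm l4(2) gzb EzM])+

  \<comment> \<open>Limits along a common subsequence\<close>
  have a72: "(0::real) \<le> 72" by simp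
  obtain r1 :: "nat \<Rightarrow> nat" and V where r1: "strict_mono r1" and Vm[measurable]: "V \<in> borel_measurable borel"
    and Vae: "AE x in lborel. (\<lambda>i. vb (r1 i) x) \<longlonglongrightarrow> V x" and V4: "(pow4_integral V) \<le> ennreal 72"
    and VL: "\<And>N e. 0 < e \<Longrightarrow> \<exists>i0. \<forall>i\<ge>i0. (\<integral>\<^sup>+x. ennreal (\<bar>vb (r1 i) x - V x\<bar> * indicator (cball 0 N) x) \<partial>lborel) \<le> ennreal e"
    by (rule Rellich[where v = vb, OF vbm a72 M0 n72(1) tv]) (rule that)
  \<comment> \<open>The second extraction runs inside the first, so the composed subsequence serves
    both components.\<close>
  obtain r2 :: "nat \<Rightarrow> nat" and Z where r2: "strict_mono r2" and Zm[measurable]: "Z \<in> borel_measurable borel"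
    and Zae: "AE x in lborel. (\<lambda>i. zb (r1 (r2 i)) x) \<longlonglongrightarrow> Z x" and Z4: "(pow4_integral Z) \<le> ennreal 72"
    and ZL: "\<And>N e. 0 < e \<Longrightarrow> \<exists>i0. \<forall>i\<ge>i0. (\<integral>\<^sup>+x. ennreal (\<bar>zb (r1 (r2 i)) x - Z x\<bar> * indicator (cball 0 N) x) \<partial>lborel) \<le> ennreal e"
    by (rule Rellich[where v = "\<lambda>m. zb (r1 m)", OF zbm a72 M0 n72(2) tz]) (rule that)
  define s where "s i = r1 (r2 i)" for i
  have s: "strict_mono s" using r1 r2 by (simp add: s_def strict_mono_def)
  have Vl[measurable]: "V \<in> borel_measurable lebesgue" and Zl[measurable]: "Z \<in> borel_measurable lebesgue"
    by (rule borel_imp_lebesgue, measurable)+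
  have Vi: "integrable lebesgue (\<lambda>x. (V x)^4)" and Zi: "integrable lebesgue (\<lambda>x. (Z x)^4)"
    by (rule integrable_pow4I[OF Vm V4], rule integrable_pow4I[OF Zm Z4])
  have aeV: "AE x in lebesgue. (\<lambda>i. vb (s i) x) \<longlonglongrightarrow> V x"
  proof (rule AE_completion)
    show "AE x in lborel. (\<lambda>i. vb (s i) x) \<longlonglongrightarrow> V x"
      using Vae
    proof eventually_elim
      case (elim x)
      from LIMSEQ_subseq_LIMSEQ[OF this r2] show ?case by (simp add: o_def s_def)
    qed
  qed
  have aeZ: "AE x in lebesgue. (\<lambda>i. zb (s i) x) \<longlonglongrightarrow> Z x"
    using AE_completion[OF Zae] by (simp add: s_def)
  have LV: "\<exists>i0. \<forall>i\<ge>i0. (\<integral>\<^sup>+x. ennreal (\<bar>vb (s i) x - V x\<bar> * indicator (cball 0 N) x) \<partial>lebesgue) \<le> ennreal e" if e: "0 < e" for N e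
  proof -
    obtain i0 where i0: "\<And>i. i \<ge> i0 \<Longrightarrow> (\<integral>\<^sup>+x. ennreal (\<bar>vb (r1 i) x - V x\<bar> * indicator (cball 0 N) x) \<partial>lborel) \<le> ennreal e"
      using VL[OF e] by blast
    then show ?thesis
      unfolding nn_integral_completion s_def using seq_suble[OF r2] order_trans by blast
  qed
  have LZ: "\<exists>i0. \<forall>i\<ge>i0. (\<integral>\<^sup>+x. ennreal (\<bar>zb (s i) x - Z x\<bar> * indicator (cball 0 N) x) \<partial>lebesgue) \<le> ennreal e" if e: "0 < e" for N e
    unfolding nn_integral_completion s_def by (rule ZL[OF e])
  obtain GV where GV: "L2_grad V GV" and GVle: "\<And>e. 0 < e \<Longrightarrow> \<exists>m0. \<forall>m\<ge>m0. energy (\<lambda>x. gv (s m) x - GV x) + energy GV \<le> energy (gv (s m)) + e"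
    by (rule L2_grad_lower_semicontinuity[where u = "\<lambda>i. vb (s i)" and g = "\<lambda>i. gv (s i)", OF vbl gvb EvM Vl Vi LV]) (assumption, rule that)
  obtain GZ where GZ: "L2_grad Z GZ" and GZle: "\<And>e. 0 < e \<Longrightarrow> \<exists>m0. \<forall>m\<ge>m0. energy (\<lambda>x. gz (s m) x - GZ x) + energy GZ \<le> energy (gz (s m)) + e"
    by (rule L2_grad_lower_semicontinuity[where u = "\<lambda>i. zb (s i)" and g = "\<lambda>i. gz (s i)", OF zbl gzb EzM Zl Zi LZ]) (assumption, rule that)
  have VH: "V \<in> Hdot1" by (rule Hdot1I[OF Vl Vi GV])
  have ZH: "Z \<in> Hdot1" by (rule Hdot1I[OF Zl Zi GZ])
  have KVZ: "Kfun V Z = energy GV + energy GZ" by (rule Kfun_eq[OF GV GZ])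
  define \<theta> where "\<theta> = Nfun V Z"

  \<comment> \<open>Nontriviality of the limit\<close>
  have mass: "ennreal B < (\<integral>\<^sup>+h. ennreal (\<bar>vb m h\<bar> + \<bar>zb m h\<bar>) \<partial>unif Q)" for m
  proof (rule ccontr)
    let ?X = "\<integral>\<^sup>+h. ennreal (\<bar>ub m (c m + \<rho> m *\<^sub>R h)\<bar> + \<bar>wb m (c m + \<rho> m *\<^sub>R h)\<bar>) \<partial>unif Q"
    assume "\<not> ?thesis"
    then have "(\<integral>\<^sup>+h. ennreal (\<bar>vb m h\<bar> + \<bar>zb m h\<bar>) \<partial>unif Q) \<le> ennreal B" by simp
    moreover have "(\<integral>\<^sup>+h. ennreal (\<bar>vb m h\<bar> + \<bar>zb m h\<bar>) \<partial>unif Q) = ennreal (\<rho> m) * ?X"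
    proof -
      have "ennreal (\<bar>vb m h\<bar> + \<bar>zb m h\<bar>) = ennreal (\<rho> m) * ennreal (\<bar>ub m (c m + \<rho> m *\<^sub>R h)\<bar> + \<bar>wb m (c m + \<rho> m *\<^sub>R h)\<bar>)" for h
        using \<rho>[of m] by (subst ennreal_mult[symmetric]) (auto simp: vb_def zb_def abs_mult algebra_simps)
      then show ?thesis by (simp add: nn_integral_cmult)
    qed
    ultimately have "ennreal (1 / \<rho> m) * (ennreal (\<rho> m) * ?X) \<le> ennreal (1 / \<rho> m) * ennreal B"
      by (intro mult_left_mono) auto
    moreover have "ennreal (1 / \<rho> m) * (ennreal (\<rho> m) * ?X) = ?X"
      using \<rho>[of m] by (subst mult.assoc[symmetric], subst ennreal_mult[symmetric]) auto
    moreover have "ennreal (1 / \<rho> m) * ennreal B = ennreal (B / \<rho> m)"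
      using \<rho>[of m] B by (subst ennreal_mult[symmetric]) auto
    ultimately show False using nv[of m] by simp
  qed
  have \<theta>: "0 < \<theta>"
  proof (rule ccontr)
    assume "\<not> 0 < \<theta>"
    then have "Nfun V Z = 0" using Nfun_nonneg[of V Z] by (simp add: \<theta>_def)
    then have "AE x in lebesgue. Fpoly (V x) (Z x) = 0"
      unfolding Nfun_Fpoly
      by (subst (asm) integral_nonneg_eq_0_iff_AE) (auto intro!: integrable_Fpoly Vi Zi simp: Fpoly_nonneg)
    then have ae0: "AE x in lebesgue. V x = 0 \<and> Z x = 0"
    proof eventually_elim
      case (elim x)
      then have "(V x)^4 + (Z x)^4 \<le> 0" using Fpoly_lower[of "V x" "Z x"] by simp
      moreover have "0 \<le> (V x)^4" "0 \<le> (Z x)^4" by simp_all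
      ultimately have "(V x)^4 = 0" "(Z x)^4 = 0" by linarith+
      then show ?case by simp
    qed
    \<comment> \<open>If both limits vanished, local L^1 convergence would leave at most B / 2 per
      component on the ball of radius 2. That ball contains the unit cube, whose diagonal has length
      2, and the mass there exceeds B.\<close>
    have "0 < B / 2" using B by simp
    then obtain i j where i: "\<And>k. k \<ge> i \<Longrightarrow> (\<integral>\<^sup>+x. ennreal (\<bar>vb (s k) x - V x\<bar> * indicator (cball 0 2) x) \<partial>lebesgue) \<le> ennreal (B / 2)"
      and j: "\<And>k. k \<ge> j \<Longrightarrow> (\<integral>\<^sup>+x. ennreal (\<bar>zb (s k) x - Z x\<bar> * indicator (cball 0 2) x) \<partial>lebesgue) \<le> ennreal (B / 2)"
      using LV[of "B/2" 2] LZ[of "B/2" 2] by blast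
    let ?k = "s (max i j)"
    have QB: "h \<in> cball 0 2" if "h \<in> Q" for h
    proof -
      have "(norm h)\<^sup>2 \<le> 2\<^sup>2" using unit_cube_norm[OF that] by simp
      then have "norm h \<le> 2" by (rule power2_le_imp_le) simp
      then show ?thesis by simp
    qed
    have [measurable]: "cball 0 2 \<in> sets (lebesgue :: R4 measure)" by (rule lmeasurable_cball[THEN fmeasurableD])
    have mm: "(\<lambda>x. ennreal (\<bar>f x - g x\<bar> * indicator (cball 0 2) x)) \<in> borel_measurable lebesgue"
      if [measurable]: "f \<in> borel_measurable lebesgue" "g \<in> borel_measurable lebesgue" for f g :: "R4 \<Rightarrow> real"
      by measurable
    have "(\<integral>\<^sup>+h. ennreal (\<bar>vb ?k h\<bar> + \<bar>zb ?k h\<bar>) \<partial>unif Q) = (\<integral>\<^sup>+h. indicator Q h * ennreal (\<bar>vb ?k h\<bar> + \<bar>zb ?k h\<bar>) \<partial>lebesgue)"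
      unfolding nn_integral_completion by (rule nn_integral_unif[OF unit_cube(1)]) measurable
    also have "\<dots> \<le> (\<integral>\<^sup>+x. ennreal (\<bar>vb ?k x - V x\<bar> * indicator (cball 0 2) x) + ennreal (\<bar>zb ?k x - Z x\<bar> * indicator (cball 0 2) x) \<partial>lebesgue)"
    proof (rule nn_integral_mono_AE)
      show "AE h in lebesgue. indicator Q h * ennreal (\<bar>vb ?k h\<bar> + \<bar>zb ?k h\<bar>)
        \<le> ennreal (\<bar>vb ?k h - V h\<bar> * indicator (cball 0 2) h) + ennreal (\<bar>zb ?k h - Z h\<bar> * indicator (cball 0 2) h)"
        using ae0
      proof eventually_elim
        case (elim h)
        then show ?case using QB[of h] by (cases "h \<in> Q") (simp_all add: ennreal_plus del: mem_cball)
      qed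
    qed
    also have "\<dots> = (\<integral>\<^sup>+x. ennreal (\<bar>vb ?k x - V x\<bar> * indicator (cball 0 2) x) \<partial>lebesgue) + (\<integral>\<^sup>+x. ennreal (\<bar>zb ?k x - Z x\<bar> * indicator (cball 0 2) x) \<partial>lebesgue)"
      by (intro nn_integral_add mm vbl zbl Vl Zl)
    also have "\<dots> \<le> ennreal (B / 2) + ennreal (B / 2)" by (intro add_mono i j) auto
    also have "\<dots> = ennreal B" using B by (simp flip: ennreal_plus)
    finally show False using mass[of ?k] by simp
  qed

  \<comment> \<open>Splitting of energy and mass\<close>
  define n where "n i = Nfun (\<lambda>x. vb (s i) x - V x) (\<lambda>x. zb (s i) x - Z x)" for i
  define d where "d i = energy (\<lambda>x. gv (s i) x - GV x) + energy (\<lambda>x. gz (s i) x - GZ x)" for i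
  have nd: "Iinf * sqrt (n i) \<le> d i" for i
  proof -
    have g1: "L2_grad (\<lambda>x. vb (s i) x - V x) (\<lambda>x. gv (s i) x - GV x)" and g2: "L2_grad (\<lambda>x. zb (s i) x - Z x) (\<lambda>x. gz (s i) x - GZ x)"
      using L2_grad_lincomb[OF gvb[of "s i"] GV, of 1 "-1"] L2_grad_lincomb[OF gzb[of "s i"] GZ, of 1 "-1"] by simp_all
    have "(\<lambda>x. vb (s i) x - V x) \<in> Hdot1" "(\<lambda>x. zb (s i) x - Z x) \<in> Hdot1"
      using integrable_pow4_lincomb[OF vbl[of "s i"] Vl l4(1) Vi, of 1 "-1"] integrable_pow4_lincomb[OF zbl[of "s i"] Zl l4(2) Zi, of 1 "-1"]
      by (auto intro!: Hdot1I[OF _ _ g1] Hdot1I[OF _ _ g2])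
    from Kfun_ge_sqrt_Nfun[OF this] show ?thesis unfolding Kfun_eq[OF g1 g2] n_def d_def .
  qed
  have KI: "Iinf * sqrt \<theta> \<le> Kfun V Z" unfolding \<theta>_def by (rule Kfun_ge_sqrt_Nfun[OF VH ZH])
  have Ks: "(\<lambda>i. Kfun (u (s i)) (w (s i))) \<longlonglongrightarrow> Iinf"
    using LIMSEQ_subseq_LIMSEQ[OF Klim s] by (simp add: o_def)
  \<comment> \<open>The error 2 e consists of e / 2 for each component and e for the convergence of
    \<open>Kfun\<close> to the infimum.\<close>
  have split: "\<forall>\<^sub>F i in sequentially. d i + Kfun V Z \<le> Iinf + 2 * e" if e: "0 < e" for e
  proof -
    have "\<forall>\<^sub>F i in sequentially. energy (\<lambda>x. gv (s i) x - GV x) + energy GV \<le> energy (gv (s i)) + e / 2"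
      "\<forall>\<^sub>F i in sequentially. energy (\<lambda>x. gz (s i) x - GZ x) + energy GZ \<le> energy (gz (s i)) + e / 2"
      using GVle[of "e/2"] GZle[of "e/2"] e by (auto simp: eventually_sequentially)
    moreover have "\<forall>\<^sub>F i in sequentially. Kfun (u (s i)) (w (s i)) < Iinf + e"
      using Ks e by (intro order_tendstoD(2)) auto
    ultimately show ?thesis
    proof eventually_elim
      case (elim i)
      then show ?case unfolding d_def KVZ using KE[of "s i"] by linarith
    qed
  qed
  have "\<theta> = 1"
  proof (rule mass_eq_1[OF I \<theta>])
    fix e :: real assume e: "0 < e"
    have "\<exists>i0. \<forall>i\<ge>i0. Nfun (vb (s i)) (zb (s i)) \<le> n i + \<theta> + e"
      unfolding n_def \<theta>_def by (rule Nfun_Brezis_Lieb[OF vbl zbl Vl Zl l4 b72 Vi Zi aeV aeZ e])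
    then have "\<forall>\<^sub>F i in sequentially. 1 \<le> n i + \<theta> + e" by (simp add: eventually_sequentially Nvz)
    then obtain i where i: "1 \<le> n i + \<theta> + e" "d i + Kfun V Z \<le> Iinf + 2 * e"
      using eventually_happens'[OF sequentially_bot eventually_conj[OF _ split[OF e]]] by blast
    \<comment> \<open>Mass splitting gives n i \<ge> 1 - \<theta> - e, whose right side may be
      negative; nonnegativity of n i allows the maximum with 0 under the root.\<close>
    have "0 \<le> n i" unfolding n_def by (rule Nfun_nonneg)
    then have "Iinf * sqrt (max 0 (1 - \<theta> - e)) \<le> Iinf * sqrt (n i)"
      using I i(1) by (intro mult_left_mono real_sqrt_le_mono) auto
    then show "Iinf * sqrt (max 0 (1 - \<theta> - e)) + Iinf * sqrt \<theta> \<le> Iinf + 2 * e"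
      using nd[of i] KI i(2) by linarith
  qed

  \<comment> \<open>Minimality of the limit and strong convergence\<close>
  then have N1': "Nfun V Z = 1" and KI': "Iinf \<le> Kfun V Z" using KI by (auto simp: \<theta>_def)
  have d0: "0 \<le> d i" for i unfolding d_def by simp
  have KVI: "Kfun V Z = Iinf"
  proof (rule antisym[OF field_le_epsilon KI'])
    fix e :: real assume e: "0 < e"
    then obtain i where "d i + Kfun V Z \<le> Iinf + 2 * (e / 2)"
      using eventually_happens'[OF sequentially_bot split[of "e/2"]] by auto
    then show "Kfun V Z \<le> Iinf + e" using d0[of i] by simp
  qed
  have dlim: "d \<longlonglongrightarrow> 0"
  proof (rule tendstoI)
    fix e :: real assume e: "0 < e"
    then have "\<forall>\<^sub>F i in sequentially. d i + Kfun V Z \<le> Iinf + 2 * (e / 4)" by (intro split) simp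
    then show "\<forall>\<^sub>F i in sequentially. dist (d i) 0 < e"
    proof eventually_elim
      case (elim i)
      then show ?case using d0[of i] KVI e by (simp add: dist_real_def)
    qed
  qed
  \<comment> \<open>The scale enters the claim inversely: with R = 1 / \<rho> and y = - c / \<rho>,
    the expression R^-1 u(R^-1 (x - y)) is \<rho> u(c + \<rho> x). The chosen \<open>grad\<close> of
    a rescaled function agrees with the rescaled gradient only almost everywhere, so the energies
    are compared as integrals.\<close>
  have rescale: "Hdot1_conv (\<lambda>j x. (1 / (1 / \<rho> (s j))) * f (s j) ((1 / (1 / \<rho> (s j))) *\<^sub>R (x - (- (1 / \<rho> (s j))) *\<^sub>R c (s j)))) F"
    if f: "\<And>m. f m \<in> Hdot1" and G: "L2_grad F G"
      and lim: "(\<lambda>i. energy (\<lambda>x. (\<rho> (s i))\<^sup>2 *\<^sub>R grad (f (s i)) (c (s i) + \<rho> (s i) *\<^sub>R x) - G x)) \<longlonglongrightarrow> 0" for f F G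
  proof -
    let ?g = "\<lambda>j x. (\<rho> (s j))\<^sup>2 *\<^sub>R grad (f (s j)) (c (s j) + \<rho> (s j) *\<^sub>R x)"
    let ?f = "\<lambda>j x. (1 / (1 / \<rho> (s j))) * f (s j) ((1 / (1 / \<rho> (s j))) *\<^sub>R (x - (- (1 / \<rho> (s j))) *\<^sub>R c (s j)))"
    have "?f j = (\<lambda>x. \<rho> (s j) * f (s j) (c (s j) + \<rho> (s j) *\<^sub>R x))" for j
      using \<rho>[of "s j"] by (simp add: scaleR_right_distrib add.commute)
    then have g: "L2_grad (?f j) (?g j)" for j
      using L2_grad_affine(1)[OF Hdot1D(3)[OF f[of "s j"]] Hdot1D(1)[OF f[of "s j"]] \<rho>[of "s j"], of "c (s j)"] by simp
    have "energy (\<lambda>x. grad (?f j) x - grad F x) = energy (\<lambda>x. ?g j x - G x)" for j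
    proof (rule integral_cong_AE)
      have nm: "(\<lambda>x. (norm (k x - l x))\<^sup>2) \<in> borel_measurable lebesgue"
        if [measurable]: "k \<in> borel_measurable lebesgue" "l \<in> borel_measurable lebesgue" for k l :: "R4 \<Rightarrow> R4"
        by measurable
      have m: "k \<in> borel_measurable lebesgue" if "L2_grad f k" for f k using that by (simp add: L2_grad_def)
      show "(\<lambda>x. (norm (grad (?f j) x - grad F x))\<^sup>2) \<in> borel_measurable lebesgue"
        by (rule nm[OF m[OF L2_grad_grad[OF g]] m[OF L2_grad_grad[OF G]]])
      show "(\<lambda>x. (norm (?g j x - G x))\<^sup>2) \<in> borel_measurable lebesgue"
        by (rule nm[OF m[OF g] m[OF G]])
      show "AE x in lebesgue. (norm (grad (?f j) x - grad F x))\<^sup>2 = (norm (?g j x - G x))\<^sup>2"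
        using grad_AE[OF g[of j]] grad_AE[OF G] by eventually_elim simp
    qed
    then show ?thesis unfolding Hdot1_conv_def using lim by simp
  qed
  have Ev0: "(\<lambda>i. energy (\<lambda>x. gv (s i) x - GV x)) \<longlonglongrightarrow> 0"
    by (rule tendsto_sandwich[OF _ _ tendsto_const dlim]) (auto simp: d_def)
  have Ez0: "(\<lambda>i. energy (\<lambda>x. gz (s i) x - GZ x)) \<longlonglongrightarrow> 0"
    by (rule tendsto_sandwich[OF _ _ tendsto_const dlim]) (auto simp: d_def)
  have "Hdot1_conv (\<lambda>j x. (1 / (1 / \<rho> (s j))) * u (s j) ((1 / (1 / \<rho> (s j))) *\<^sub>R (x - (- (1 / \<rho> (s j))) *\<^sub>R c (s j)))) V"
    by (rule rescale[OF uH GV]) (use Ev0 in \<open>simp add: gv_def\<close>)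
  moreover have "Hdot1_conv (\<lambda>j x. (1 / (1 / \<rho> (s j))) * w (s j) ((1 / (1 / \<rho> (s j))) *\<^sub>R (x - (- (1 / \<rho> (s j))) *\<^sub>R c (s j)))) Z"
    by (rule rescale[OF wH GZ]) (use Ez0 in \<open>simp add: gz_def\<close>)
  moreover have "\<forall>j. 0 < 1 / \<rho> (s j)" using \<rho> by simp
  moreover have "(V, Z) \<in> NN" using VH ZH N1' by (simp add: NN_def)
  ultimately show ?thesis
    using s N1' KVI
    by (intro exI[of _ s] exI[of _ "\<lambda>j. 1 / \<rho> (s j)"] exI[of _ "\<lambda>j. (- (1 / \<rho> (s j))) *\<^sub>R c (s j)"] exI[of _ V] exI[of _ Z] conjI)
qed

end
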